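(* The second-order field $\Gamma$ represents (locally) a gyroscopic system, i.e. there exist (locally) a regular function $L$ and a basic 2-form $\omega$ with components $\omega_{ki}(q)=-\omega_{ik}(q)$ such that the equations $$\frac{d}{dt}\left(\frac{\partial L}{\partial \dot q^i}\right)-\frac{\partial L}{\partial q^i}=\omega_{ki}(q)\dot q^k$$ are equivalent to $\ddot q^i=f^i(q,\dot q)$, if and only if there exist (locally) a basic 2-form $\omega$ and a non-singular symmetric type $(0,2)$ tensor field $g$ along $\tau$ such that $D^Vg$ is symmetric and $g$ and $\omega$ further satisfy $$\nabla g=0,\qquad \Phi\lrcorner g-(\Phi\lrcorner g)^T=i_{\mathbf T}d^H\omega,$$ where $\Phi$ is the Jacobi endomorphism of $\Gamma$.
   Context: All objects are smooth; the summation convention is used. $Q$ is an $n$-dimensional manifold, $\tau:TQ\to Q$ its tangent bundle, with local coordinates $q^i$ on $Q$ and induced coordinates $(q^i,v^i)$ on $TQ$ ($v^i=\dot q^i$ along curves). $\Gamma=v^i\frac{\partial}{\partial q^i}+f^i(q,v)\frac{\partial}{\partial v^i}$ is a given second-order vector field on $TQ$, corresponding to $\ddot q^i=f^i(q,\dot q)$. Two systems of equations are equivalent if they have the same solutions. A function $L$ is regular if the matrix $\left(\frac{\partial^2L}{\partial v^i\partial v^j}\right)$ is everywhere non-singular. "Locally" means: every point of $Q$ has an open neighbourhood $U$ such that the objects in question exist on $TU$ (tensor fields along $\tau|_{TU}$; basic forms on $U$). Tensor fields and forms along $\tau$ are sections over $TQ$ of the pull-backs by $\tau$ of the tensor/exterior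 bundles of $Q$; in coordinates they are expressed in terms of $\frac{\partial}{\partial q^i}$, $dq^i$ with coefficients that are functions on $TQ$. A form along $\tau$ is basic if it is (the pull-back of) a form on $Q$. The components of a 2-form are given by $\omega=\frac12\omega_{ij}dq^i\wedge dq^j$. $\mathbf T=v^i\frac{\partial}{\partial q^i}$ is the canonical vector field along $\tau$ (the identity map of $TQ$), and $i_{\mathbf T}$ is insertion of $\mathbf T$ in the first argument, so $i_{\mathbf T}\omega=\omega_{ki}v^kdq^i$. Put $\Gamma^j_i=-\frac12\frac{\partial f^j}{\partial v^i}$, $V_i=\frac{\partial}{\partial v^i}$, $H_i=\frac{\partial}{\partial q^i}-\Gamma^j_i\frac{\partial}{\partial v^j}$. $d^H$ is the degree 1 derivation of the algebra of forms along $\tau$ determined by $d^HF=H_i(F)dq^i$ for $F\in C^\infty(TQ)$ and $d^Hdq^i=0$; on basic forms it is the ordinary exterior derivative. For $X=X^i\frac{\partial}{\partial q^i}$ along $\tau$, $D^V_X$ is the degree 0 tensor derivation with $D^V_XF=X^iV_i(F)$, $D^V_X\frac{\partial}{\partial q^i}=0$, $D^V_Xdq^i=0$, and $D^Vg(X,Y,Z)=(D^V_Xg)(Y,Z)$. "$D^Vg$ is symmetric" means symmetric in all its arguments. Dynamical covariant derivative: $\nabla$ is the degree 0 tensor derivation with $\nabla F=\Gamma(F)$, $\nabla\frac{\partial}{\partial q^j}=\Gamma^i_j\frac{\partial}{\partial q^i}$, $\nabla dq^i=-\Gamma^i_jdq^j$. Jacobi endomorphism: the type $(1,1)$ tensor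 field $\Phi=\Phi^i_j\,dq^j\otimes\frac{\partial}{\partial q^i}$ along $\tau$ with $\Phi^i_j=-\frac{\partial f^i}{\partial q^j}-\Gamma^k_j\Gamma^i_k-\Gamma(\Gamma^i_j)$. $(\Phi\lrcorner g-(\Phi\lrcorner g)^T)(X,Y):=g(\Phi X,Y)-g(X,\Phi Y)$. *)

theory Defs
  imports "HOL-Analysis.Analysis"
begin

section \<open>Smooth functions and smooth manifolds\<close>

primrec higher_differentiable_on ::
  "'a::real_normed_vector set \<Rightarrow> ('a \<Rightarrow> 'b::real_normed_vector) \<Rightarrow> nat \<Rightarrow> bool" where
  "higher_differentiable_on S F 0 \<longleftrightarrow> continuous_on S F"
| "higher_differentiable_on S F (Suc k) \<longleftrightarrow>
     (\<forall>x\<in>S. F differentiable (at x)) \<and>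
     (\<forall>v. higher_differentiable_on S (\<lambda>x. frechet_derivative F (at x) v) k)"

text \<open>Only used for open \<open>S\<close>.\<close>

definition smooth_on :: "'a::real_normed_vector set \<Rightarrow> ('a \<Rightarrow> 'b::real_normed_vector) \<Rightarrow> bool" where
  "smooth_on S F \<longleftrightarrow> (\<forall>k. higher_differentiable_on S F k)"

text \<open>A chart is a pair of its domain and its coordinate map; the dimension is \<open>CARD('n)\<close>.\<close>

type_synonym ('q, 'n) chart = "'q set \<times> ('q \<Rightarrow> real ^ 'n)"

definition transition :: "('q, 'n::finite) chart \<Rightarrow> ('q, 'n) chart \<Rightarrow> real ^ 'n \<Rightarrow> real ^ 'n" where
  "transition c d = (\<lambda>x. snd d (inv_into (fst c) (snd c) x))"

definition smooth_atlas :: "'q topology \<Rightarrow> ('q, 'n::finite) chart set \<Rightarrow> bool" where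
  "smooth_atlas Q A \<longleftrightarrow>
     Hausdorff_space Q \<and> second_countable Q \<and>
     (\<Union>c\<in>A. fst c) = topspace Q \<and>
     (\<forall>c\<in>A. openin Q (fst c) \<and> open (snd c ` fst c) \<and>
        homeomorphic_map (subtopology Q (fst c)) (top_of_set (snd c ` fst c)) (snd c)) \<and>
     (\<forall>c\<in>A. \<forall>d\<in>A. smooth_on (snd c ` (fst c \<inter> fst d)) (transition c d))"

text \<open>
  A point of \<open>TQ\<close> is given in a chart by its coordinates \<open>(q, v)\<close>. The change of these
  coordinates is the tangent map of the transition map. A geometric object over \<open>TU\<close>
  (or over \<open>U\<close>) is represented by the family, indexed by the charts \<open>c\<close> of the atlas, of
  its coordinate expressions, subject to the appropriate transformation law.
  Values outside the coordinate domains below are irrelevant.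
\<close>

type_synonym 'n tcoord = "(real ^ 'n) \<times> (real ^ 'n)"

definition base_coords :: "'q set \<Rightarrow> ('q, 'n::finite) chart \<Rightarrow> (real ^ 'n) set" where
  "base_coords U c = snd c ` (U \<inter> fst c)"

definition tangent_coords :: "'q set \<Rightarrow> ('q, 'n::finite) chart \<Rightarrow> 'n tcoord set" where
  "tangent_coords U c = base_coords U c \<times> UNIV"

definition jacobian_map ::
  "('q, 'n::finite) chart \<Rightarrow> ('q, 'n) chart \<Rightarrow> real ^ 'n \<Rightarrow> real ^ 'n \<Rightarrow> real ^ 'n" where
  "jacobian_map c d x = frechet_derivative (transition c d) (at x)"

definition tangent_transition ::
  "('q, 'n::finite) chart \<Rightarrow> ('q, 'n) chart \<Rightarrow> 'n tcoord \<Rightarrow> 'n tcoord" where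
  "tangent_transition c d = (\<lambda>(x, v). (transition c d x, jacobian_map c d x v))"

section \<open>Objects on \<open>TU\<close> and along the tangent bundle projection\<close>

text \<open>
  The second-order vector field with coefficients \<open>f\<close> has components \<open>(v, f(q, v))\<close>; the
  second clause says that it is transformed as a vector field on \<open>TQ\<close>.
\<close>

definition second_order_field ::
  "'q topology \<Rightarrow> ('q, 'n::finite) chart set \<Rightarrow> (('q, 'n) chart \<Rightarrow> 'n tcoord \<Rightarrow> real ^ 'n) \<Rightarrow> bool"
where
  "second_order_field Q A f \<longleftrightarrow>
     (\<forall>c\<in>A. smooth_on (tangent_coords (topspace Q) c) (f c)) \<and>
     (\<forall>c\<in>A. \<forall>d\<in>A. \<forall>z\<in>tangent_coords (fst d) c.
        frechet_derivative (tangent_transition c d) (at z) (snd z, f c z) =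
          (snd (tangent_transition c d z), f d (tangent_transition c d z)))"

definition tangent_function ::
  "('q, 'n::finite) chart set \<Rightarrow> 'q set \<Rightarrow> (('q, 'n) chart \<Rightarrow> 'n tcoord \<Rightarrow> real) \<Rightarrow> bool" where
  "tangent_function A U L \<longleftrightarrow>
     (\<forall>c\<in>A. smooth_on (tangent_coords U c) (L c)) \<and>
     (\<forall>c\<in>A. \<forall>d\<in>A. \<forall>z\<in>tangent_coords (U \<inter> fst d) c. L c z = L d (tangent_transition c d z))"

text \<open>The value on two vectors of the type (0,2) tensor with component matrix \<open>M\<close>.\<close>

definition tensor_val :: "real ^ 'n ^ 'n \<Rightarrow> real ^ 'n \<Rightarrow> real ^ 'n::finite \<Rightarrow> real" where
  "tensor_val M X Y = (\<Sum>i\<in>UNIV. \<Sum>j\<in>UNIV. M $ i $ j * X $ i * Y $ j)"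

definition tensor02_along ::
  "('q, 'n::finite) chart set \<Rightarrow> 'q set \<Rightarrow> (('q, 'n) chart \<Rightarrow> 'n tcoord \<Rightarrow> real ^ 'n ^ 'n) \<Rightarrow> bool"
where
  "tensor02_along A U g \<longleftrightarrow>
     (\<forall>c\<in>A. smooth_on (tangent_coords U c) (g c)) \<and>
     (\<forall>c\<in>A. \<forall>d\<in>A. \<forall>z\<in>tangent_coords (U \<inter> fst d) c. \<forall>X Y.
        tensor_val (g c z) X Y =
          tensor_val (g d (tangent_transition c d z))
            (jacobian_map c d (fst z) X) (jacobian_map c d (fst z) Y))"

definition basic_two_form ::
  "('q, 'n::finite) chart set \<Rightarrow> 'q set \<Rightarrow> (('q, 'n) chart \<Rightarrow> real ^ 'n \<Rightarrow> real ^ 'n ^ 'n) \<Rightarrow> bool"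
where
  "basic_two_form A U w \<longleftrightarrow>
     (\<forall>c\<in>A. smooth_on (base_coords U c) (w c)) \<and>
     (\<forall>c\<in>A. \<forall>x\<in>base_coords U c. \<forall>i k. w c x $ k $ i = - w c x $ i $ k) \<and>
     (\<forall>c\<in>A. \<forall>d\<in>A. \<forall>x\<in>base_coords (U \<inter> fst d) c. \<forall>X Y.
        tensor_val (w c x) X Y =
          tensor_val (w d (transition c d x)) (jacobian_map c d x X) (jacobian_map c d x Y))"

section \<open>Calculus in the coordinates of one chart\<close>

definition dq :: "'n::finite \<Rightarrow> ('n tcoord \<Rightarrow> real) \<Rightarrow> 'n tcoord \<Rightarrow> real" where
  "dq i F z = frechet_derivative F (at z) (axis i 1, 0)"

definition dv :: "'n::finite \<Rightarrow> ('n tcoord \<Rightarrow> real) \<Rightarrow> 'n tcoord \<Rightarrow> real" where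
  "dv i F z = frechet_derivative F (at z) (0, axis i 1)"

definition Gam :: "('n tcoord \<Rightarrow> real ^ 'n::finite) \<Rightarrow> ('n tcoord \<Rightarrow> real) \<Rightarrow> 'n tcoord \<Rightarrow> real" where
  "Gam f F z = (\<Sum>i\<in>UNIV. snd z $ i * dq i F z + f z $ i * dv i F z)"

text \<open>\<open>conn f j i\<close> is the coefficient with upper index \<open>j\<close> and lower index \<open>i\<close>.\<close>

definition conn :: "('n tcoord \<Rightarrow> real ^ 'n::finite) \<Rightarrow> 'n \<Rightarrow> 'n \<Rightarrow> 'n tcoord \<Rightarrow> real" where
  "conn f j i z = - (1/2) * dv i (\<lambda>y. f y $ j) z"

definition Hor ::
  "('n tcoord \<Rightarrow> real ^ 'n::finite) \<Rightarrow> 'n \<Rightarrow> ('n tcoord \<Rightarrow> real) \<Rightarrow> 'n tcoord \<Rightarrow> real" where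
  "Hor f i F z = dq i F z - (\<Sum>j\<in>UNIV. conn f j i z * dv j F z)"

definition wedge3 :: "'n \<Rightarrow> 'n \<Rightarrow> 'n \<Rightarrow> real ^ 'n \<Rightarrow> real ^ 'n \<Rightarrow> real ^ 'n::finite \<Rightarrow> real" where
  "wedge3 k i j X Y Z =
     det (vector [vector [X $ k, X $ i, X $ j],
                  vector [Y $ k, Y $ i, Y $ j],
                  vector [Z $ k, Z $ i, Z $ j]] :: real ^ 3 ^ 3)"

text \<open>
  The horizontal exterior derivative of the 2-form
  \<open>\<omega> = 1/2 \<omega>\<^sub>i\<^sub>j dq\<^sup>i \<and> dq\<^sup>j\<close> along \<open>\<tau>\<close>, as a 3-form:
  \<open>1/2 H\<^sub>k(\<omega>\<^sub>i\<^sub>j) dq\<^sup>k \<and> dq\<^sup>i \<and> dq\<^sup>j\<close>.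
\<close>

definition dH ::
  "('n tcoord \<Rightarrow> real ^ 'n::finite) \<Rightarrow> ('n tcoord \<Rightarrow> real ^ 'n ^ 'n) \<Rightarrow> 'n tcoord \<Rightarrow>
   real ^ 'n \<Rightarrow> real ^ 'n \<Rightarrow> real ^ 'n \<Rightarrow> real" where
  "dH f w z X Y Z =
     (1/2) * (\<Sum>k\<in>UNIV. \<Sum>i\<in>UNIV. \<Sum>j\<in>UNIV. Hor f k (\<lambda>y. w y $ i $ j) z * wedge3 k i j X Y Z)"

definition pullback :: "(real ^ 'n \<Rightarrow> 'b) \<Rightarrow> 'n tcoord \<Rightarrow> 'b" where
  "pullback w = (\<lambda>z. w (fst z))"

text \<open>\<open>(D\<^sup>V\<^sub>X g)(Y, Z)\<close>\<close>

definition DV ::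
  "('n tcoord \<Rightarrow> real ^ 'n ^ 'n::finite) \<Rightarrow> 'n tcoord \<Rightarrow>
   real ^ 'n \<Rightarrow> real ^ 'n \<Rightarrow> real ^ 'n \<Rightarrow> real" where
  "DV g z X Y Z = tensor_val (\<chi> i j. \<Sum>k\<in>UNIV. X $ k * dv k (\<lambda>y. g y $ i $ j) z) Y Z"

text \<open>
  The dynamical covariant derivative of a coordinate vector field, and, by the Leibniz rule
  \<open>(\<nabla>g)(X, Y) = \<Gamma>(g(X, Y)) - g(\<nabla>X, Y) - g(X, \<nabla>Y)\<close>, the components of that of a
  type (0,2) tensor field.
\<close>

definition nabla_coord :: "('n tcoord \<Rightarrow> real ^ 'n::finite) \<Rightarrow> 'n \<Rightarrow> 'n tcoord \<Rightarrow> real ^ 'n" where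
  "nabla_coord f j z = (\<chi> i. conn f i j z)"

definition nabla ::
  "('n tcoord \<Rightarrow> real ^ 'n::finite) \<Rightarrow> ('n tcoord \<Rightarrow> real ^ 'n ^ 'n) \<Rightarrow> 'n tcoord \<Rightarrow>
   real ^ 'n ^ 'n" where
  "nabla f g z = (\<chi> i j. Gam f (\<lambda>y. g y $ i $ j) z
     - tensor_val (g z) (nabla_coord f i z) (axis j 1)
     - tensor_val (g z) (axis i 1) (nabla_coord f j z))"

text \<open>Row index upper, column index lower, so that \<open>\<Phi>(X)\<close> is \<open>jacobi f z *v X\<close>.\<close>

definition jacobi :: "('n tcoord \<Rightarrow> real ^ 'n::finite) \<Rightarrow> 'n tcoord \<Rightarrow> real ^ 'n ^ 'n" where
  "jacobi f z = (\<chi> i j. - dq j (\<lambda>y. f y $ i) z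
     - (\<Sum>k\<in>UNIV. conn f k j z * conn f i k z) - Gam f (conn f i j) z)"

section \<open>Curves and equations of motion\<close>

definition smooth_curve ::
  "'q topology \<Rightarrow> ('q, 'n::finite) chart set \<Rightarrow> 'q set \<Rightarrow> real set \<Rightarrow> (real \<Rightarrow> 'q) \<Rightarrow> bool" where
  "smooth_curve Q A U I \<gamma> \<longleftrightarrow>
     open I \<and> is_interval I \<and> \<gamma> ` I \<subseteq> U \<and>
     continuous_map (top_of_set I) Q \<gamma> \<and>
     (\<forall>c\<in>A. smooth_on {t\<in>I. \<gamma> t \<in> fst c} (\<lambda>t. snd c (\<gamma> t)))"

definition position :: "('q, 'n::finite) chart \<Rightarrow> (real \<Rightarrow> 'q) \<Rightarrow> real \<Rightarrow> real ^ 'n" where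
  "position c \<gamma> t = snd c (\<gamma> t)"

definition velocity :: "('q, 'n::finite) chart \<Rightarrow> (real \<Rightarrow> 'q) \<Rightarrow> real \<Rightarrow> real ^ 'n" where
  "velocity c \<gamma> t = vector_derivative (position c \<gamma>) (at t)"

definition acceleration :: "('q, 'n::finite) chart \<Rightarrow> (real \<Rightarrow> 'q) \<Rightarrow> real \<Rightarrow> real ^ 'n" where
  "acceleration c \<gamma> t = vector_derivative (velocity c \<gamma>) (at t)"

definition solves_second_order ::
  "('q, 'n::finite) chart set \<Rightarrow> (('q, 'n) chart \<Rightarrow> 'n tcoord \<Rightarrow> real ^ 'n) \<Rightarrow>
   real set \<Rightarrow> (real \<Rightarrow> 'q) \<Rightarrow> bool" where
  "solves_second_order A f I \<gamma> \<longleftrightarrow>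
     (\<forall>c\<in>A. \<forall>t\<in>I. \<gamma> t \<in> fst c \<longrightarrow>
        acceleration c \<gamma> t = f c (position c \<gamma> t, velocity c \<gamma> t))"

definition solves_gyroscopic ::
  "('q, 'n::finite) chart set \<Rightarrow> (('q, 'n) chart \<Rightarrow> 'n tcoord \<Rightarrow> real) \<Rightarrow>
   (('q, 'n) chart \<Rightarrow> real ^ 'n \<Rightarrow> real ^ 'n ^ 'n) \<Rightarrow> real set \<Rightarrow> (real \<Rightarrow> 'q) \<Rightarrow> bool" where
  "solves_gyroscopic A L w I \<gamma> \<longleftrightarrow>
     (\<forall>c\<in>A. \<forall>t\<in>I. \<gamma> t \<in> fst c \<longrightarrow> (\<forall>i.
        deriv (\<lambda>s. dv i (L c) (position c \<gamma> s, velocity c \<gamma> s)) t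
          - dq i (L c) (position c \<gamma> t, velocity c \<gamma> t)
        = (\<Sum>k\<in>UNIV. w c (position c \<gamma> t) $ k $ i * velocity c \<gamma> t $ k)))"

definition equations_equivalent ::
  "'q topology \<Rightarrow> ('q, 'n::finite) chart set \<Rightarrow> 'q set \<Rightarrow>
   (('q, 'n) chart \<Rightarrow> 'n tcoord \<Rightarrow> real) \<Rightarrow> (('q, 'n) chart \<Rightarrow> real ^ 'n \<Rightarrow> real ^ 'n ^ 'n) \<Rightarrow>
   (('q, 'n) chart \<Rightarrow> 'n tcoord \<Rightarrow> real ^ 'n) \<Rightarrow> bool" where
  "equations_equivalent Q A U L w f \<longleftrightarrow>
     (\<forall>I \<gamma>. smooth_curve Q A U I \<gamma> \<longrightarrow>
        (solves_gyroscopic A L w I \<gamma> \<longleftrightarrow> solves_second_order A f I \<gamma>))"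

section \<open>Conditions on Lagrangians and tensor fields over \<open>U\<close>\<close>

definition regular ::
  "('q, 'n::finite) chart set \<Rightarrow> 'q set \<Rightarrow> (('q, 'n) chart \<Rightarrow> 'n tcoord \<Rightarrow> real) \<Rightarrow> bool" where
  "regular A U L \<longleftrightarrow>
     (\<forall>c\<in>A. \<forall>z\<in>tangent_coords U c. invertible (\<chi> i j. dv i (dv j (L c)) z))"

definition nonsingular ::
  "('q, 'n::finite) chart set \<Rightarrow> 'q set \<Rightarrow> (('q, 'n) chart \<Rightarrow> 'n tcoord \<Rightarrow> real ^ 'n ^ 'n) \<Rightarrow> bool"
where
  "nonsingular A U g \<longleftrightarrow> (\<forall>c\<in>A. \<forall>z\<in>tangent_coords U c. invertible (g c z))"

definition symmetric_tensor ::
  "('q, 'n::finite) chart set \<Rightarrow> 'q set \<Rightarrow> (('q, 'n) chart \<Rightarrow> 'n tcoord \<Rightarrow> real ^ 'n ^ 'n) \<Rightarrow> bool"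
where
  "symmetric_tensor A U g \<longleftrightarrow>
     (\<forall>c\<in>A. \<forall>z\<in>tangent_coords U c. \<forall>X Y. tensor_val (g c z) X Y = tensor_val (g c z) Y X)"

definition DV_symmetric ::
  "('q, 'n::finite) chart set \<Rightarrow> 'q set \<Rightarrow> (('q, 'n) chart \<Rightarrow> 'n tcoord \<Rightarrow> real ^ 'n ^ 'n) \<Rightarrow> bool"
where
  "DV_symmetric A U g \<longleftrightarrow>
     (\<forall>c\<in>A. \<forall>z\<in>tangent_coords U c. \<forall>X Y Z.
        DV (g c) z X Y Z = DV (g c) z Y X Z \<and> DV (g c) z X Y Z = DV (g c) z X Z Y)"

definition nabla_zero ::
  "('q, 'n::finite) chart set \<Rightarrow> 'q set \<Rightarrow> (('q, 'n) chart \<Rightarrow> 'n tcoord \<Rightarrow> real ^ 'n) \<Rightarrow>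
   (('q, 'n) chart \<Rightarrow> 'n tcoord \<Rightarrow> real ^ 'n ^ 'n) \<Rightarrow> bool" where
  "nabla_zero A U f g \<longleftrightarrow> (\<forall>c\<in>A. \<forall>z\<in>tangent_coords U c. nabla (f c) (g c) z = 0)"

text \<open>Insertion of \<open>\<T> = v\<^sup>i \<partial>/\<partial>q\<^sup>i\<close> is evaluation of the first argument at \<open>v = snd z\<close>.\<close>

definition jacobi_condition ::
  "('q, 'n::finite) chart set \<Rightarrow> 'q set \<Rightarrow> (('q, 'n) chart \<Rightarrow> 'n tcoord \<Rightarrow> real ^ 'n) \<Rightarrow>
   (('q, 'n) chart \<Rightarrow> 'n tcoord \<Rightarrow> real ^ 'n ^ 'n) \<Rightarrow>
   (('q, 'n) chart \<Rightarrow> real ^ 'n \<Rightarrow> real ^ 'n ^ 'n) \<Rightarrow> bool" where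
  "jacobi_condition A U f g w \<longleftrightarrow>
     (\<forall>c\<in>A. \<forall>z\<in>tangent_coords U c. \<forall>X Y.
        tensor_val (g c z) (jacobi (f c) z *v X) Y - tensor_val (g c z) X (jacobi (f c) z *v Y)
        = dH (f c) (pullback (w c)) z (snd z) X Y)"

end

theory Submission
  imports Defs
begin

text \<open>
  For a function \<open>L\<close> put \<open>E\<^sub>i = \<Gamma>(V\<^sub>i L) - \<partial>L/\<partial>q\<^sup>i - \<omega>\<^sub>k\<^sub>i v\<^sup>k\<close>, \<open>g = V V L\<close> and
  \<open>m\<^sub>j\<^sub>i = H\<^sub>j V\<^sub>i L - H\<^sub>i V\<^sub>j L\<close>. Two identities carry the proof:
  \<open>V\<^sub>j E\<^sub>i = (\<nabla>g)\<^sub>i\<^sub>j + m\<^sub>j\<^sub>i - \<omega>\<^sub>j\<^sub>i\<close>, and, where \<open>\<nabla>g = 0\<close>,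
  \<open>\<partial>\<^sub>j E\<^sub>i - \<partial>\<^sub>i E\<^sub>j = \<Gamma>(m\<^sub>j\<^sub>i) + \<Phi>\<^sup>k\<^sub>i g\<^sub>k\<^sub>j - \<Phi>\<^sup>k\<^sub>j g\<^sub>k\<^sub>i - v\<^sup>k (\<partial>\<^sub>j \<omega>\<^sub>k\<^sub>i - \<partial>\<^sub>i \<omega>\<^sub>k\<^sub>j)\<close>.

  If the equations of motion are equivalent to those of \<open>\<Gamma>\<close>, then \<open>E = 0\<close>, because a solution of
  \<open>\<Gamma>\<close> passes through every tangent vector. The symmetric part of the first identity gives
  \<open>\<nabla>g = 0\<close>, its antisymmetric part \<open>m = \<omega>\<close>, and the second one is then the condition on \<open>\<Phi>\<close>.

  Conversely, two integrations along the fibres yield a function with Hessian \<open>g\<close>. The first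
  identity shows that \<open>V\<^sub>j E\<^sub>i\<close> is antisymmetric in \<open>i, j\<close>; since \<open>V\<^sub>k V\<^sub>j E\<^sub>i\<close> is also symmetric in
  \<open>j, k\<close> it vanishes, so \<open>E\<^sub>i = \<mu>\<^sub>k\<^sub>i(q) v\<^sup>k + \<nu>\<^sub>i(q)\<close>. The second identity and the condition on \<open>\<Phi>\<close>
  make \<open>\<mu>\<close> and \<open>\<nu>\<close> closed, and adding a suitable \<open>a\<^sub>i(q) v\<^sup>i + b(q)\<close> to the function makes \<open>E\<close> vanish.
\<close>

section \<open>Smooth functions and symmetry of second derivatives\<close>

text \<open>The Hessian determines a function only up to terms affine in the velocities, and this
  freedom matches the defect that is left: adding \<open>a\<^sub>i(q) v\<^sup>i + b(q)\<close>
  changes \<open>E\<close> by an exact 2-form contracted with \<open>v\<close>, minus an exact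
  1-form. So an \<open>E\<close> that is affine in \<open>v\<close> can be removed as soon as its
  coefficients are closed. The condition on \<Phi> gives both closures at once, because it equates
  an expression independent of \<open>v\<close> with one linear in \<open>v\<close>. The connection
  coefficients enter through the commutator of \<open>V\<^sub>j\<close> with \<Gamma>, as
  \<open>V\<^sub>j f\<^sup>k\<close> is -2 times the coefficient with upper index k and lower index
  j. Integration along the fibres asks nothing of the base, the fibres being vector spaces; the
  integration of the coefficients needs a star-shaped base, hence a coordinate ball. Potentials are
  not unique, so potentials found separately in different charts need not agree: the function is
  built in one chart and transported by tangent maps, which is why the covariance of Hessian and
  \<open>E\<close> has to be shown. Conversely, a curve obtained from the differential equation in
  one chart has to be recognised as a solution in all charts.\<close>

abbreviation fderiv where "fderiv F x \<equiv> frechet_derivative F (at x)"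

lemma frechet_derivative_transform_open:
  assumes "open S" "x \<in> S" "\<And>y. y \<in> S \<Longrightarrow> F y = G y"
  shows "fderiv F x = fderiv G x"
proof -
  have "(F has_derivative D) (at x) \<longleftrightarrow> (G has_derivative D) (at x)" for D
    using has_derivative_transform_within_open[OF _ assms(1,2), of F D UNIV G]
      has_derivative_transform_within_open[OF _ assms(1,2), of G D UNIV F] assms(3) by auto
  then show ?thesis by (simp add: frechet_derivative_def)
qed

section \<open>Closure properties of finitely often differentiable maps\<close>

lemma higher_differentiable_on_cong:
  assumes "open S" "\<And>x. x \<in> S \<Longrightarrow> F x = G x" "higher_differentiable_on S F k"
  shows "higher_differentiable_on S G k"
  using assms(2,3)
proof (induction k arbitrary: F G)
  case 0
  then show ?case by (simp cong: continuous_on_cong)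
next
  case (Suc k)
  have "G differentiable at x" if "x \<in> S" for x
  proof -
    have "(F has_derivative fderiv F x) (at x)"
      using Suc.prems(2) that by (simp add: frechet_derivative_works)
    then show ?thesis
      using has_derivative_transform_within_open[OF _ assms(1) that] Suc.prems(1)
      by (blast intro: differentiableI)
  qed
  moreover have "higher_differentiable_on S (\<lambda>x. fderiv G x v) k" for v
  proof (rule Suc.IH)
    show "fderiv F x v = fderiv G x v" if "x \<in> S" for x
      by (subst frechet_derivative_transform_open[OF assms(1) that, of F G]) (simp_all add: Suc.prems(1))
  qed (use Suc.prems(2) in simp)
  ultimately show ?case by simp
qed

text \<open>By uniqueness of derivatives any explicit formula \<open>F'\<close> agrees on
  \<open>S\<close> with the chosen \<open>frechet_derivative\<close>. The later inductions on
  \<open>k\<close> can therefore take the derivative from Leibniz or the chain rule and only show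
  that the formula is of class \<open>k\<close>.\<close>

lemma higher_differentiable_on_SucI:
  assumes "open S" "\<And>x. x \<in> S \<Longrightarrow> (F has_derivative F' x) (at x)"
    and "\<And>v. higher_differentiable_on S (\<lambda>x. F' x v) k"
  shows "higher_differentiable_on S F (Suc k)"
proof -
  have "F' x v = fderiv F x v" if "x \<in> S" for x v
    using frechet_derivative_at[OF assms(2)[OF that]] by simp
  then show ?thesis
    using assms(2) higher_differentiable_on_cong[OF assms(1) _ assms(3)]
    by (auto simp: differentiable_def)
qed

lemma higher_differentiable_on_SucD:
  "higher_differentiable_on S F (Suc k) \<Longrightarrow> higher_differentiable_on S F k"
proof (induction k arbitrary: F)
  case 0
  then show ?case
    by (auto intro!: continuous_at_imp_continuous_on differentiable_imp_continuous_within)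
qed auto

lemma higher_differentiable_on_subset:
  "higher_differentiable_on S F k \<Longrightarrow> T \<subseteq> S \<Longrightarrow> higher_differentiable_on T F k"
  by (induction k arbitrary: F) (auto intro: continuous_on_subset)

lemma higher_differentiable_on_has_derivative:
  "higher_differentiable_on S F (Suc k) \<Longrightarrow> x \<in> S \<Longrightarrow>
    (F has_derivative fderiv F x) (at x)"
  by (simp add: frechet_derivative_works)

lemma higher_differentiable_on_const: "higher_differentiable_on S (\<lambda>x. c) k"
  by (induction k arbitrary: c) auto

lemma higher_differentiable_on_bounded_linear:
  assumes "bounded_linear F" "open S"
  shows "higher_differentiable_on S F k"
proof (cases k)
  case 0
  then show ?thesis using assms by (simp add: linear_continuous_on)
next
  case (Suc m)
  show ?thesis unfolding Suc
    by (rule higher_differentiable_on_SucI[OF assms(2) bounded_linear_imp_has_derivative[OF assms(1)]])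
      (rule higher_differentiable_on_const)
qed

lemma higher_differentiable_on_add:
  assumes "open S" "higher_differentiable_on S F k" "higher_differentiable_on S G k"
  shows "higher_differentiable_on S (\<lambda>x. F x + G x) k"
  using assms(2,3)
proof (induction k arbitrary: F G)
  case (Suc k)
  show ?case
  proof (rule higher_differentiable_on_SucI[OF assms(1) has_derivative_add])
    show "x \<in> S \<Longrightarrow> (F has_derivative fderiv F x) (at x)"
      "x \<in> S \<Longrightarrow> (G has_derivative fderiv G x) (at x)" for x
      using Suc.prems higher_differentiable_on_has_derivative by blast+
  qed (use Suc in auto)
qed (auto intro: continuous_on_add)

lemma higher_differentiable_on_sum:
  assumes "open S" "\<And>i. i \<in> I \<Longrightarrow> higher_differentiable_on S (F i) k"
  shows "higher_differentiable_on S (\<lambda>x. \<Sum>i\<in>I. F i x) k"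
  using assms(2)
  by (induction I rule: infinite_finite_induct)
    (auto simp: higher_differentiable_on_const intro!: higher_differentiable_on_add assms(1))

text \<open>Leibniz turns the derivative in a fixed direction into two expressions of the same
  bilinear shape, so the induction runs over all pairs of maps;
  \<open>higher_differentiable_on_SucD\<close> provides the undifferentiated factors at the lower
  order.\<close>

lemma higher_differentiable_on_bilinear:
  assumes "bounded_bilinear p" "open S" "higher_differentiable_on S F k" "higher_differentiable_on S G k"
  shows "higher_differentiable_on S (\<lambda>x. p (F x) (G x)) k"
  using assms(3,4)
proof (induction k arbitrary: F G)
  case 0
  then show ?case using bounded_bilinear.continuous_on[OF assms(1)] by auto
next
  case (Suc k)
  show ?case
  proof (rule higher_differentiable_on_SucI[OF assms(2) bounded_bilinear.FDERIV[OF assms(1)]])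
    show "x \<in> S \<Longrightarrow> (F has_derivative fderiv F x) (at x)"
      "x \<in> S \<Longrightarrow> (G has_derivative fderiv G x) (at x)" for x
      using Suc.prems higher_differentiable_on_has_derivative by blast+
    fix v
    show "higher_differentiable_on S (\<lambda>x. p (F x) (fderiv G x v)
        + p (fderiv F x v) (G x)) k"
      using Suc.prems higher_differentiable_on_SucD[OF Suc.prems(1)] higher_differentiable_on_SucD[OF Suc.prems(2)]
      by (intro higher_differentiable_on_add assms(2) Suc.IH) auto
  qed
qed

lemma higher_differentiable_on_linear_compose:
  assumes "bounded_linear h" "open S" "higher_differentiable_on S F k"
  shows "higher_differentiable_on S (\<lambda>x. h (F x)) k"
  using assms(3)
proof (induction k arbitrary: F)
  case 0
  then show ?case using bounded_linear.continuous_on[OF assms(1)] by auto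
next
  case (Suc k)
  show ?case
  proof (rule higher_differentiable_on_SucI[OF assms(2) bounded_linear.has_derivative[OF assms(1)]])
    show "x \<in> S \<Longrightarrow> (F has_derivative fderiv F x) (at x)" for x
      using Suc.prems higher_differentiable_on_has_derivative by blast
  qed (use Suc in auto)
qed

lemma frechet_derivative_euclidean:
  assumes "F differentiable at (x::'a::euclidean_space)"
  shows "fderiv F x w = (\<Sum>b\<in>Basis. (w \<bullet> b) *\<^sub>R fderiv F x b)"
proof -
  interpret linear "fderiv F x" using assms by (rule linear_frechet_derivative)
  show ?thesis by (subst euclidean_representation[symmetric, of w]) (simp add: sum scaleR del: euclidean_representation)
qed

text \<open>The chain rule differentiates \<open>F\<close> in a direction that moves with
  \<open>x\<close>, while the recursive definition speaks of fixed directions. Expanding the moving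
  direction in the basis of the Euclidean space in the middle leaves products of a coefficient and a
  derivative of \<open>F\<close> in a fixed direction composed with \<open>G\<close>, to which the
  induction hypothesis applies.\<close>

lemma higher_differentiable_on_compose:
  fixes G :: "'a::real_normed_vector \<Rightarrow> 'b::euclidean_space"
  assumes "open S" "open T" "G ` S \<subseteq> T"
    "higher_differentiable_on T F k" "higher_differentiable_on S G k"
  shows "higher_differentiable_on S (\<lambda>x. F (G x)) k"
  using assms(4,5)
proof (induction k arbitrary: F)
  case 0
  then show ?case using assms by (auto intro: continuous_on_compose2)
next
  case (Suc k)
  let ?DF = "\<lambda>y. fderiv F y" and ?DG = "\<lambda>y. fderiv G y"
  have d: "G differentiable at x" "F differentiable at (G x)" if "x \<in> S" for x
    using Suc.prems that assms(3) by auto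
  show ?case
  proof (rule higher_differentiable_on_SucI[OF assms(1), where F' = "\<lambda>x w. \<Sum>b\<in>Basis. (?DG x w \<bullet> b) *\<^sub>R ?DF (G x) b"])
    fix x assume "x \<in> S"
    then have "((\<lambda>x. F (G x)) has_derivative (\<lambda>w. ?DF (G x) (?DG x w))) (at x)"
      using has_derivative_compose[OF d(1)[unfolded frechet_derivative_works] d(2)[unfolded frechet_derivative_works]] by simp
    moreover have "?DF (G x) (?DG x w) = (\<Sum>b\<in>Basis. (?DG x w \<bullet> b) *\<^sub>R ?DF (G x) b)" for w
      by (rule frechet_derivative_euclidean[OF d(2)[OF \<open>x \<in> S\<close>]])
    ultimately show "((\<lambda>x. F (G x)) has_derivative (\<lambda>w. \<Sum>b\<in>Basis. (?DG x w \<bullet> b) *\<^sub>R ?DF (G x) b)) (at x)"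
      by (simp only:)
  next
    fix v
    show "higher_differentiable_on S (\<lambda>x. \<Sum>b\<in>Basis. (?DG x v \<bullet> b) *\<^sub>R ?DF (G x) b) k"
    proof (intro higher_differentiable_on_sum assms(1) higher_differentiable_on_bilinear[OF bounded_bilinear_scaleR] Suc.IH)
      show "higher_differentiable_on S (\<lambda>x. ?DG x v \<bullet> b) k" for b
        by (rule higher_differentiable_on_bilinear[OF bounded_bilinear_inner assms(1)])
          (use Suc.prems in \<open>auto simp: higher_differentiable_on_const\<close>)
      show "higher_differentiable_on S G k" by (rule higher_differentiable_on_SucD[OF Suc.prems(2)])
    qed (use Suc.prems in auto)
  qed
qed

section \<open>The same closure properties for smooth maps\<close>

lemma smooth_on_has_derivative:
  "smooth_on S F \<Longrightarrow> x \<in> S \<Longrightarrow> (F has_derivative fderiv F x) (at x)"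
  unfolding smooth_on_def by (meson higher_differentiable_on_has_derivative)

lemma smooth_on_differentiable: "smooth_on S F \<Longrightarrow> x \<in> S \<Longrightarrow> F differentiable (at x)"
  using smooth_on_has_derivative by (blast intro: differentiableI)

lemma smooth_on_continuous_on: "smooth_on S F \<Longrightarrow> continuous_on S F"
  unfolding smooth_on_def by (metis higher_differentiable_on.simps(1))

lemma smooth_on_frechet_derivative:
  "smooth_on S F \<Longrightarrow> smooth_on S (\<lambda>x. fderiv F x v)"
  unfolding smooth_on_def by (metis higher_differentiable_on.simps(2))

lemma smooth_on_cong:
  "open S \<Longrightarrow> (\<And>x. x \<in> S \<Longrightarrow> F x = G x) \<Longrightarrow> smooth_on S F \<Longrightarrow> smooth_on S G"
  unfolding smooth_on_def using higher_differentiable_on_cong by blast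

lemma smooth_on_subset: "smooth_on S F \<Longrightarrow> T \<subseteq> S \<Longrightarrow> smooth_on T F"
  unfolding smooth_on_def using higher_differentiable_on_subset by blast

lemma smooth_on_const: "smooth_on S (\<lambda>x. c)"
  unfolding smooth_on_def by (blast intro: higher_differentiable_on_const)

lemma smooth_on_bounded_linear: "bounded_linear F \<Longrightarrow> open S \<Longrightarrow> smooth_on S F"
  unfolding smooth_on_def by (blast intro: higher_differentiable_on_bounded_linear)

lemma smooth_on_add:
  "open S \<Longrightarrow> smooth_on S F \<Longrightarrow> smooth_on S G \<Longrightarrow> smooth_on S (\<lambda>x. F x + G x)"
  unfolding smooth_on_def by (blast intro: higher_differentiable_on_add)

lemma smooth_on_sum:
  "open S \<Longrightarrow> (\<And>i. i \<in> I \<Longrightarrow> smooth_on S (F i)) \<Longrightarrow> smooth_on S (\<lambda>x. \<Sum>i\<in>I. F i x)"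
  unfolding smooth_on_def by (blast intro: higher_differentiable_on_sum)

lemma smooth_on_bilinear:
  "bounded_bilinear p \<Longrightarrow> open S \<Longrightarrow> smooth_on S F \<Longrightarrow> smooth_on S G \<Longrightarrow> smooth_on S (\<lambda>x. p (F x) (G x))"
  unfolding smooth_on_def by (blast intro: higher_differentiable_on_bilinear)

lemmas smooth_on_scaleR = smooth_on_bilinear[OF bounded_bilinear_scaleR]
  and smooth_on_mult = smooth_on_bilinear[OF bounded_bilinear_mult]
  and smooth_on_inner = smooth_on_bilinear[OF bounded_bilinear_inner]

lemma smooth_on_compose:
  fixes G :: "'a::real_normed_vector \<Rightarrow> 'b::euclidean_space"
  shows "open S \<Longrightarrow> open T \<Longrightarrow> smooth_on T F \<Longrightarrow> smooth_on S G \<Longrightarrow> G ` S \<subseteq> T \<Longrightarrow> smooth_on S (\<lambda>x. F (G x))"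
  unfolding smooth_on_def by (intro allI, rule higher_differentiable_on_compose[where T = T]) auto

lemma smooth_on_linear_compose:
  "bounded_linear h \<Longrightarrow> open S \<Longrightarrow> smooth_on S G \<Longrightarrow> smooth_on S (\<lambda>x. h (G x))"
  unfolding smooth_on_def by (blast intro: higher_differentiable_on_linear_compose)

lemma smooth_on_uminus:
  "open S \<Longrightarrow> smooth_on S F \<Longrightarrow> smooth_on S (\<lambda>x. - F x)"
  using smooth_on_scaleR[of S "\<lambda>_. -1" F] by (simp add: smooth_on_const)

lemma smooth_on_diff:
  "open S \<Longrightarrow> smooth_on S F \<Longrightarrow> smooth_on S G \<Longrightarrow> smooth_on S (\<lambda>x. F x - G x)"
  using smooth_on_add[of S F "\<lambda>x. - G x"] by (simp add: smooth_on_uminus)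

lemma smooth_on_Pair:
  assumes "open S" "smooth_on S F" "smooth_on S G"
  shows "smooth_on S (\<lambda>x. (F x, G x))"
proof -
  have lin: "bounded_linear (\<lambda>a::'b. (a, 0::'c))" "bounded_linear (\<lambda>b::'c. (0::'b, b))"
    by (auto intro!: bounded_linear_Pair bounded_linear_ident bounded_linear_zero)
  have "smooth_on S (\<lambda>x. (F x, 0) + (0, G x))"
    using smooth_on_linear_compose[OF lin(1) assms(1,2)] smooth_on_linear_compose[OF lin(2) assms(1,3)]
    by (intro smooth_on_add assms(1))
  then show ?thesis by simp
qed

lemma smooth_on_fst: "open S \<Longrightarrow> smooth_on S fst"
  by (rule smooth_on_bounded_linear[OF bounded_linear_fst])

lemma smooth_on_snd: "open S \<Longrightarrow> smooth_on S snd"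
  by (rule smooth_on_bounded_linear[OF bounded_linear_snd])

lemma smooth_on_ident: "open S \<Longrightarrow> smooth_on S (\<lambda>x. x)"
  by (rule smooth_on_bounded_linear[OF bounded_linear_ident])

lemma smooth_on_nth:
  fixes F :: "'a::real_normed_vector \<Rightarrow> ('b::euclidean_space)^'n::finite"
  shows "open S \<Longrightarrow> smooth_on S F \<Longrightarrow> smooth_on S (\<lambda>x. F x $ i)"
  by (rule smooth_on_linear_compose[OF bounded_linear_vec_nth])

lemma smooth_on_vec_lambda:
  fixes F :: "'n::finite \<Rightarrow> 'a::real_normed_vector \<Rightarrow> 'b::euclidean_space"
  assumes "open S" "\<And>i. smooth_on S (F i)"
  shows "smooth_on S (\<lambda>x. \<chi> i. F i x)"
proof -
  have lin: "bounded_linear (\<lambda>y::'b. axis i y)" for i :: 'n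
    by (rule linear_conv_bounded_linear[THEN iffD1])
      (auto intro!: linearI simp: axis_def vec_eq_iff)
  have "smooth_on S (\<lambda>x. \<Sum>i\<in>UNIV. axis i (F i x))"
    by (intro smooth_on_sum assms(1) smooth_on_linear_compose[OF lin] assms(2))
  also have "(\<lambda>x. \<Sum>i\<in>UNIV. axis i (F i x)) = (\<lambda>x. \<chi> i. F i x)"
    by (auto simp: vec_eq_iff axis_def fun_eq_iff if_distrib cong: if_cong)
  finally show ?thesis .
qed

text \<open>Here too the basis expansion replaces a varying direction by constant ones with smooth
  coefficients.\<close>

lemma smooth_on_frechet_derivative_apply:
  fixes F :: "'a::euclidean_space \<Rightarrow> 'b::real_normed_vector"
  assumes "open S" "smooth_on S F" "smooth_on S w"
  shows "smooth_on S (\<lambda>x. fderiv F x (w x))"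
proof (rule smooth_on_cong[OF assms(1)])
  show "smooth_on S (\<lambda>x. \<Sum>b\<in>Basis. (w x \<bullet> b) *\<^sub>R fderiv F x b)"
    by (intro smooth_on_sum smooth_on_scaleR smooth_on_inner smooth_on_frechet_derivative smooth_on_const assms)
qed (rule frechet_derivative_euclidean[OF smooth_on_differentiable[OF assms(2)], symmetric])

text \<open>Both iterated derivatives are limits of the same second difference quotient, by applying
  the mean value theorem twice in either order.\<close>

lemma second_difference_mean_value:
  fixes F :: "'a::real_normed_vector \<Rightarrow> real"
  assumes "open S" "smooth_on S F" "h > 0"
    and seg: "\<And>s t. 0 \<le> s \<Longrightarrow> s \<le> h \<Longrightarrow> 0 \<le> t \<Longrightarrow> t \<le> h \<Longrightarrow> x + s *\<^sub>R u + t *\<^sub>R v \<in> S"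
  shows "\<exists>s t. 0 < s \<and> s < h \<and> 0 < t \<and> t < h \<and>
    F (x + h *\<^sub>R u + h *\<^sub>R v) - F (x + h *\<^sub>R u) - F (x + h *\<^sub>R v) + F x =
    h * h * fderiv (\<lambda>y. fderiv F y u) (x + s *\<^sub>R u + t *\<^sub>R v) v"
proof -
  have dv: "((\<lambda>t. G (a + t *\<^sub>R w)) has_real_derivative fderiv G (a + t *\<^sub>R w) w) (at t)"
    if "smooth_on S G" "a + t *\<^sub>R w \<in> S" for G :: "'a \<Rightarrow> real" and a w t
  proof -
    have "((\<lambda>t. a + t *\<^sub>R w) has_derivative (\<lambda>r. r *\<^sub>R w)) (at t)"
      by (auto intro!: derivative_eq_intros)
    from has_derivative_compose[OF this smooth_on_has_derivative[OF that]]
    have "((\<lambda>t. G (a + t *\<^sub>R w)) has_derivative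
        (\<lambda>r. fderiv G (a + t *\<^sub>R w) (r *\<^sub>R w))) (at t)" .
    moreover have "fderiv G (a + t *\<^sub>R w) (r *\<^sub>R w)
        = fderiv G (a + t *\<^sub>R w) w * r" for r
      using linear_cmul[OF linear_frechet_derivative[OF smooth_on_differentiable[OF that]]] by simp
    ultimately show ?thesis by (simp add: has_field_derivative_def)
  qed
  let ?p = "\<lambda>s. F ((x + h *\<^sub>R v) + s *\<^sub>R u) - F (x + s *\<^sub>R u)"
  let ?D = "\<lambda>y. fderiv F y u"
  have "\<exists>s>0. s < h \<and> ?p h - ?p 0 = (h - 0) * (?D ((x + h *\<^sub>R v) + s *\<^sub>R u) - ?D (x + s *\<^sub>R u))"
  proof (intro MVT2 DERIV_diff dv assms(2))
    fix s assume "0 \<le> s" "s \<le> h"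
    then show "(x + h *\<^sub>R v) + s *\<^sub>R u \<in> S" "x + s *\<^sub>R u \<in> S"
      using assms(3) seg[of s h] seg[of s 0] by (simp_all add: add.commute add.left_commute)
  qed (rule assms(3))
  then obtain s where s: "0 < s" "s < h"
    and e1: "?p h - ?p 0 = h * (?D ((x + h *\<^sub>R v) + s *\<^sub>R u) - ?D (x + s *\<^sub>R u))" by auto
  have "\<exists>t>0. t < h \<and> ?D (x + s *\<^sub>R u + h *\<^sub>R v) - ?D (x + s *\<^sub>R u + 0 *\<^sub>R v)
      = (h - 0) * fderiv ?D (x + s *\<^sub>R u + t *\<^sub>R v) v"
    using assms(3) s seg
    by (intro MVT2 dv smooth_on_frechet_derivative[OF assms(2)]) auto
  then obtain t where t: "0 < t" "t < h"
    "?D (x + s *\<^sub>R u + h *\<^sub>R v) - ?D (x + s *\<^sub>R u)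
      = h * fderiv ?D (x + s *\<^sub>R u + t *\<^sub>R v) v" by auto
  have "?p h - ?p 0 = h * (h * fderiv ?D (x + s *\<^sub>R u + t *\<^sub>R v) v)"
    using e1 t(3) by (simp add: add.commute add.left_commute)
  then show ?thesis using s t by (intro exI[of _ s] exI[of _ t]) (simp add: add.commute add.left_commute)
qed

lemma frechet_derivative_commute_real:
  fixes F :: "'a::real_normed_vector \<Rightarrow> real"
  assumes S: "open S" and F: "smooth_on S F" and x: "x \<in> S"
  shows "fderiv (\<lambda>y. fderiv F y u) x v =
    fderiv (\<lambda>y. fderiv F y v) x u"
proof -
  define A where "A u v y = fderiv (\<lambda>y. fderiv F y u) y v" for u v y
  have cont: "continuous_on S (A u v)" for u v
    unfolding A_def by (intro smooth_on_continuous_on smooth_on_frechet_derivative F)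
  have "\<bar>A u v x - A v u x\<bar> < e" if "e > 0" for e
  proof -
    obtain d1 where d1: "d1 > 0" "\<And>y. y \<in> S \<Longrightarrow> dist y x < d1 \<Longrightarrow> \<bar>A u v y - A u v x\<bar> < e/2"
      using cont[of u v] x \<open>e > 0\<close> unfolding continuous_on_iff dist_real_def by (meson half_gt_zero)
    obtain d2 where d2: "d2 > 0" "\<And>y. y \<in> S \<Longrightarrow> dist y x < d2 \<Longrightarrow> \<bar>A v u y - A v u x\<bar> < e/2"
      using cont[of v u] x \<open>e > 0\<close> unfolding continuous_on_iff dist_real_def by (meson half_gt_zero)
    obtain d3 where d3: "d3 > 0" "ball x d3 \<subseteq> S" using S x open_contains_ball by blast
    define d where "d = min d1 (min d2 d3)"
    \<comment> \<open>With this \<open>h\<close> the whole parallelogram spanned at \<open>x\<close>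
      by \<open>h *\<^sub>R u\<close> and \<open>h *\<^sub>R v\<close> lies within distance
      \<open>d\<close> of \<open>x\<close>; the summand 1 keeps the denominator positive when both
      vectors vanish.\<close>
    define h where "h = d / (2 * (norm u + norm v + 1))"
    have "d > 0" using d1 d2 d3 by (simp add: d_def)
    then have "h > 0" unfolding h_def by (intro divide_pos_pos mult_pos_pos) (auto intro: add_nonneg_pos)
    have near: "dist (x + s *\<^sub>R u + t *\<^sub>R v) x < d" if "0 \<le> s" "s \<le> h" "0 \<le> t" "t \<le> h" for s t
    proof -
      have "norm (s *\<^sub>R u + t *\<^sub>R v) \<le> norm (s *\<^sub>R u) + norm (t *\<^sub>R v)" by (rule norm_triangle_ineq)
      also have "\<dots> = s * norm u + t * norm v" using that by simp
      also have "\<dots> \<le> h * norm u + h * norm v"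
        using that by (intro add_mono mult_right_mono) auto
      also have "\<dots> < h * (2 * (norm u + norm v + 1))"
      proof -
        have "0 \<le> h * norm u" "0 \<le> h * norm v" using \<open>h > 0\<close> by simp_all
        moreover have "h * (2 * (norm u + norm v + 1)) = 2 * (h * norm u) + 2 * (h * norm v) + 2 * h"
          by (simp add: algebra_simps)
        ultimately show ?thesis using \<open>h > 0\<close> by linarith
      qed
      also have "\<dots> = d"
      proof -
        have "norm u + norm v + 1 \<noteq> 0" using norm_ge_zero[of u] norm_ge_zero[of v] by linarith
        then show ?thesis by (simp add: h_def)
      qed
      finally show ?thesis by (simp add: dist_norm add.assoc)
    qed
    have inS: "x + s *\<^sub>R u + t *\<^sub>R v \<in> S" if "0 \<le> s" "s \<le> h" "0 \<le> t" "t \<le> h" for s t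
      using near[OF that] d3 by (force simp: d_def dist_commute)
    obtain s t where st: "0 < s" "s < h" "0 < t" "t < h"
      "F (x + h *\<^sub>R u + h *\<^sub>R v) - F (x + h *\<^sub>R u) - F (x + h *\<^sub>R v) + F x =
        h * h * A u v (x + s *\<^sub>R u + t *\<^sub>R v)"
      using second_difference_mean_value[OF S F \<open>h > 0\<close>, of x u v] inS unfolding A_def by blast
    have inS': "x + s *\<^sub>R v + t *\<^sub>R u \<in> S" if "0 \<le> s" "s \<le> h" "0 \<le> t" "t \<le> h" for s t
      using inS[of t s] that by (simp add: add.commute add.left_commute)
    obtain s' t' where st': "0 < s'" "s' < h" "0 < t'" "t' < h"
      "F (x + h *\<^sub>R v + h *\<^sub>R u) - F (x + h *\<^sub>R v) - F (x + h *\<^sub>R u) + F x =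
        h * h * A v u (x + s' *\<^sub>R v + t' *\<^sub>R u)"
      using second_difference_mean_value[OF S F \<open>h > 0\<close>, of x v u] inS' unfolding A_def by blast
    have "x + h *\<^sub>R v + h *\<^sub>R u = x + h *\<^sub>R u + h *\<^sub>R v" by simp
    then have "h * h * A u v (x + s *\<^sub>R u + t *\<^sub>R v) = h * h * A v u (x + s' *\<^sub>R v + t' *\<^sub>R u)"
      using st(5) st'(5)[simplified \<open>x + h *\<^sub>R v + h *\<^sub>R u = x + h *\<^sub>R u + h *\<^sub>R v\<close>]
      by linarith
    then have eq: "A u v (x + s *\<^sub>R u + t *\<^sub>R v) = A v u (x + t' *\<^sub>R u + s' *\<^sub>R v)"
      using \<open>h > 0\<close> by (simp add: add.commute add.left_commute)
    have "\<bar>A u v (x + s *\<^sub>R u + t *\<^sub>R v) - A u v x\<bar> < e/2"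
      using st near[of s t] inS[of s t] by (intro d1) (auto simp: d_def)
    moreover have "\<bar>A v u (x + t' *\<^sub>R u + s' *\<^sub>R v) - A v u x\<bar> < e/2"
      using st' near[of t' s'] inS[of t' s'] by (intro d2) (auto simp: d_def)
    ultimately show ?thesis using eq by linarith
  qed
  then have "\<bar>A u v x - A v u x\<bar> \<le> 0" by (meson less_irrefl not_le_imp_less)
  then show ?thesis by (simp add: A_def)
qed

lemma frechet_derivative_inner_left:
  assumes "F differentiable at x"
  shows "fderiv (\<lambda>y. F y \<bullet> b) x v = fderiv F x v \<bullet> b"
  using frechet_derivative_at[OF has_derivative_inner_left[OF assms[unfolded frechet_derivative_works], of b]]
  by (simp add: fun_eq_iff)

text \<open>The mean value argument needs real values, so the vector case is settled on the
  components with respect to the basis; taking a component commutes with differentiation.\<close>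

lemma frechet_derivative_commute:
  fixes F :: "'a::real_normed_vector \<Rightarrow> 'b::euclidean_space"
  assumes S: "open S" and F: "smooth_on S F" and x: "x \<in> S"
  shows "fderiv (\<lambda>y. fderiv F y u) x v =
    fderiv (\<lambda>y. fderiv F y v) x u"
proof (rule euclidean_eqI)
  fix b :: 'b assume "b \<in> Basis"
  have *: "fderiv (\<lambda>y. fderiv F y u) x v \<bullet> b =
     fderiv (\<lambda>y. fderiv (\<lambda>y. F y \<bullet> b) y u) x v" for u v
  proof -
    have "fderiv (\<lambda>y. fderiv F y u) x v \<bullet> b =
      fderiv (\<lambda>y. fderiv F y u \<bullet> b) x v"
      by (rule frechet_derivative_inner_left[symmetric])
        (intro smooth_on_differentiable[OF smooth_on_frechet_derivative[OF F] x])
    also have "\<dots> = fderiv (\<lambda>y. fderiv (\<lambda>y. F y \<bullet> b) y u) x v"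
      by (rule fun_cong[OF frechet_derivative_transform_open[OF S x]])
        (rule frechet_derivative_inner_left[OF smooth_on_differentiable[OF F], symmetric])
    finally show ?thesis .
  qed
  show "fderiv (\<lambda>y. fderiv F y u) x v \<bullet> b =
    fderiv (\<lambda>y. fderiv F y v) x u \<bullet> b"
    unfolding * by (rule frechet_derivative_commute_real[OF S _ x])
      (intro smooth_on_inner smooth_on_const S F)
qed

section \<open>Parameter integrals and the Poincare lemma\<close>

lemma linear_frechet_derivative_smooth:
  "smooth_on S F \<Longrightarrow> x \<in> S \<Longrightarrow> linear (fderiv F x)"
  by (simp add: linear_frechet_derivative smooth_on_differentiable)

text \<open>\<open>leibniz_rule\<close> asks for a continuous family of bounded linear maps on a
  convex set. This explains the passage to a ball and to \<open>Blinfun\<close>, with continuity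
  tested on basis vectors. The open set \<open>T\<close> around the product makes full derivatives
  available at both ends of the unit interval.\<close>

lemma has_derivative_param_integral:
  fixes h :: "real \<times> 'a::euclidean_space \<Rightarrow> 'b::euclidean_space"
  assumes T: "open T" "smooth_on T h" and S: "open S" "{0..1} \<times> S \<subseteq> T" and x: "x \<in> S"
  shows "((\<lambda>x. integral {0..1} (\<lambda>s. h (s, x))) has_derivative
    (\<lambda>v. integral {0..1} (\<lambda>s. fderiv h (s, x) (0, v)))) (at x)"
proof -
  obtain r where r: "r > 0" "ball x r \<subseteq> S" using S x open_contains_ball by blast
  have inT: "(s, y) \<in> T" if "y \<in> ball x r" "s \<in> {0..1}" for s y
    using r S that by blast
  define f' where "f' y s = Blinfun (\<lambda>v. fderiv h (s, y) (0, v))" for y s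
  have lin: "bounded_linear (\<lambda>v. fderiv h z (0, v))" if "z \<in> T" for z
    using bounded_linear_compose[OF has_derivative_bounded_linear[OF smooth_on_has_derivative[OF T(2) that]]
        bounded_linear_Pair[OF bounded_linear_zero bounded_linear_ident]] .
  have f': "blinfun_apply (f' y s) = (\<lambda>v. fderiv h (s, y) (0, v))"
    if "y \<in> ball x r" "s \<in> {0..1}" for y s
    unfolding f'_def by (rule bounded_linear_Blinfun_apply[OF lin[OF inT[OF that]]])
  have der: "((\<lambda>y. h (s, y)) has_derivative blinfun_apply (f' y s)) (at y within ball x r)"
    if "y \<in> ball x r" "s \<in> cbox 0 1" for y s
  proof -
    have "((\<lambda>y. (s, y)) has_derivative (\<lambda>v. (0, v))) (at y)"
      by (auto intro!: derivative_eq_intros)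
    from has_derivative_compose[OF this smooth_on_has_derivative[OF T(2) inT]]
    have "((\<lambda>y. h (s, y)) has_derivative (\<lambda>v. fderiv h (s, y) (0, v))) (at y)"
      using that by auto
    then show ?thesis using f'[of y s] that by (auto intro: has_derivative_at_withinI)
  qed
  have cont_h: "continuous_on {0..1} (\<lambda>s. h (s, y))" if "y \<in> ball x r" for y
    by (rule continuous_on_compose2[OF smooth_on_continuous_on[OF T(2)]])
      (use inT that in \<open>auto intro!: continuous_intros\<close>)
  have cont: "continuous_on (ball x r \<times> cbox 0 1) (\<lambda>(y, s). f' y s)"
  proof (rule continuous_on_blinfun_componentwise)
    fix i :: 'a
    have "continuous_on (ball x r \<times> cbox 0 1) (\<lambda>z. fderiv h (snd z, fst z) (0, i))"
      by (rule continuous_on_compose2[OF smooth_on_continuous_on[OF smooth_on_frechet_derivative[OF T(2)]]])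
        (use inT in \<open>auto intro!: continuous_intros\<close>)
    then show "continuous_on (ball x r \<times> cbox 0 1) (\<lambda>z. blinfun_apply (case z of (y, s) \<Rightarrow> f' y s) i)"
      by (rule continuous_on_eq) (use f' in auto)
  qed
  have "((\<lambda>y. integral (cbox 0 1) (\<lambda>s. h (s, y))) has_derivative
      blinfun_apply (integral (cbox 0 1) (f' x))) (at x within ball x r)"
    by (rule leibniz_rule[OF der _ cont])
      (use r cont_h in \<open>auto intro!: integrable_continuous_real\<close>)
  moreover have "blinfun_apply (integral (cbox 0 1) (f' x)) =
      (\<lambda>v. integral {0..1} (\<lambda>s. fderiv h (s, x) (0, v)))"
  proof
    fix v
    have "continuous_on (cbox 0 1) (f' x)"
      using continuous_on_compose2[OF cont, of "cbox 0 1" "\<lambda>s. (x, s)"] r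
      by (auto simp: image_subset_iff continuous_on_Pair)
    then have "blinfun_apply (integral (cbox 0 1) (f' x)) v = integral (cbox 0 1) (\<lambda>s. blinfun_apply (f' x s) v)"
      by (intro blinfun_apply_integral integrable_continuous)
    also have "\<dots> = integral {0..1} (\<lambda>s. fderiv h (s, x) (0, v))"
      unfolding cbox_interval by (rule integral_cong) (use f' r in auto)
    finally show "blinfun_apply (integral (cbox 0 1) (f' x)) v =
      integral {0..1} (\<lambda>s. fderiv h (s, x) (0, v))" .
  qed
  ultimately show ?thesis
    using r by (simp add: at_within_open[of x "ball x r"])
qed

text \<open>Every directional derivative of the integral is again such an integral with a smooth
  integrand, so an induction on \<open>k\<close> over all integrands suffices.\<close>

lemma smooth_on_param_integral:
  fixes h :: "real \<times> 'a::euclidean_space \<Rightarrow> 'b::euclidean_space"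
  assumes T: "open T" "smooth_on T h" and S: "open S" "{0..1} \<times> S \<subseteq> T"
  shows "smooth_on S (\<lambda>x. integral {0..1} (\<lambda>s. h (s, x)))"
proof -
  have "higher_differentiable_on S (\<lambda>x. integral {0..1} (\<lambda>s. h (s, x))) k"
    if "smooth_on T h" for k and h :: "real \<times> 'a \<Rightarrow> 'b"
    using that
  proof (induction k arbitrary: h)
    case 0
    then show ?case
      using has_derivative_continuous[OF has_derivative_param_integral[OF T(1) _ S]]
      by (auto intro!: continuous_at_imp_continuous_on)
  next
    case (Suc k)
    show ?case
      by (rule higher_differentiable_on_SucI[OF S(1) has_derivative_param_integral[OF T(1) Suc.prems S]])
        (auto intro!: Suc.IH smooth_on_frechet_derivative Suc.prems)
  qed
  then show ?thesis using T by (simp add: smooth_on_def)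
qed

text \<open>The potential is radial: \<open>P (p, x)\<close> is the integral of
  \<open>h (p, s *\<^sub>R x) \<bullet> x\<close> over 0 \<le> s \<le> 1. The first factor is only a
  parameter, on which the integral depends smoothly; this is the form needed for integration along
  the fibres of a tangent bundle.\<close>

lemma poincare_fibre:
  fixes h :: "'a::euclidean_space \<times> 'b::euclidean_space \<Rightarrow> 'b"
  assumes W: "open W" "smooth_on W h"
    and star: "\<And>p x s. (p, x) \<in> W \<Longrightarrow> 0 \<le> s \<Longrightarrow> s \<le> 1 \<Longrightarrow> (p, s *\<^sub>R x) \<in> W"
    and closed: "\<And>z u w. z \<in> W \<Longrightarrow>
      fderiv h z (0, u) \<bullet> w = fderiv h z (0, w) \<bullet> u"
  obtains P :: "'a \<times> 'b \<Rightarrow> real"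
  where "smooth_on W P" "\<And>z u. z \<in> W \<Longrightarrow> fderiv P z (0, u) = h z \<bullet> u"
proof -
  define sc :: "real \<times> 'a \<times> 'b \<Rightarrow> 'a \<times> 'b" where "sc y = (fst (snd y), fst y *\<^sub>R snd (snd y))" for y
  define T where "T = sc -` W"
  define k where "k y = h (sc y) \<bullet> snd (snd y)" for y
  have sc_smooth: "smooth_on X sc" if "open X" for X
    unfolding sc_def
    by (intro smooth_on_Pair smooth_on_scaleR that smooth_on_fst
        smooth_on_linear_compose[OF bounded_linear_fst] smooth_on_linear_compose[OF bounded_linear_snd] smooth_on_snd)
  have "open T"
    unfolding T_def using smooth_on_continuous_on[OF sc_smooth[OF open_UNIV]] W(1)
    by (intro open_vimage) auto
  have sub: "{0..1} \<times> W \<subseteq> T" using star by (auto simp: T_def sc_def)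
  have "smooth_on T k"
    unfolding k_def
    by (intro smooth_on_inner \<open>open T\<close> smooth_on_compose[OF _ W sc_smooth]
        smooth_on_linear_compose[OF bounded_linear_snd] smooth_on_snd) (auto simp: T_def)
  define P where "P z = integral {0..1} (\<lambda>s. k (s, z))" for z
  show thesis
  proof
    show "smooth_on W P"
      unfolding P_def by (rule smooth_on_param_integral[OF \<open>open T\<close> \<open>smooth_on T k\<close> W(1) sub])
    fix z u assume z: "z \<in> W"
    obtain p x where zp: "z = (p, x)" by force
    have inW: "(p, s *\<^sub>R x) \<in> W" if "s \<in> {0..1}" for s using star z zp that by auto
    have Dk: "fderiv k (s, z) (0, (0, u)) =
        s * (fderiv h (p, s *\<^sub>R x) (0, x) \<bullet> u) + h (p, s *\<^sub>R x) \<bullet> u" if s: "s \<in> {0..1}" for s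
    proof -
      have 1: "(sc has_derivative (\<lambda>y. (fst (snd y), s *\<^sub>R snd (snd y) + fst y *\<^sub>R x))) (at (s, z))"
        unfolding sc_def zp by (auto intro!: derivative_eq_intros)
      have 2: "(h has_derivative fderiv h (p, s *\<^sub>R x)) (at (sc (s, z)))"
        using smooth_on_has_derivative[OF W(2) inW[OF s]] by (simp add: sc_def zp)
      have "(k has_derivative (\<lambda>y. h (sc (s, z)) \<bullet> snd (snd y) +
          fderiv h (p, s *\<^sub>R x) (fst (snd y), s *\<^sub>R snd (snd y) + fst y *\<^sub>R x) \<bullet> snd (snd (s, z)))) (at (s, z))"
        unfolding k_def
        by (rule has_derivative_inner[OF has_derivative_compose[OF 1 2]]) (auto intro!: derivative_eq_intros)
      from fun_cong[OF frechet_derivative_at[OF this, symmetric], of "(0, (0, u))"]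
      have "fderiv k (s, z) (0, (0, u)) =
        h (sc (s, z)) \<bullet> u + fderiv h (p, s *\<^sub>R x) (0, s *\<^sub>R u) \<bullet> x"
        by (simp add: zp)
      also have "fderiv h (p, s *\<^sub>R x) (0, s *\<^sub>R u) = s *\<^sub>R fderiv h (p, s *\<^sub>R x) (0, u)"
        using linear_cmul[OF linear_frechet_derivative_smooth[OF W(2) inW[OF s]], of s "(0, u)"] by simp
      finally show ?thesis using closed[OF inW[OF s], of u x] by (simp add: sc_def zp)
    qed
    have "fderiv P z (0, u) = integral {0..1} (\<lambda>s. fderiv k (s, z) (0, (0, u)))"
      unfolding P_def
      using frechet_derivative_at[OF has_derivative_param_integral[OF \<open>open T\<close> \<open>smooth_on T k\<close> W(1) sub z]]
      by (simp add: fun_eq_iff)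
    also have "\<dots> = integral {0..1} (\<lambda>s. s * (fderiv h (p, s *\<^sub>R x) (0, x) \<bullet> u) + h (p, s *\<^sub>R x) \<bullet> u)"
      by (rule integral_cong) (rule Dk)
    \<comment> \<open>Closedness has turned the integrand into the derivative of
      \<open>s * (h (p, s *\<^sub>R x) \<bullet> u)\<close> in \<open>s\<close>.\<close>
    also have "\<dots> = 1 * (h (p, 1 *\<^sub>R x) \<bullet> u) - 0 * (h (p, 0 *\<^sub>R x) \<bullet> u)"
    proof (rule integral_unique, rule fundamental_theorem_of_calculus)
      fix s :: real assume s: "s \<in> {0..1}"
      have 1: "((\<lambda>s. (p, s *\<^sub>R x)) has_derivative (\<lambda>r. (0, r *\<^sub>R x))) (at s)"
        by (auto intro!: derivative_eq_intros)
      have "((\<lambda>s. h (p, s *\<^sub>R x)) has_derivative (\<lambda>r. fderiv h (p, s *\<^sub>R x) (0, r *\<^sub>R x))) (at s)"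
        by (rule has_derivative_compose[OF 1 smooth_on_has_derivative[OF W(2) inW[OF s]]])
      then have "((\<lambda>s. s * (h (p, s *\<^sub>R x) \<bullet> u)) has_derivative
          (\<lambda>r. s * (fderiv h (p, s *\<^sub>R x) (0, r *\<^sub>R x) \<bullet> u) + r * (h (p, s *\<^sub>R x) \<bullet> u))) (at s)"
        by (intro has_derivative_mult has_derivative_inner_left has_derivative_ident)
      moreover have "fderiv h (p, s *\<^sub>R x) (0, r *\<^sub>R x) = r *\<^sub>R fderiv h (p, s *\<^sub>R x) (0, x)" for r
        using linear_cmul[OF linear_frechet_derivative_smooth[OF W(2) inW[OF s]], of r "(0, x)"] by simp
      ultimately have "((\<lambda>s. s * (h (p, s *\<^sub>R x) \<bullet> u)) has_vector_derivative
          s * (fderiv h (p, s *\<^sub>R x) (0, x) \<bullet> u) + h (p, s *\<^sub>R x) \<bullet> u) (at s)"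
        unfolding has_vector_derivative_def by (simp add: algebra_simps)
      then show "((\<lambda>s. s * (h (p, s *\<^sub>R x) \<bullet> u)) has_vector_derivative
          s * (fderiv h (p, s *\<^sub>R x) (0, x) \<bullet> u) + h (p, s *\<^sub>R x) \<bullet> u) (at s within {0..1})"
        by (rule has_vector_derivative_at_within)
    qed simp
    finally show "fderiv P z (0, u) = h z \<bullet> u" by (simp add: zp)
  qed
qed

text \<open>Reduced to \<open>poincare_fibre\<close> by a dummy real parameter and by a translation
  that moves the centre \<open>c\<close> to the origin.\<close>

lemma poincare_one_form:
  fixes h :: "'b::euclidean_space \<Rightarrow> 'b"
  assumes S: "open S" "smooth_on S h"
    and star: "\<And>x s. x \<in> S \<Longrightarrow> 0 \<le> s \<Longrightarrow> s \<le> 1 \<Longrightarrow> c + s *\<^sub>R (x - c) \<in> S"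
    and closed: "\<And>x u w. x \<in> S \<Longrightarrow> fderiv h x u \<bullet> w = fderiv h x w \<bullet> u"
  obtains P :: "'b \<Rightarrow> real"
  where "smooth_on S P" "\<And>x u. x \<in> S \<Longrightarrow> fderiv P x u = h x \<bullet> u"
proof -
  define W :: "(real \<times> 'b) set" where "W = UNIV \<times> (\<lambda>y. c + y) -` S"
  define H where "H z = h (c + snd z)" for z :: "real \<times> 'b"
  have oW: "open W" unfolding W_def
    by (intro open_Times open_UNIV open_vimage S) (auto intro!: continuous_intros)
  have sm: "smooth_on W (\<lambda>z. c + snd z)"
    by (intro smooth_on_add oW smooth_on_const smooth_on_snd)
  have H: "smooth_on W H" unfolding H_def
    by (rule smooth_on_compose[OF oW S sm]) (auto simp: W_def)
  have DH: "fderiv H z (a, u) = fderiv h (c + snd z) u" if "z \<in> W" for z a u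
  proof -
    have 1: "((\<lambda>z::real \<times> 'b. c + snd z) has_derivative snd) (at z)" by (auto intro!: derivative_eq_intros)
    have "(H has_derivative (\<lambda>w. fderiv h (c + snd z) (snd w))) (at z)"
      unfolding H_def
      by (rule has_derivative_compose[OF 1 smooth_on_has_derivative[OF S(2)]]) (use that in \<open>auto simp: W_def\<close>)
    from frechet_derivative_at[OF this] show ?thesis by (simp add: fun_eq_iff)
  qed
  obtain P where P: "smooth_on W P" "\<And>z u. z \<in> W \<Longrightarrow> fderiv P z (0, u) = H z \<bullet> u"
  proof (rule poincare_fibre[OF oW H])
    show "(p, s *\<^sub>R x) \<in> W" if "(p, x) \<in> W" "0 \<le> s" "s \<le> 1" for p x s
      using star[of "c + x" s] that by (auto simp: W_def)
    show "fderiv H z (0, u) \<bullet> w = fderiv H z (0, w) \<bullet> u"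
      if "z \<in> W" for z u w
      using that closed[of "c + snd z" u w] by (auto simp: DH W_def)
  qed blast
  have e: "smooth_on S (\<lambda>x. (0::real, x - c))"
    by (intro smooth_on_Pair smooth_on_diff S smooth_on_const smooth_on_ident)
  have inW: "(0::real, x - c) \<in> W" if "x \<in> S" for x using that by (auto simp: W_def)
  show thesis
  proof
    show "smooth_on S (\<lambda>x. P (0, x - c))"
      by (rule smooth_on_compose[OF S(1) oW P(1) e]) (use inW in auto)
    fix x u assume x: "x \<in> S"
    have 1: "((\<lambda>x. (0::real, x - c)) has_derivative (\<lambda>u. (0, u))) (at x)"
      by (auto intro!: derivative_eq_intros)
    from frechet_derivative_at[OF has_derivative_compose[OF 1 smooth_on_has_derivative[OF P(1) inW[OF x]]]]
    show "fderiv (\<lambda>x. P (0, x - c)) x u = h x \<bullet> u"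
      using P(2)[OF inW[OF x], of u] by (simp add: H_def fun_eq_iff)
  qed
qed

lemma frechet_derivative_skew:
  fixes m :: "'a::real_normed_vector \<Rightarrow> real ^ 'n ^ 'n::finite"
  assumes "open S" "smooth_on S m" "x \<in> S" "\<And>x i j. x \<in> S \<Longrightarrow> m x $ i $ j = - m x $ j $ i"
  shows "fderiv m x u $ p $ q = - fderiv m x u $ q $ p"
proof -
  have d: "((\<lambda>x. m x $ p $ q) has_derivative (\<lambda>u. fderiv m x u $ p $ q)) (at x)" for p q
    by (intro bounded_linear.has_derivative[OF bounded_linear_vec_nth] smooth_on_has_derivative[OF assms(2,3)])
  have "fderiv (\<lambda>x. m x $ p $ q) x = fderiv (\<lambda>x. - m x $ q $ p) x"
    by (rule frechet_derivative_transform_open[OF assms(1,3)]) (rule assms(4))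
  then show ?thesis
    using fun_cong[OF frechet_derivative_at[OF d[of p q]], of u]
      fun_cong[OF frechet_derivative_at[OF has_derivative_minus[OF d[of q p]]], of u] by simp
qed

text \<open>\<open>a\<close> is the image of \<open>m\<close> under the homotopy operator of the
  Poincare lemma, the contraction with \<open>x - c\<close> integrated along the ray from
  \<open>c\<close>. The factor \<open>s\<close>, absent for 1-forms, belongs to degree 2: one
  argument of the form stays free and is scaled along the ray.\<close>

lemma poincare_two_form:
  fixes m :: "real ^ 'n \<Rightarrow> real ^ 'n ^ 'n::finite"
  assumes S: "open S" "smooth_on S m"
    and star: "\<And>x s. x \<in> S \<Longrightarrow> 0 \<le> s \<Longrightarrow> s \<le> 1 \<Longrightarrow> c + s *\<^sub>R (x - c) \<in> S"
    and skew: "\<And>x i j. x \<in> S \<Longrightarrow> m x $ i $ j = - m x $ j $ i"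
    and closed: "\<And>x i j k. x \<in> S \<Longrightarrow>
      fderiv m x (axis i 1) $ j $ k + fderiv m x (axis j 1) $ k $ i
        + fderiv m x (axis k 1) $ i $ j = 0"
  obtains a :: "real ^ 'n \<Rightarrow> real ^ 'n"
  where "smooth_on S a"
    "\<And>x i j. x \<in> S \<Longrightarrow> fderiv a x (axis j 1) $ i - fderiv a x (axis i 1) $ j = m x $ j $ i"
proof -
  define sc :: "real \<times> (real ^ 'n) \<Rightarrow> real ^ 'n" where "sc y = c + fst y *\<^sub>R (snd y - c)" for y
  define T where "T = sc -` S"
  define k where "k y = fst y *\<^sub>R ((snd y - c) v* m (sc y))" for y
  have sc_smooth: "smooth_on X sc" if "open X" for X
    unfolding sc_def
    by (intro smooth_on_add smooth_on_diff smooth_on_scaleR that smooth_on_fst smooth_on_const smooth_on_snd)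
  have "open T"
    unfolding T_def using smooth_on_continuous_on[OF sc_smooth[OF open_UNIV]] S(1)
    by (intro open_vimage) auto
  have sub: "{0..1} \<times> S \<subseteq> T" using star by (auto simp: T_def sc_def)
  have bil: "bounded_bilinear (\<lambda>(x::real^'n) (M::real^'n^'n). x v* M)"
    by (rule bilinear_conv_bounded_bilinear[THEN iffD1])
      (auto simp: bilinear_def vec_eq_iff vector_matrix_mult_def sum.distrib algebra_simps sum_distrib_left
        intro!: linearI)
  have "smooth_on T k"
    unfolding k_def
    by (intro smooth_on_scaleR smooth_on_bilinear[OF bil] \<open>open T\<close> smooth_on_compose[OF _ S sc_smooth]
        smooth_on_fst smooth_on_diff smooth_on_const smooth_on_snd) (auto simp: T_def)
  define a where "a x = integral {0..1} (\<lambda>s. k (s, x))" for x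
  show thesis
  proof
    show "smooth_on S a"
      unfolding a_def by (rule smooth_on_param_integral[OF \<open>open T\<close> \<open>smooth_on T k\<close> S(1) sub])
    fix x i j assume x: "x \<in> S"
    define y where "y = x - c"
    have inS: "c + s *\<^sub>R y \<in> S" if "s \<in> {0..1}" for s using star x that by (auto simp: y_def)
    define N where "N s = fderiv m (c + s *\<^sub>R y)" for s
    have linN: "linear (N s)" if "s \<in> {0..1}" for s
      unfolding N_def by (rule linear_frechet_derivative_smooth[OF S(2) inS[OF that]])
    have Dk: "fderiv k (s, x) (0, u) = s *\<^sub>R (s *\<^sub>R (y v* N s u) + u v* m (c + s *\<^sub>R y))"
      if s: "s \<in> {0..1}" for s u
    proof -
      have 1: "(sc has_derivative (\<lambda>w. fst w *\<^sub>R y + s *\<^sub>R snd w)) (at (s, x))"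
        unfolding sc_def y_def by (auto intro!: derivative_eq_intros)
      have 2: "(m has_derivative N s) (at (sc (s, x)))"
        using smooth_on_has_derivative[OF S(2) inS[OF s]] by (simp add: sc_def N_def y_def)
      have 3: "((\<lambda>w::real \<times> (real^'n). snd w - c) has_derivative snd) (at (s, x))"
        by (auto intro!: derivative_eq_intros)
      have "(k has_derivative (\<lambda>w. fst (s, x) *\<^sub>R
          ((snd (s, x) - c) v* N s (fst w *\<^sub>R y + s *\<^sub>R snd w) + snd w v* m (sc (s, x)))
          + fst w *\<^sub>R ((snd (s, x) - c) v* m (sc (s, x))))) (at (s, x))"
        unfolding k_def
        by (intro has_derivative_scaleR has_derivative_fst has_derivative_ident
            bounded_bilinear.FDERIV[OF bil 3 has_derivative_compose[OF 1 2]])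
      from fun_cong[OF frechet_derivative_at[OF this, symmetric], of "(0, u)"]
      have "fderiv k (s, x) (0, u) = s *\<^sub>R (y v* N s (s *\<^sub>R u) + u v* m (sc (s, x)))"
        by (simp add: y_def)
      also have "N s (s *\<^sub>R u) = s *\<^sub>R N s u" by (rule linear_cmul[OF linN[OF s]])
      finally show ?thesis
        by (simp add: sc_def y_def bounded_bilinear.scaleR_right[OF bil])
    qed
    have Da: "fderiv a x u $ l
        = integral {0..1} (\<lambda>s. s * (s * (y v* N s u) $ l + (u v* m (c + s *\<^sub>R y)) $ l))"
      (is "_ = ?I u l")
      and int: "(\<lambda>s. s * (s * (y v* N s u) $ l + (u v* m (c + s *\<^sub>R y)) $ l)) integrable_on {0..1}" for u l
    proof -
      have c: "continuous_on {0..1} (\<lambda>s. fderiv k (s, x) (0, u))"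
        by (rule continuous_on_compose2[OF smooth_on_continuous_on[OF smooth_on_frechet_derivative[OF \<open>smooth_on T k\<close>]]])
          (use sub x in \<open>auto intro!: continuous_intros\<close>)
      then have "continuous_on {0..1} (\<lambda>s. fderiv k (s, x) (0, u) $ l)"
        by (intro continuous_intros)
      then have "continuous_on {0..1} (\<lambda>s. s * (s * (y v* N s u) $ l + (u v* m (c + s *\<^sub>R y)) $ l))"
        by (rule continuous_on_eq) (simp add: Dk)
      then show "(\<lambda>s. s * (s * (y v* N s u) $ l + (u v* m (c + s *\<^sub>R y)) $ l)) integrable_on {0..1}"
        by (rule integrable_continuous_real)
      have "fderiv a x u = integral {0..1} (\<lambda>s. fderiv k (s, x) (0, u))"
        unfolding a_def
        using frechet_derivative_at[OF has_derivative_param_integral[OF \<open>open T\<close> \<open>smooth_on T k\<close> S(1) sub x]]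
        by (simp add: fun_eq_iff)
      then have "fderiv a x u $ l = integral {0..1} (\<lambda>s. fderiv k (s, x) (0, u)) $ l"
        by simp
      also have "\<dots> = integral {0..1} (\<lambda>s. fderiv k (s, x) (0, u) $ l)"
        using integral_linear[OF integrable_continuous_real[OF c] bounded_linear_vec_nth, of l] by (simp add: o_def)
      also have "\<dots> = ?I u l" by (rule integral_cong) (simp add: Dk)
      finally show "fderiv a x u $ l = ?I u l" .
    qed
    have skewN: "N s u $ p $ q = - N s u $ q $ p" if s: "s \<in> {0..1}" for s u p q
      unfolding N_def by (rule frechet_derivative_skew[OF S inS[OF s] skew])
    have integrand: "s * (s * (y v* N s (axis j 1)) $ i + (axis j 1 v* m (c + s *\<^sub>R y)) $ i)
        - s * (s * (y v* N s (axis i 1)) $ j + (axis i 1 v* m (c + s *\<^sub>R y)) $ j)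
        = s\<^sup>2 * (N s y $ j $ i) + 2 * s * (m (c + s *\<^sub>R y) $ j $ i)" if s: "s \<in> {0..1}" for s
    proof -
      have ax: "(axis p 1 v* M) $ q = M $ p $ q" for M :: "real^'n^'n" and p q
        by (simp add: vector_matrix_mult_def axis_def if_distrib[of "\<lambda>x. x * _"] cong: if_cong)
      \<comment> \<open>\<open>closed\<close> together with skewness trades the direction of
        differentiation for a component index, so the difference becomes the derivative of
        \<open>m\<close> along the ray.\<close>
      have "(y v* N s (axis j 1)) $ i - (y v* N s (axis i 1)) $ j = (\<Sum>l\<in>UNIV. y $ l * (N s (axis l 1) $ j $ i))"
      proof -
        have "N s (axis j 1) $ l $ i - N s (axis i 1) $ l $ j = N s (axis l 1) $ j $ i" for l
          using closed[OF inS[OF s], of i j l, folded N_def] skewN[OF s, of "axis j 1" l i]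
            skewN[OF s, of "axis l 1" i j] skewN[OF s, of "axis i 1" l j] by simp
        then have "y $ l * N s (axis j 1) $ l $ i - y $ l * N s (axis i 1) $ l $ j = y $ l * N s (axis l 1) $ j $ i" for l
          by (metis right_diff_distrib)
        then show ?thesis
          by (simp add: vector_matrix_mult_def sum_subtractf[symmetric] mult.commute)
      qed
      also have "\<dots> = N s y $ j $ i"
      proof -
        have "N s y = N s (\<Sum>l\<in>UNIV. y $ l *\<^sub>R axis l 1)"
          using basis_expansion[of y] by (simp add: scalar_mult_eq_scaleR)
        also have "\<dots> = (\<Sum>l\<in>UNIV. y $ l *\<^sub>R N s (axis l 1))"
          by (simp add: linear_sum[OF linN[OF s]] linear_cmul[OF linN[OF s]])
        finally show ?thesis by simp
      qed
      finally have e: "(y v* N s (axis j 1)) $ i = N s y $ j $ i + (y v* N s (axis i 1)) $ j" by simp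
      show ?thesis unfolding e ax
        using skew[OF inS[OF s], of i j] by (simp add: algebra_simps power2_eq_square)
    qed
    have "fderiv a x (axis j 1) $ i - fderiv a x (axis i 1) $ j
      = integral {0..1} (\<lambda>s. s * (s * (y v* N s (axis j 1)) $ i + (axis j 1 v* m (c + s *\<^sub>R y)) $ i)
        - s * (s * (y v* N s (axis i 1)) $ j + (axis i 1 v* m (c + s *\<^sub>R y)) $ j))"
      unfolding Da by (rule integral_diff[symmetric]) (rule int)+
    also have "\<dots> = integral {0..1} (\<lambda>s. s\<^sup>2 * (N s y $ j $ i) + 2 * s * (m (c + s *\<^sub>R y) $ j $ i))"
      by (rule integral_cong) (rule integrand)
    \<comment> \<open>The integrand is the derivative of
      \<open>s\<^sup>2 * (m (c + s *\<^sub>R y) $ j $ i)\<close> in \<open>s\<close>.\<close>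
    also have "\<dots> = 1\<^sup>2 * (m (c + 1 *\<^sub>R y) $ j $ i) - 0\<^sup>2 * (m (c + 0 *\<^sub>R y) $ j $ i)"
    proof (rule integral_unique, rule fundamental_theorem_of_calculus)
      fix s :: real assume s: "s \<in> {0..1}"
      have 1: "((\<lambda>s. c + s *\<^sub>R y) has_derivative (\<lambda>r. r *\<^sub>R y)) (at s)"
        by (auto intro!: derivative_eq_intros)
      have "((\<lambda>s. m (c + s *\<^sub>R y)) has_derivative (\<lambda>r. N s (r *\<^sub>R y))) (at s)"
        unfolding N_def by (rule has_derivative_compose[OF 1 smooth_on_has_derivative[OF S(2) inS[OF s]]])
      then have "((\<lambda>s. m (c + s *\<^sub>R y) $ j $ i) has_derivative (\<lambda>r. N s (r *\<^sub>R y) $ j $ i)) (at s)"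
        by (intro bounded_linear.has_derivative[OF bounded_linear_vec_nth])
      then have "((\<lambda>s. m (c + s *\<^sub>R y) $ j $ i) has_field_derivative N s y $ j $ i) (at s)"
        by (simp add: has_field_derivative_def linear_cmul[OF linN[OF s]] mult.commute[of _ "N s y $ j $ i"])
      then have "((\<lambda>s. s\<^sup>2 * (m (c + s *\<^sub>R y) $ j $ i)) has_field_derivative
          s\<^sup>2 * (N s y $ j $ i) + 2 * s * (m (c + s *\<^sub>R y) $ j $ i)) (at s)"
        by (auto intro!: derivative_eq_intros)
      then show "((\<lambda>s. s\<^sup>2 * (m (c + s *\<^sub>R y) $ j $ i)) has_vector_derivative
          s\<^sup>2 * (N s y $ j $ i) + 2 * s * (m (c + s *\<^sub>R y) $ j $ i)) (at s within {0..1})"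
        by (rule has_vector_derivative_at_within[OF has_real_derivative_iff_has_vector_derivative[THEN iffD1]])
    qed simp
    finally show "fderiv a x (axis j 1) $ i - fderiv a x (axis i 1) $ j = m x $ j $ i"
      by (simp add: y_def)
  qed
qed

section \<open>Local solutions of ordinary differential equations\<close>

text \<open>The mean value inequality on a convex set. The operator norm of the derivative is at
  most the sum of the norms of its values on the basis, a continuous function and hence bounded on
  the compact ball.\<close>

lemma smooth_on_lipschitz_cball:
  fixes F :: "'a::euclidean_space \<Rightarrow> 'b::euclidean_space"
  assumes "smooth_on S F" "cball y0 r \<subseteq> S"
  obtains B where "B \<ge> 0" "\<And>x y. x \<in> cball y0 r \<Longrightarrow> y \<in> cball y0 r \<Longrightarrow> norm (F x - F y) \<le> B * norm (x - y)"
proof -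
  have "continuous_on (cball y0 r) (\<lambda>x. \<Sum>i\<in>Basis. norm (fderiv F x i))"
    by (intro continuous_intros continuous_on_subset[OF smooth_on_continuous_on[OF smooth_on_frechet_derivative[OF assms(1)]] assms(2)])
  then have "bounded ((\<lambda>x. \<Sum>i\<in>Basis. norm (fderiv F x i)) ` cball y0 r)"
    by (intro compact_imp_bounded compact_continuous_image compact_cball)
  then obtain B where B: "B > 0" "\<And>x. x \<in> cball y0 r \<Longrightarrow> norm (\<Sum>i\<in>Basis. norm (fderiv F x i)) \<le> B"
    unfolding bounded_pos by auto
  show thesis
  proof
    show "0 \<le> B" using B by simp
    fix x y assume xy: "x \<in> cball y0 r" "y \<in> cball y0 r"
    show "norm (F x - F y) \<le> B * norm (x - y)"
    proof (rule differentiable_bound[OF convex_cball _ _ xy(1,2)])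
      fix z assume z: "z \<in> cball y0 r"
      have d: "(F has_derivative fderiv F z) (at z)"
        using smooth_on_has_derivative[OF assms(1)] z assms(2) by blast
      then show "(F has_derivative fderiv F z) (at z within cball y0 r)"
        by (rule has_derivative_at_withinI)
      show "onorm (fderiv F z) \<le> B"
        using onorm_componentwise[OF has_derivative_bounded_linear[OF d]] B(2)[OF z] by (simp add: sum_nonneg)
    qed
  qed
qed

text \<open>The field is composed with the projection onto a ball, which makes it bounded and globally
  Lipschitz. All integrals start at \<open>-h\<close>, since an integral over a reversed interval is \<open>0\<close>.\<close>

lemma ode_local_solution:
  fixes F :: "'a::euclidean_space \<Rightarrow> 'a"
  assumes S: "open S" "smooth_on S F" "y0 \<in> S"
  obtains e y where "e > 0" "y 0 = y0" "\<And>t. t \<in> {-e<..<e} \<Longrightarrow> y t \<in> S"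
    "\<And>t. t \<in> {-e<..<e} \<Longrightarrow> (y has_vector_derivative F (y t)) (at t)"
proof -
  obtain r where r: "r > 0" "cball y0 r \<subseteq> S" using S open_contains_cball by blast
  obtain B where B: "B \<ge> 0"
    "\<And>x y. x \<in> cball y0 r \<Longrightarrow> y \<in> cball y0 r \<Longrightarrow> norm (F x - F y) \<le> B * norm (x - y)"
    using smooth_on_lipschitz_cball[OF S(2) r(2)] by blast
  have "bounded (F ` cball y0 r)"
    by (intro compact_imp_bounded compact_continuous_image compact_cball
        continuous_on_subset[OF smooth_on_continuous_on[OF S(2)] r(2)])
  then obtain M where M: "M > 0" "\<And>x. x \<in> cball y0 r \<Longrightarrow> norm (F x) \<le> M"
    unfolding bounded_pos by auto
  define proj where "proj = closest_point (cball y0 r)"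
  have proj_in: "proj x \<in> cball y0 r" for x
    unfolding proj_def by (rule closest_point_in_set) (use r in auto)
  have proj_lip: "norm (proj x - proj y) \<le> norm (x - y)" for x y
    unfolding proj_def using closest_point_lipschitz[of "cball y0 r" x y] r by (simp add: dist_norm)
  have proj_self: "proj x = x" if "x \<in> cball y0 r" for x
    unfolding proj_def by (rule closest_point_self[OF that])
  define G where "G x = F (proj x)" for x
  have G_bd: "norm (G x) \<le> M" for x unfolding G_def by (rule M(2)[OF proj_in])
  have G_lip: "norm (G x - G y) \<le> B * norm (x - y)" for x y
    unfolding G_def using B(2)[OF proj_in proj_in, of x y] mult_left_mono[OF proj_lip B(1), of x y] by linarith
  have G_cont: "continuous_on UNIV G"
    unfolding continuous_on_iff
  proof (intro ballI allI impI)
    fix x e assume "(e::real) > 0"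
    have "dist (G y) (G x) < e" if "dist y x < e / (B + 1)" for y
    proof -
      have "norm (G y - G x) \<le> B * norm (y - x)" by (rule G_lip)
      also have "\<dots> \<le> (B + 1) * norm (y - x)" by (intro mult_right_mono) auto
      also have "\<dots> < e" using that B(1) by (simp add: dist_norm field_simps)
      finally show ?thesis by (simp add: dist_norm)
    qed
    then show "\<exists>d>0. \<forall>x'\<in>UNIV. dist x' x < d \<longrightarrow> dist (G x') (G x) < e"
      using \<open>e > 0\<close> B(1) by (intro exI[of _ "e / (B + 1)"]) auto
  qed
  \<comment> \<open>Two integrals enter \<open>J\<close>, over intervals of length at most
    \<open>2 * h\<close> and \<open>h\<close>; this is the origin of the 3. The bound with
    \<open>M\<close> keeps the values in the ball of radius \<open>r\<close>, the bound with
    \<open>B\<close> makes the Picard map a contraction with factor 1/2.\<close>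
  define h where "h = min (r / (3 * M)) (1 / (6 * (B + 1)))"
  have h: "h > 0" "3 * h * M \<le> r" "3 * h * B \<le> 1 / 2"
  proof -
    show "h > 0" using r M B by (simp add: h_def)
    have "h \<le> r / (3 * M)" by (simp add: h_def)
    then show "3 * h * M \<le> r" using M by (simp add: field_simps)
    have "h \<le> 1 / (6 * (B + 1))" by (simp add: h_def)
    then have "h * (6 * (B + 1)) \<le> 1" using B(1) by (subst (asm) pos_le_divide_eq) auto
    then show "3 * h * B \<le> 1 / 2" using \<open>h > 0\<close> by (simp add: algebra_simps)
  qed
  \<comment> \<open>Freezing the upper limit outside the interval makes \<open>J g\<close> a bounded
    continuous function on the whole line, so the fixed point theorem can be applied in the complete
    space of such functions.\<close>
  define clamp where "clamp t = max (-h) (min h t)" for t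
  have clamp: "clamp t \<in> {-h..h}" for t using h by (auto simp: clamp_def)
  define J where "J g t = y0 + (integral {-h..clamp t} g - integral {-h..0} g)" for g :: "real \<Rightarrow> 'a" and t
  have J_est: "norm (J g1 t - J g2 t) \<le> 3 * h * C"
    if g: "continuous_on UNIV g1" "continuous_on UNIV g2" "\<And>s. norm (g1 s - g2 s) \<le> C" for g1 g2 t C
  proof -
    have int: "g integrable_on {-h..a}" if "continuous_on UNIV g" for g :: "real \<Rightarrow> 'a" and a
      by (rule integrable_continuous_real[OF continuous_on_subset[OF that]]) simp
    have bd: "norm (integral {-h..a} g1 - integral {-h..a} g2) \<le> C * (a + h)" if "-h \<le> a" for a
    proof -
      have "norm (integral {-h..a} (\<lambda>s. g1 s - g2 s)) \<le> C * (a - (-h))"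
        by (rule integral_bound[OF that _ g(3)])
          (intro continuous_intros continuous_on_subset[OF g(1)] continuous_on_subset[OF g(2)] subset_UNIV)
      then show ?thesis by (simp add: integral_diff int g)
    qed
    have "0 \<le> C" using g(3)[of 0] norm_ge_zero order_trans by blast
    have "J g1 t - J g2 t = (integral {-h..clamp t} g1 - integral {-h..clamp t} g2)
        - (integral {-h..0} g1 - integral {-h..0} g2)" by (simp add: J_def)
    then have "norm (J g1 t - J g2 t) \<le> norm (integral {-h..clamp t} g1 - integral {-h..clamp t} g2)
        + norm (integral {-h..0} g1 - integral {-h..0} g2)" by (simp only: norm_triangle_ineq4)
    also have "\<dots> \<le> C * (clamp t + h) + C * (0 + h)"
      using clamp[of t] h by (intro add_mono bd) auto
    also have "\<dots> \<le> C * (h + h) + C * (0 + h)"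
      using clamp[of t] \<open>0 \<le> C\<close> by (intro add_mono mult_left_mono) auto
    finally show ?thesis by (simp add: algebra_simps)
  qed
  have J_zero: "J (\<lambda>_. 0) t = y0" for t by (simp add: J_def)
  have J_cont: "continuous_on UNIV (J g)" if "continuous_on UNIV g" for g
  proof -
    have "continuous_on {-h..h} (\<lambda>a. integral {-h..a} g)"
      by (intro indefinite_integral_continuous_1 integrable_continuous_real continuous_on_subset[OF that]) simp
    then have "continuous_on UNIV (\<lambda>t. integral {-h..clamp t} g)"
      by (rule continuous_on_compose2) (use clamp in \<open>auto simp: clamp_def intro!: continuous_intros\<close>)
    then show ?thesis unfolding J_def by (intro continuous_intros)
  qed
  have Gy: "continuous_on UNIV (\<lambda>s. G (apply_bcontfun y s))" for y :: "real \<Rightarrow>\<^sub>C 'a"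
    by (rule continuous_on_compose2[OF G_cont]) auto
  have J_bd: "norm (J (\<lambda>s. G (apply_bcontfun y s)) t - y0) \<le> 3 * h * M" for y :: "real \<Rightarrow>\<^sub>C 'a" and t
    using J_est[OF Gy continuous_on_const, of y 0 M t] G_bd by (simp add: J_zero)
  define T where "T y = Bcontfun (J (\<lambda>s. G (apply_bcontfun y s)))" for y :: "real \<Rightarrow>\<^sub>C 'a"
  have T: "apply_bcontfun (T y) = J (\<lambda>s. G (apply_bcontfun y s))" for y
    unfolding T_def
  proof (rule Bcontfun_inverse)
    have "range (J (\<lambda>s. G (apply_bcontfun y s))) \<subseteq> cball y0 (3 * h * M)"
      using J_bd[of y] by (auto simp: dist_norm norm_minus_commute)
    then show "J (\<lambda>s. G (apply_bcontfun y s)) \<in> bcontfun"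
      using J_cont[OF Gy, of y] bounded_subset[OF bounded_cball] by (auto simp: bcontfun_def)
  qed
  have "dist (T y) (T z) \<le> 1/2 * dist y z" for y z
  proof (rule dist_bound)
    fix t
    have "norm (G (apply_bcontfun y s) - G (apply_bcontfun z s)) \<le> B * dist y z" for s
      using order_trans[OF G_lip mult_left_mono[OF dist_bounded[of y s z, unfolded dist_norm] B(1)]] by (simp add: dist_norm)
    from J_est[OF Gy Gy this] have "dist (apply_bcontfun (T y) t) (apply_bcontfun (T z) t) \<le> 3 * h * (B * dist y z)"
      by (simp add: T dist_norm)
    also have "\<dots> \<le> 1/2 * dist y z"
      using mult_right_mono[OF h(3), of "dist y z"] by (simp add: mult.assoc)
    finally show "dist (apply_bcontfun (T y) t) (apply_bcontfun (T z) t) \<le> 1/2 * dist y z" .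
  qed
  then obtain y where y: "T y = y" using banach_fix_type[of "1/2" T] by auto
  have yJ: "apply_bcontfun y t = J (\<lambda>s. G (apply_bcontfun y s)) t" for t
    using T[of y] y by simp
  \<comment> \<open>The fixed point never leaves the ball, where \<open>proj\<close> is the
    identity; thus it solves the original equation and not only the modified one.\<close>
  have in_ball: "apply_bcontfun y t \<in> cball y0 r" for t
    using J_bd[of y t] h(2) yJ[of t] by (simp add: dist_norm norm_minus_commute)
  show thesis
  proof
    show "h > 0" by (rule h)
    show "apply_bcontfun y 0 = y0" using yJ[of 0] h by (simp add: J_def clamp_def)
    fix t assume t: "t \<in> {-h<..<h}"
    show "apply_bcontfun y t \<in> S" using in_ball r by blast
    have "((\<lambda>a. integral {-h..a} (\<lambda>s. G (apply_bcontfun y s))) has_vector_derivative G (apply_bcontfun y t)) (at t within {-h..h})"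
      by (rule integral_has_vector_derivative[OF continuous_on_subset[OF Gy]]) (use t in auto)
    then have "((\<lambda>a. integral {-h..a} (\<lambda>s. G (apply_bcontfun y s))) has_vector_derivative G (apply_bcontfun y t)) (at t)"
      using t at_within_interior[of t "{-h..h}"] by (simp add: interior_atLeastAtMost_real)
    then have "((\<lambda>a. y0 + (integral {-h..a} (\<lambda>s. G (apply_bcontfun y s)) - integral {-h..0} (\<lambda>s. G (apply_bcontfun y s))))
      has_vector_derivative G (apply_bcontfun y t)) (at t)"
      by (auto intro!: derivative_eq_intros)
    moreover have "y0 + (integral {-h..a} (\<lambda>s. G (apply_bcontfun y s)) - integral {-h..0} (\<lambda>s. G (apply_bcontfun y s)))
        = apply_bcontfun y a" if "a \<in> {-h<..<h}" for a
      using yJ[of a] that by (simp add: J_def clamp_def)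
    ultimately have "(apply_bcontfun y has_vector_derivative G (apply_bcontfun y t)) (at t)"
      using has_vector_derivative_transform_within_open[OF _ open_greaterThanLessThan t] by blast
    then show "(apply_bcontfun y has_vector_derivative F (apply_bcontfun y t)) (at t)"
      using proj_self[OF in_ball] by (simp add: G_def)
  qed
qed

text \<open>Bootstrapping: if \<open>y\<close> is of class \<open>k\<close>, so is the right hand
  side \<open>F (y t)\<close>, which is the derivative of \<open>y\<close>; hence \<open>y\<close>
  is of class \<open>k + 1\<close>.\<close>

lemma ode_solution_smooth:
  fixes F :: "'a::euclidean_space \<Rightarrow> 'a"
  assumes S: "open S" "smooth_on S F" and I: "open I" "y ` I \<subseteq> S"
    and ode: "\<And>t. t \<in> I \<Longrightarrow> (y has_vector_derivative F (y t)) (at t)"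
  shows "smooth_on I y"
proof -
  have "higher_differentiable_on I y k" for k
  proof (induction k)
    case 0
    then show ?case
      using has_vector_derivative_continuous[OF ode] by (auto intro!: continuous_at_imp_continuous_on)
  next
    case (Suc k)
    show ?case
    proof (rule higher_differentiable_on_SucI[OF I(1) ode[unfolded has_vector_derivative_def]])
      fix v :: real
      have "higher_differentiable_on I (\<lambda>t. F (y t)) k"
        by (rule higher_differentiable_on_compose[OF I(1) S(1) I(2) _ Suc.IH]) (use S(2) in \<open>simp add: smooth_on_def\<close>)
      then show "higher_differentiable_on I (\<lambda>t. v *\<^sub>R F (y t)) k"
        by (rule higher_differentiable_on_linear_compose[OF bounded_linear_scaleR_right I(1)])
    qed
  qed
  then show ?thesis by (simp add: smooth_on_def)
qed

section \<open>Calculus in one chart\<close>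

lemma frechet_derivative_add:
  "F differentiable at z \<Longrightarrow> G differentiable at z \<Longrightarrow>
    fderiv (\<lambda>y. F y + G y) z u = fderiv F z u + fderiv G z u"
  using fun_cong[OF frechet_derivative_at[OF has_derivative_add, symmetric], of F _ z G _ u]
  by (simp add: frechet_derivative_works)

lemma frechet_derivative_diff:
  "F differentiable at z \<Longrightarrow> G differentiable at z \<Longrightarrow>
    fderiv (\<lambda>y. F y - G y) z u = fderiv F z u - fderiv G z u"
  using fun_cong[OF frechet_derivative_at[OF has_derivative_diff, symmetric], of F _ z G _ u]
  by (simp add: frechet_derivative_works)

lemma frechet_derivative_mult:
  fixes F G :: "'a::real_normed_vector \<Rightarrow> real"
  shows "F differentiable at z \<Longrightarrow> G differentiable at z \<Longrightarrow>
    fderiv (\<lambda>y. F y * G y) z u = F z * fderiv G z u + fderiv F z u * G z"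
  using fun_cong[OF frechet_derivative_at[OF has_derivative_mult, symmetric], of F _ z G _ u]
  by (simp add: frechet_derivative_works)

lemma frechet_derivative_sum:
  "(\<And>i. i \<in> I \<Longrightarrow> F i differentiable at z) \<Longrightarrow>
    fderiv (\<lambda>y. \<Sum>i\<in>I. F i y) z u = (\<Sum>i\<in>I. fderiv (F i) z u)"
  using fun_cong[OF frechet_derivative_at[OF has_derivative_sum, symmetric],
      of I F "\<lambda>i. fderiv (F i) z" z u]
  by (simp add: frechet_derivative_works)

lemma frechet_derivative_nth:
  fixes F :: "'a::real_normed_vector \<Rightarrow> ('b::real_normed_vector) ^ 'n::finite"
  shows "F differentiable at z \<Longrightarrow> fderiv (\<lambda>y. F y $ i) z u = fderiv F z u $ i"
  using fun_cong[OF frechet_derivative_at[OF bounded_linear.has_derivative[OF bounded_linear_vec_nth], symmetric], of F _ z i u]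
  by (simp add: frechet_derivative_works)

lemma frechet_derivative_fst:
  fixes F :: "'a::real_normed_vector \<Rightarrow> 'c::real_normed_vector"
  assumes "F differentiable at (fst z)"
  shows "fderiv (\<lambda>y::'a \<times> 'b::real_normed_vector. F (fst y)) z u = fderiv F (fst z) (fst u)"
  using fun_cong[OF frechet_derivative_at[OF has_derivative_compose[OF has_derivative_fst[OF has_derivative_ident]
          assms[unfolded frechet_derivative_works]], symmetric]] by simp

lemma smooth_on_pullback:
  fixes F :: "'a::euclidean_space \<Rightarrow> 'c::real_normed_vector"
  assumes "open S" "smooth_on S F"
  shows "smooth_on (S \<times> (UNIV::'b::euclidean_space set)) (\<lambda>z. F (fst z))"
  by (rule smooth_on_compose[OF _ assms smooth_on_fst]) (auto intro!: open_Times assms)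

lemma linear_tcoord_expansion:
  fixes T :: "'n::finite tcoord \<Rightarrow> real"
  assumes "linear T"
  shows "T (v, a) = (\<Sum>i\<in>UNIV. v $ i * T (axis i 1, 0) + a $ i * T (0, axis i 1))"
proof -
  have ax: "(\<Sum>i\<in>UNIV. x $ i *\<^sub>R axis i 1) = x" for x :: "real^'n"
    using basis_expansion[of x] by (simp add: scalar_mult_eq_scaleR)
  have "(v, a) = (\<Sum>i\<in>UNIV. v $ i *\<^sub>R (axis i 1, 0) + a $ i *\<^sub>R (0, axis i 1))"
    by (simp add: prod_eq_iff fst_sum snd_sum ax)
  then show ?thesis
    by (simp add: linear_sum[OF assms] linear_add[OF assms] linear_cmul[OF assms] del: add_Pair scaleR_Pair)
qed

section \<open>The derivation along the second-order field and its commutators with coordinate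
  derivatives\<close>

lemma Gam_frechet_derivative:
  assumes "F differentiable at z"
  shows "Gam f F z = fderiv F z (snd z, f z)"
  using linear_tcoord_expansion[OF linear_frechet_derivative[OF assms], of "snd z" "f z"]
  by (simp add: Gam_def dq_def dv_def)

lemma smooth_on_dq: "smooth_on W F \<Longrightarrow> smooth_on W (dq i F)"
  unfolding dq_def[abs_def] by (rule smooth_on_frechet_derivative)

lemma smooth_on_dv: "smooth_on W F \<Longrightarrow> smooth_on W (dv i F)"
  unfolding dv_def[abs_def] by (rule smooth_on_frechet_derivative)

lemma smooth_on_Gam:
  fixes f :: "'n tcoord \<Rightarrow> real ^ 'n::finite"
  assumes "open W" "smooth_on W f" "smooth_on W F"
  shows "smooth_on W (Gam f F)"
  unfolding Gam_def[abs_def]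
  by (intro smooth_on_sum smooth_on_add smooth_on_mult smooth_on_nth smooth_on_snd smooth_on_dq smooth_on_dv assms)

lemma smooth_on_conn:
  assumes "open W" "smooth_on W f"
  shows "smooth_on W (conn f j i)"
  unfolding conn_def[abs_def]
  by (intro smooth_on_mult smooth_on_const smooth_on_dv smooth_on_nth assms)

text \<open>Leibniz on the basis expansion of \<open>X\<close>, followed by symmetry of second
  derivatives: the commutator of the constant field \<open>u\<close> with \<open>X\<close> is the
  derivative of \<open>X\<close> along \<open>u\<close>. The commutators with \<Gamma> and the
  derivative of a tangent map are instances.\<close>

lemma frechet_derivative_apply_field:
  fixes F :: "'a::euclidean_space \<Rightarrow> 'b::euclidean_space"
  assumes "open W" "smooth_on W F" "smooth_on W X" "z \<in> W"
  shows "fderiv (\<lambda>y. fderiv F y (X y)) z u =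
    fderiv (\<lambda>y. fderiv F y u) z (X z)
      + fderiv F z (fderiv X z u)"
proof -
  let ?D = "\<lambda>y. fderiv F y"
  have d: "F differentiable at y" if "y \<in> W" for y
    by (rule smooth_on_differentiable[OF assms(2) that])
  have db: "(\<lambda>y. ?D y b) differentiable at z" for b
    by (rule smooth_on_differentiable[OF smooth_on_frechet_derivative[OF assms(2)] assms(4)])
  have dX: "X differentiable at z" by (rule smooth_on_differentiable[OF assms(3,4)])
  have eq: "fderiv (\<lambda>y. ?D y (X y)) z u =
      fderiv (\<lambda>y. \<Sum>b\<in>Basis. (X y \<bullet> b) *\<^sub>R ?D y b) z u"
    by (rule fun_cong[OF frechet_derivative_transform_open[OF assms(1,4)]])
      (rule frechet_derivative_euclidean[OF d])
  have dXb: "(\<lambda>y. X y \<bullet> b) differentiable at z" for b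
    using dX by (intro differentiable_inner differentiable_const)
  have "fderiv (\<lambda>y. (X y \<bullet> b) *\<^sub>R ?D y b) z u =
      (X z \<bullet> b) *\<^sub>R fderiv (\<lambda>y. ?D y b) z u + (fderiv X z u \<bullet> b) *\<^sub>R ?D z b" for b
    using fun_cong[OF frechet_derivative_at[OF has_derivative_scaleR[OF dXb[of b, unfolded frechet_derivative_works] db[of b, unfolded frechet_derivative_works]], symmetric], of u]
    by (simp add: frechet_derivative_inner_left[OF dX])
  moreover have "(\<lambda>y. (X y \<bullet> b) *\<^sub>R ?D y b) differentiable at z" for b
    using dXb db by (intro differentiable_scaleR)
  ultimately have "fderiv (\<lambda>y. ?D y (X y)) z u =
      (\<Sum>b\<in>Basis. (X z \<bullet> b) *\<^sub>R fderiv (\<lambda>y. ?D y b) z u)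
      + (\<Sum>b\<in>Basis. (fderiv X z u \<bullet> b) *\<^sub>R ?D z b)"
    unfolding eq by (subst frechet_derivative_sum) (simp_all add: sum.distrib)
  also have "(\<Sum>b\<in>Basis. (fderiv X z u \<bullet> b) *\<^sub>R ?D z b) = ?D z (fderiv X z u)"
    by (rule frechet_derivative_euclidean[OF d[OF assms(4)], symmetric])
  also have "(\<Sum>b\<in>Basis. (X z \<bullet> b) *\<^sub>R fderiv (\<lambda>y. ?D y b) z u)
      = (\<Sum>b\<in>Basis. (X z \<bullet> b) *\<^sub>R fderiv (\<lambda>y. ?D y u) z b)"
    by (simp add: frechet_derivative_commute[OF assms(1,2,4), of _ u])
  also have "\<dots> = fderiv (\<lambda>y. ?D y u) z (X z)"
    by (rule frechet_derivative_euclidean[OF db, symmetric])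
  finally show ?thesis .
qed

lemma frechet_derivative_Gam:
  fixes f :: "'n tcoord \<Rightarrow> real ^ 'n::finite"
  assumes "open W" "smooth_on W f" "smooth_on W F" "z \<in> W"
  shows "fderiv (Gam f F) z u =
    Gam f (\<lambda>y. fderiv F y u) z + fderiv F z (snd u, fderiv f z u)"
proof -
  have X: "smooth_on W (\<lambda>y. (snd y, f y))" by (intro smooth_on_Pair smooth_on_snd assms)
  have "((\<lambda>y. (snd y, f y)) has_derivative (\<lambda>u. (snd u, fderiv f z u))) (at z)"
    by (intro has_derivative_Pair has_derivative_snd has_derivative_ident smooth_on_has_derivative[OF assms(2,4)])
  from fun_cong[OF frechet_derivative_at[OF this, symmetric], of u]
  have DX: "fderiv (\<lambda>y. (snd y, f y)) z u = (snd u, fderiv f z u)" .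
  have "fderiv (Gam f F) z u = fderiv (\<lambda>y. fderiv F y (snd y, f y)) z u"
    by (rule fun_cong[OF frechet_derivative_transform_open[OF assms(1,4)]])
      (rule Gam_frechet_derivative[OF smooth_on_differentiable[OF assms(3)]])
  also have "\<dots> = fderiv (\<lambda>y. fderiv F y u) z (snd z, f z)
      + fderiv F z (snd u, fderiv f z u)"
    using frechet_derivative_apply_field[OF assms(1,3) X assms(4), of u] by (simp add: DX)
  finally show ?thesis
    using Gam_frechet_derivative[OF smooth_on_differentiable[OF smooth_on_frechet_derivative[OF assms(3)] assms(4)], of f u]
    by simp
qed

text \<open>The commutator of \<open>V\<^sub>j\<close> with \<Gamma> has position part
  \<open>\<partial>/\<partial>q\<^sup>j\<close> and velocity part \<open>V\<^sub>j f\<close>, which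
  is -2 times the connection coefficients by their definition.\<close>

lemma dv_Gam:
  fixes f :: "'n tcoord \<Rightarrow> real ^ 'n::finite"
  assumes "open W" "smooth_on W f" "smooth_on W F" "z \<in> W"
  shows "dv j (Gam f F) z = Gam f (dv j F) z + dq j F z - 2 * (\<Sum>k\<in>UNIV. conn f k j z * dv k F z)"
proof -
  have "fderiv F z (axis j 1, fderiv f z (0, axis j 1)) =
      (\<Sum>i\<in>UNIV. axis j 1 $ i * dq i F z + dv j (\<lambda>y. f y $ i) z * dv i F z)"
    by (subst linear_tcoord_expansion[OF linear_frechet_derivative_smooth[OF assms(3,4)]])
      (simp add: dq_def dv_def frechet_derivative_nth[OF smooth_on_differentiable[OF assms(2,4)]])
  also have "\<dots> = dq j F z - 2 * (\<Sum>k\<in>UNIV. conn f k j z * dv k F z)"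
    by (simp add: sum.distrib conn_def axis_def sum_distrib_left if_distrib[of "\<lambda>x. x * _"] sum_negf cong: if_cong)
  finally show ?thesis
    using frechet_derivative_Gam[OF assms, of "(0, axis j 1)"] by (simp add: dv_def[abs_def])
qed

lemma dq_Gam:
  fixes f :: "'n tcoord \<Rightarrow> real ^ 'n::finite"
  assumes "open W" "smooth_on W f" "smooth_on W F" "z \<in> W"
  shows "dq j (Gam f F) z = Gam f (dq j F) z + (\<Sum>k\<in>UNIV. dq j (\<lambda>y. f y $ k) z * dv k F z)"
proof -
  have "fderiv F z (0, fderiv f z (axis j 1, 0)) =
      (\<Sum>i\<in>UNIV. 0 * dq i F z + dq j (\<lambda>y. f y $ i) z * dv i F z)"
    by (subst linear_tcoord_expansion[OF linear_frechet_derivative_smooth[OF assms(3,4)]])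
      (simp add: dq_def dv_def frechet_derivative_nth[OF smooth_on_differentiable[OF assms(2,4)]])
  then show ?thesis
    using frechet_derivative_Gam[OF assms, of "(axis j 1, 0)"] by (simp add: dq_def[abs_def])
qed

definition hess :: "('n::finite tcoord \<Rightarrow> real) \<Rightarrow> 'n tcoord \<Rightarrow> real ^ 'n ^ 'n" where
  "hess L z = (\<chi> i j. dv i (dv j L) z)"

text \<open>The \<open>E\<^sub>i\<close> of the overview. It is the equation of motion with the time
  derivative of the momentum replaced by \<Gamma>, so no curve occurs and the identities are
  pointwise statements in tangent coordinates.\<close>

definition gyro_form ::
  "('n::finite tcoord \<Rightarrow> real ^ 'n) \<Rightarrow> ('n tcoord \<Rightarrow> real) \<Rightarrow> (real ^ 'n \<Rightarrow> real ^ 'n ^ 'n) \<Rightarrow> 'n \<Rightarrow> 'n tcoord \<Rightarrow> real" where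
  "gyro_form f L w i z = Gam f (dv i L) z - dq i L z - (\<Sum>k\<in>UNIV. w (fst z) $ k $ i * snd z $ k)"

text \<open>The components of \<open>d\<^sup>H(d\<^sup>V L)\<close>.\<close>

definition hor_curl :: "('n::finite tcoord \<Rightarrow> real ^ 'n) \<Rightarrow> ('n tcoord \<Rightarrow> real) \<Rightarrow> 'n \<Rightarrow> 'n \<Rightarrow> 'n tcoord \<Rightarrow> real" where
  "hor_curl f L j i z = Hor f j (dv i L) z - Hor f i (dv j L) z"

lemma smooth_on_hess:
  "open W \<Longrightarrow> smooth_on W L \<Longrightarrow> smooth_on W (hess L)"
  unfolding hess_def[abs_def] by (intro smooth_on_vec_lambda smooth_on_dv)

lemma dv_commute: "open W \<Longrightarrow> smooth_on W F \<Longrightarrow> z \<in> W \<Longrightarrow> dv i (dv j F) z = dv j (dv i F) z"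
  unfolding dv_def[abs_def] by (rule frechet_derivative_commute)

lemma dq_dv_commute: "open W \<Longrightarrow> smooth_on W F \<Longrightarrow> z \<in> W \<Longrightarrow> dq i (dv j F) z = dv j (dq i F) z"
  unfolding dv_def[abs_def] dq_def[abs_def] by (rule frechet_derivative_commute)

lemma dq_commute: "open W \<Longrightarrow> smooth_on W F \<Longrightarrow> z \<in> W \<Longrightarrow> dq i (dq j F) z = dq j (dq i F) z"
  unfolding dq_def[abs_def] by (rule frechet_derivative_commute)

lemma hess_symmetric: "open W \<Longrightarrow> smooth_on W L \<Longrightarrow> z \<in> W \<Longrightarrow> hess L z $ i $ j = hess L z $ j $ i"
  by (simp add: hess_def dv_commute)

lemma tensor_val_axis_right: "tensor_val M X (axis j 1) = (\<Sum>k\<in>UNIV. M $ k $ j * X $ k)"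
  by (simp add: tensor_val_def axis_def if_distrib[of "\<lambda>x. _ * x"] cong: if_cong)

lemma tensor_val_axis_left: "tensor_val M (axis i 1) Y = (\<Sum>k\<in>UNIV. M $ i $ k * Y $ k)"
proof -
  have "tensor_val M (axis i 1) Y = (\<Sum>a\<in>UNIV. if a = i then (\<Sum>k\<in>UNIV. M $ a $ k * Y $ k) else 0)"
    unfolding tensor_val_def by (rule sum.cong) (auto simp: axis_def)
  then show ?thesis by simp
qed

lemma nabla_component:
  "nabla f g z $ i $ j = Gam f (\<lambda>y. g y $ i $ j) z
    - (\<Sum>k\<in>UNIV. conn f k i z * g z $ k $ j) - (\<Sum>k\<in>UNIV. conn f k j z * g z $ i $ k)"
  by (simp add: nabla_def tensor_val_axis_left tensor_val_axis_right nabla_coord_def mult.commute)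

lemma smooth_on_gyro_linear_part:
  fixes w :: "real ^ 'n \<Rightarrow> real ^ 'n ^ 'n::finite"
  assumes "open S" "smooth_on S w"
  shows "smooth_on (S \<times> UNIV) (\<lambda>z. \<Sum>k\<in>UNIV. w (fst z) $ k $ i * snd z $ k)"
  by (intro smooth_on_sum smooth_on_mult smooth_on_nth smooth_on_pullback smooth_on_snd assms open_Times open_UNIV)

lemma smooth_on_gyro_form:
  assumes "open S" "smooth_on S w" "smooth_on (S \<times> UNIV) f" "smooth_on (S \<times> UNIV) L"
  shows "smooth_on (S \<times> UNIV) (gyro_form f L w i)"
  unfolding gyro_form_def[abs_def]
  by (intro smooth_on_diff smooth_on_Gam smooth_on_dv smooth_on_dq smooth_on_gyro_linear_part assms open_Times open_UNIV)

lemma frechet_derivative_gyro_linear_part: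
  fixes w :: "real ^ 'n \<Rightarrow> real ^ 'n ^ 'n::finite"
  assumes "open S" "smooth_on S w" "fst z \<in> S"
  shows "fderiv (\<lambda>z. \<Sum>k\<in>UNIV. w (fst z) $ k $ i * snd z $ k) z u =
    (\<Sum>k\<in>UNIV. w (fst z) $ k $ i * snd u $ k + fderiv w (fst z) (fst u) $ k $ i * snd z $ k)"
proof -
  have 1: "((\<lambda>z. w (fst z)) has_derivative (\<lambda>u. fderiv w (fst z) (fst u))) (at z)"
    by (rule has_derivative_compose[OF has_derivative_fst[OF has_derivative_ident] smooth_on_has_derivative[OF assms(2,3)]])
  have "((\<lambda>z. \<Sum>k\<in>UNIV. w (fst z) $ k $ i * snd z $ k) has_derivative
    (\<lambda>u. \<Sum>k\<in>UNIV. w (fst z) $ k $ i * snd u $ k + fderiv w (fst z) (fst u) $ k $ i * snd z $ k)) (at z)"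
    by (intro has_derivative_sum has_derivative_mult bounded_linear.has_derivative[OF bounded_linear_vec_nth] 1
        has_derivative_snd has_derivative_ident)
  from fun_cong[OF frechet_derivative_at[OF this, symmetric]] show ?thesis .
qed

text \<open>The commutator contributes the connection term in \<open>j\<close> twice. One copy
  completes the horizontal derivative \<open>H\<^sub>j\<close>, the other belongs to
  \<open>nabla\<close>; the connection term in \<open>i\<close>, which both \<open>nabla\<close> and
  \<open>H\<^sub>i\<close> require, is added and subtracted.\<close>

lemma dv_gyro_form:
  fixes f :: "'n tcoord \<Rightarrow> real ^ 'n::finite"
  assumes S: "open S" "smooth_on S w" "smooth_on (S \<times> UNIV) f" "smooth_on (S \<times> UNIV) L" and z: "z \<in> S \<times> UNIV"
  shows "dv j (gyro_form f L w i) z = nabla f (hess L) z $ i $ j + hor_curl f L j i z - w (fst z) $ j $ i"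
proof -
  let ?W = "S \<times> (UNIV :: (real ^ 'n) set)"
  have W: "open ?W" by (intro open_Times S open_UNIV)
  have zS: "fst z \<in> S" using z by auto
  have d: "F differentiable at z" if "smooth_on ?W F" for F :: "'n tcoord \<Rightarrow> real"
    by (rule smooth_on_differentiable[OF that z])
  have "dv j (gyro_form f L w i) z = dv j (Gam f (dv i L)) z - dv j (dq i L) z - w (fst z) $ j $ i"
    unfolding gyro_form_def[abs_def] dv_def[of j]
    apply (subst frechet_derivative_diff)
      apply (intro d smooth_on_diff smooth_on_Gam smooth_on_dv smooth_on_dq W S)
     apply (intro d smooth_on_gyro_linear_part S)
    apply (subst frechet_derivative_diff)
      apply (intro d smooth_on_Gam smooth_on_dv W S)
     apply (intro d smooth_on_dq W S)
    apply (simp add: frechet_derivative_gyro_linear_part[OF S(1,2) zS])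
    apply (simp add: linear_0[OF linear_frechet_derivative_smooth[OF S(2) zS]] axis_def if_distrib[of "\<lambda>x. _ * x"] cong: if_cong)
    done
  also have "dv j (Gam f (dv i L)) z = Gam f (dv j (dv i L)) z + dq j (dv i L) z - 2 * (\<Sum>k\<in>UNIV. conn f k j z * dv k (dv i L) z)"
    by (rule dv_Gam[OF W S(3) smooth_on_dv[OF S(4)] z])
  also have "dv j (dq i L) z = dq i (dv j L) z" by (rule dq_dv_commute[OF W S(4) z, symmetric])
  also have "Gam f (dv j (dv i L)) z = Gam f (\<lambda>y. hess L y $ i $ j) z"
  proof -
    have "fderiv (dv j (dv i L)) z = fderiv (\<lambda>y. hess L y $ i $ j) z"
      by (rule frechet_derivative_transform_open[OF W z]) (simp add: hess_def dv_commute[OF W S(4)])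
    then show ?thesis by (simp add: Gam_def dq_def[of _ "dv j (dv i L)"] dv_def[of _ "dv j (dv i L)"] dq_def[of _ "\<lambda>y. hess L y $ i $ j"] dv_def[of _ "\<lambda>y. hess L y $ i $ j"])
  qed
  finally show ?thesis
    using hess_symmetric[OF W S(4) z]
    by (simp add: nabla_component hor_curl_def Hor_def hess_def)
qed

section \<open>Necessity of the conditions in one chart\<close>

lemma Gam_transform_open:
  "open W \<Longrightarrow> z \<in> W \<Longrightarrow> (\<And>y. y \<in> W \<Longrightarrow> F y = G y) \<Longrightarrow> Gam f F z = Gam f G z"
  unfolding Gam_def dq_def dv_def by (simp add: frechet_derivative_transform_open[of W z F G])

lemma dq_transform_open:
  "open W \<Longrightarrow> z \<in> W \<Longrightarrow> (\<And>y. y \<in> W \<Longrightarrow> F y = G y) \<Longrightarrow> dq i F z = dq i G z"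
  unfolding dq_def by (simp add: frechet_derivative_transform_open[of W z F G])

lemma dv_transform_open:
  "open W \<Longrightarrow> z \<in> W \<Longrightarrow> (\<And>y. y \<in> W \<Longrightarrow> F y = G y) \<Longrightarrow> dv i F z = dv i G z"
  unfolding dv_def by (simp add: frechet_derivative_transform_open[of W z F G])

lemma Gam_diff:
  assumes "F differentiable at z" "G differentiable at z"
  shows "Gam f (\<lambda>y. F y - G y) z = Gam f F z - Gam f G z"
  using assms by (simp add: Gam_frechet_derivative frechet_derivative_diff)

lemma Gam_add:
  assumes "F differentiable at z" "G differentiable at z"
  shows "Gam f (\<lambda>y. F y + G y) z = Gam f F z + Gam f G z"
  using assms by (simp add: Gam_frechet_derivative frechet_derivative_add)

lemma Gam_mult:
  assumes "F differentiable at z" "G differentiable at z"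
  shows "Gam f (\<lambda>y. F y * G y) z = F z * Gam f G z + Gam f F z * G z"
  using assms by (simp add: Gam_frechet_derivative frechet_derivative_mult)

lemma Gam_sum:
  assumes "finite I" "\<And>i. i \<in> I \<Longrightarrow> F i differentiable at z"
  shows "Gam f (\<lambda>y. \<Sum>i\<in>I. F i y) z = (\<Sum>i\<in>I. Gam f (F i) z)"
  using assms by (simp add: Gam_frechet_derivative frechet_derivative_sum)

lemma dq_gyro_form:
  fixes f :: "'n tcoord \<Rightarrow> real ^ 'n::finite"
  assumes S: "open S" "smooth_on S w" "smooth_on (S \<times> UNIV) f" "smooth_on (S \<times> UNIV) L" and z: "z \<in> S \<times> UNIV"
  shows "dq j (gyro_form f L w i) z = Gam f (dq j (dv i L)) z
    + (\<Sum>k\<in>UNIV. dq j (\<lambda>y. f y $ k) z * hess L z $ k $ i) - dq j (dq i L) z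
    - (\<Sum>k\<in>UNIV. fderiv w (fst z) (axis j 1) $ k $ i * snd z $ k)"
proof -
  let ?W = "S \<times> (UNIV :: (real ^ 'n) set)"
  have W: "open ?W" by (intro open_Times S open_UNIV)
  have zS: "fst z \<in> S" using z by auto
  have d: "F differentiable at z" if "smooth_on ?W F" for F :: "'n tcoord \<Rightarrow> real"
    by (rule smooth_on_differentiable[OF that z])
  have "dq j (gyro_form f L w i) z = dq j (Gam f (dv i L)) z - dq j (dq i L) z
    - (\<Sum>k\<in>UNIV. fderiv w (fst z) (axis j 1) $ k $ i * snd z $ k)"
    unfolding gyro_form_def[abs_def] dq_def[of j]
    apply (subst frechet_derivative_diff)
      apply (intro d smooth_on_diff smooth_on_Gam smooth_on_dv smooth_on_dq W S)
     apply (intro d smooth_on_gyro_linear_part S)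
    apply (subst frechet_derivative_diff)
      apply (intro d smooth_on_Gam smooth_on_dv W S)
     apply (intro d smooth_on_dq W S)
    apply (simp add: frechet_derivative_gyro_linear_part[OF S(1,2) zS])
    done
  also have "dq j (Gam f (dv i L)) z = Gam f (dq j (dv i L)) z + (\<Sum>k\<in>UNIV. dq j (\<lambda>y. f y $ k) z * dv k (dv i L) z)"
    by (rule dq_Gam[OF W S(3) smooth_on_dv[OF S(4)] z])
  finally show ?thesis by (simp add: hess_def)
qed

lemma Gam_hor_curl:
  fixes f :: "'n tcoord \<Rightarrow> real ^ 'n::finite"
  assumes W: "open W" "smooth_on W f" "smooth_on W L" and z: "z \<in> W"
  shows "Gam f (hor_curl f L j i) z = Gam f (dq j (dv i L)) z - Gam f (dq i (dv j L)) z
    - (\<Sum>k\<in>UNIV. conn f k j z * Gam f (\<lambda>y. hess L y $ k $ i) z + Gam f (conn f k j) z * hess L z $ k $ i)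
    + (\<Sum>k\<in>UNIV. conn f k i z * Gam f (\<lambda>y. hess L y $ k $ j) z + Gam f (conn f k i) z * hess L z $ k $ j)"
proof -
  have d: "F differentiable at z" if "smooth_on W F" for F :: "'n tcoord \<Rightarrow> real"
    by (rule smooth_on_differentiable[OF that z])
  have hg: "smooth_on W (\<lambda>y. hess L y $ k $ l)" for k l
    by (intro smooth_on_nth smooth_on_hess W)
  have prod: "Gam f (\<lambda>y. \<Sum>k\<in>UNIV. conn f k j y * hess L y $ k $ i) z =
      (\<Sum>k\<in>UNIV. conn f k j z * Gam f (\<lambda>y. hess L y $ k $ i) z + Gam f (conn f k j) z * hess L z $ k $ i)" for i j
  proof -
    have "Gam f (\<lambda>y. \<Sum>k\<in>UNIV. conn f k j y * hess L y $ k $ i) z = (\<Sum>k\<in>UNIV. Gam f (\<lambda>y. conn f k j y * hess L y $ k $ i) z)"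
      by (rule Gam_sum) (auto intro!: d smooth_on_mult smooth_on_conn W hg)
    also have "\<dots> = (\<Sum>k\<in>UNIV. conn f k j z * Gam f (\<lambda>y. hess L y $ k $ i) z + Gam f (conn f k j) z * hess L z $ k $ i)"
      by (rule sum.cong[OF refl], rule Gam_mult) (intro d smooth_on_conn W hg)+
    finally show ?thesis .
  qed
  have sp: "smooth_on W (\<lambda>y. \<Sum>k\<in>UNIV. conn f k j y * hess L y $ k $ i)" for i j
    by (intro smooth_on_sum smooth_on_mult smooth_on_conn W hg)
  have sd: "smooth_on W (dq j (dv i L))" for i j by (intro smooth_on_dq smooth_on_dv W)
  have "hor_curl f L j i = (\<lambda>y. (dq j (dv i L) y - (\<Sum>k\<in>UNIV. conn f k j y * hess L y $ k $ i))
      - (dq i (dv j L) y - (\<Sum>k\<in>UNIV. conn f k i y * hess L y $ k $ j)))"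
    by (simp add: fun_eq_iff hor_curl_def Hor_def hess_def)
  then have "Gam f (hor_curl f L j i) z =
      (Gam f (dq j (dv i L)) z - Gam f (\<lambda>y. \<Sum>k\<in>UNIV. conn f k j y * hess L y $ k $ i) z)
      - (Gam f (dq i (dv j L)) z - Gam f (\<lambda>y. \<Sum>k\<in>UNIV. conn f k i y * hess L y $ k $ j) z)"
    by (simp add: Gam_diff d smooth_on_diff sp sd W)
  then show ?thesis by (simp add: prod)
qed

text \<open>The pure algebra behind the second identity, with \<open>G\<close> for the connection,
  \<open>GG\<close> for its derivative along \<Gamma>, \<open>F\<close> for the position derivatives
  of \<open>f\<close> and \<open>J\<close> for \<Phi>. Replacing \<open>Gh\<close>, the
  \<Gamma>-derivative of \<open>h\<close>, by connection terms creates two quadratic expressions: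
  \<open>R\<close> is the quadratic term of \<Phi>, and \<open>Q\<close> is symmetric in the free
  indices, hence lost in the antisymmetric difference.\<close>

lemma jacobi_contraction_identity:
  fixes h :: "'n::finite \<Rightarrow> 'n \<Rightarrow> real"
  assumes h: "\<And>k l. h k l = h l k"
    and Gh: "\<And>k i. Gh k i = (\<Sum>l\<in>UNIV. G l k * h l i) + (\<Sum>l\<in>UNIV. G l i * h k l)"
    and J: "\<And>k i. J k i = - F i k - (\<Sum>l\<in>UNIV. G l i * G k l) - GG k i"
  shows "(\<Sum>k\<in>UNIV. F j k * h k i) - (\<Sum>k\<in>UNIV. F i k * h k j) =
    - (\<Sum>k\<in>UNIV. G k j * Gh k i + GG k j * h k i) + (\<Sum>k\<in>UNIV. G k i * Gh k j + GG k i * h k j)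
    + (\<Sum>k\<in>UNIV. J k i * h k j) - (\<Sum>k\<in>UNIV. J k j * h k i)"
proof -
  define Q where "Q j i = (\<Sum>k\<in>UNIV. \<Sum>l\<in>UNIV. G k j * G l i * h k l)" for j i
  define R where "R j i = (\<Sum>k\<in>UNIV. \<Sum>l\<in>UNIV. G l j * G k l * h k i)" for j i
  have JE: "(\<Sum>k\<in>UNIV. J k j * h k i) = - (\<Sum>k\<in>UNIV. F j k * h k i) - R j i - (\<Sum>k\<in>UNIV. GG k j * h k i)" for j i
    by (simp add: J R_def left_diff_distrib sum_subtractf sum_negf sum_distrib_right)
  have "(\<Sum>k\<in>UNIV. G k j * Gh k i) = R j i + Q j i" for j i
  proof -
    have "(\<Sum>k\<in>UNIV. G k j * Gh k i) = (\<Sum>k\<in>UNIV. \<Sum>l\<in>UNIV. G k j * G l k * h l i) + Q j i"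
      by (simp add: Gh Q_def distrib_left sum.distrib sum_distrib_left mult.assoc)
    also have "(\<Sum>k\<in>UNIV. \<Sum>l\<in>UNIV. G k j * G l k * h l i) = R j i"
      unfolding R_def by (rule sum.swap)
    finally show ?thesis .
  qed
  moreover have "Q j i = Q i j"
  proof -
    have "Q j i = (\<Sum>l\<in>UNIV. \<Sum>k\<in>UNIV. G k j * G l i * h k l)" unfolding Q_def by (rule sum.swap)
    also have "\<dots> = Q i j" unfolding Q_def by (simp add: h mult.commute mult.left_commute)
    finally show ?thesis .
  qed
  ultimately show ?thesis by (simp add: JE sum.distrib)
qed

text \<open>Second position derivatives of \<open>L\<close> cancel by symmetry. What separates the
  rest from the \<Gamma>-derivative of \<open>hor_curl\<close> are position derivatives of
  \<open>f\<close> and connection terms, and these assemble to \<Phi> once \<open>nabla\<close>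
  vanishes.\<close>

lemma dq_gyro_form_antisym:
  fixes f :: "'n tcoord \<Rightarrow> real ^ 'n::finite"
  assumes S: "open S" "smooth_on S w" "smooth_on (S \<times> UNIV) f" "smooth_on (S \<times> UNIV) L" and z: "z \<in> S \<times> UNIV"
    and nabla: "nabla f (hess L) z = 0"
  shows "dq j (gyro_form f L w i) z - dq i (gyro_form f L w j) z = Gam f (hor_curl f L j i) z
    + (\<Sum>k\<in>UNIV. jacobi f z $ k $ i * hess L z $ k $ j) - (\<Sum>k\<in>UNIV. jacobi f z $ k $ j * hess L z $ k $ i)
    - (\<Sum>k\<in>UNIV. (fderiv w (fst z) (axis j 1) $ k $ i
         - fderiv w (fst z) (axis i 1) $ k $ j) * snd z $ k)"
proof -
  let ?W = "S \<times> (UNIV :: (real ^ 'n) set)"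
  have W: "open ?W" by (intro open_Times S open_UNIV)
  have Gh: "Gam f (\<lambda>y. hess L y $ k $ i) z =
      (\<Sum>l\<in>UNIV. conn f l k z * hess L z $ l $ i) + (\<Sum>l\<in>UNIV. conn f l i z * hess L z $ k $ l)" for k i
    using nabla_component[of f "hess L" z k i] by (simp add: nabla)
  have "(\<Sum>k\<in>UNIV. dq j (\<lambda>y. f y $ k) z * hess L z $ k $ i) - (\<Sum>k\<in>UNIV. dq i (\<lambda>y. f y $ k) z * hess L z $ k $ j) =
    - (\<Sum>k\<in>UNIV. conn f k j z * Gam f (\<lambda>y. hess L y $ k $ i) z + Gam f (conn f k j) z * hess L z $ k $ i)
    + (\<Sum>k\<in>UNIV. conn f k i z * Gam f (\<lambda>y. hess L y $ k $ j) z + Gam f (conn f k i) z * hess L z $ k $ j)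
    + (\<Sum>k\<in>UNIV. jacobi f z $ k $ i * hess L z $ k $ j) - (\<Sum>k\<in>UNIV. jacobi f z $ k $ j * hess L z $ k $ i)"
    by (rule jacobi_contraction_identity[where G = "\<lambda>k i. conn f k i z"])
      (use hess_symmetric[OF W S(4) z] in \<open>simp_all add: Gh jacobi_def\<close>)
  then show ?thesis
    using dq_commute[OF W S(4) z, of i j]
    by (simp add: dq_gyro_form[OF S z] Gam_hor_curl[OF W S(3,4) z] left_diff_distrib sum_subtractf)
qed

section \<open>The condition on the Jacobi endomorphism in components\<close>

lemma sum_rotate3:
  "(\<Sum>k\<in>A. \<Sum>i\<in>B. \<Sum>j\<in>C. F k i j) = (\<Sum>i\<in>B. \<Sum>j\<in>C. \<Sum>k\<in>A. F k i j :: real)"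
  by (subst sum.swap) (rule sum.cong[OF refl sum.swap])

text \<open>On functions of position alone the horizontal derivatives are the partial derivatives.
  Of the six terms of each determinant, those differing by a swap of the last two arguments agree up
  to sign by skewness; this absorbs the factor 1/2 and leaves the cyclic sum of the ordinary
  exterior derivative.\<close>

lemma dH_pullback:
  fixes w :: "real ^ 'n \<Rightarrow> real ^ 'n ^ 'n::finite"
  assumes S: "open S" "smooth_on S w" "fst z \<in> S" and skew: "\<And>x i j. x \<in> S \<Longrightarrow> w x $ i $ j = - w x $ j $ i"
  shows "dH f (pullback w) z V X Y = (\<Sum>k\<in>UNIV. \<Sum>i\<in>UNIV. \<Sum>j\<in>UNIV. V $ k * X $ i * Y $ j *
    (fderiv w (fst z) (axis k 1) $ i $ j + fderiv w (fst z) (axis i 1) $ j $ k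
      + fderiv w (fst z) (axis j 1) $ k $ i))"
proof -
  define c where "c k i j = fderiv w (fst z) (axis k 1) $ i $ j" for k i j
  have dw: "w differentiable at (fst z)" by (rule smooth_on_differentiable[OF S(2,3)])
  have D: "fderiv (\<lambda>y. w (fst y) $ i $ j) z u = fderiv w (fst z) (fst u) $ i $ j" for i j u
  proof -
    have "((\<lambda>y. w (fst y) $ i $ j) has_derivative (\<lambda>u. fderiv w (fst z) (fst u) $ i $ j)) (at z)"
      by (intro bounded_linear.has_derivative[OF bounded_linear_vec_nth]
        has_derivative_compose[OF has_derivative_fst[OF has_derivative_ident] smooth_on_has_derivative[OF S(2,3)]])
    from fun_cong[OF frechet_derivative_at[OF this, symmetric]] show ?thesis .
  qed
  have H: "Hor f k (\<lambda>y. pullback w y $ i $ j) z = c k i j" for k i j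
    using linear_0[OF linear_frechet_derivative[OF dw]]
    by (simp add: Hor_def dq_def dv_def pullback_def D c_def)
  define T where "T A B C = (\<Sum>k\<in>UNIV. \<Sum>i\<in>UNIV. \<Sum>j\<in>UNIV. c k i j * (A $ k * B $ i * C $ j))" for A B C :: "real ^ 'n"
  have Tskew: "T A C B = - T A B C" for A B C
  proof -
    have "T A C B = (\<Sum>k\<in>UNIV. \<Sum>j\<in>UNIV. \<Sum>i\<in>UNIV. c k i j * (A $ k * C $ i * B $ j))"
      unfolding T_def by (rule sum.cong[OF refl], rule sum.swap)
    also have "\<dots> = (\<Sum>k\<in>UNIV. \<Sum>i\<in>UNIV. \<Sum>j\<in>UNIV. - (c k i j * (A $ k * B $ i * C $ j)))"
    proof (intro sum.cong refl)
      fix k p q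
      have "c k q p = - c k p q" unfolding c_def by (rule frechet_derivative_skew[OF S skew])
      then show "c k q p * (A $ k * C $ q * B $ p) = - (c k p q * (A $ k * B $ p * C $ q))" by simp
    qed
    finally show ?thesis by (simp add: T_def sum_negf)
  qed
  have "dH f (pullback w) z V X Y = (1/2) * (T V X Y + T Y V X + T X Y V - T V Y X - T X V Y - T Y X V)"
    unfolding dH_def H T_def sum.distrib[symmetric] sum_subtractf[symmetric]
    by (intro arg_cong2[where f = "(*)"] refl sum.cong) (simp add: wedge3_def det_3 algebra_simps)
  also have "\<dots> = T V X Y + T Y V X + T X Y V"
    using Tskew[of V X Y] Tskew[of X Y V] Tskew[of Y V X] by simp
  also have "T Y V X = (\<Sum>i\<in>UNIV. \<Sum>j\<in>UNIV. \<Sum>k\<in>UNIV. c k i j * (Y $ k * V $ i * X $ j))"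
    unfolding T_def by (rule sum_rotate3)
  also have "T X Y V = (\<Sum>j\<in>UNIV. \<Sum>k\<in>UNIV. \<Sum>i\<in>UNIV. c k i j * (X $ k * Y $ i * V $ j))"
    unfolding T_def by (subst sum_rotate3) (rule sum_rotate3)
  finally show ?thesis
    unfolding T_def sum.distrib[symmetric] c_def[symmetric]
    by (simp add: algebra_simps)
qed

lemma tensor_val_mult_left:
  "tensor_val g (J *v X) Y = (\<Sum>i\<in>UNIV. \<Sum>j\<in>UNIV. X $ i * Y $ j * (\<Sum>k\<in>UNIV. J $ k $ i * g $ k $ j))"
proof -
  have "tensor_val g (J *v X) Y = (\<Sum>k\<in>UNIV. \<Sum>j\<in>UNIV. \<Sum>i\<in>UNIV. X $ i * Y $ j * (J $ k $ i * g $ k $ j))"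
    by (simp add: tensor_val_def matrix_vector_mult_def sum_distrib_left sum_distrib_right mult_ac)
  also have "\<dots> = (\<Sum>j\<in>UNIV. \<Sum>i\<in>UNIV. \<Sum>k\<in>UNIV. X $ i * Y $ j * (J $ k $ i * g $ k $ j))"
    by (rule sum_rotate3)
  also have "\<dots> = (\<Sum>i\<in>UNIV. \<Sum>j\<in>UNIV. \<Sum>k\<in>UNIV. X $ i * Y $ j * (J $ k $ i * g $ k $ j))"
    by (rule sum.swap)
  finally show ?thesis by (simp add: sum_distrib_left)
qed

lemma tensor_val_mult_right:
  "tensor_val g X (J *v Y) = (\<Sum>i\<in>UNIV. \<Sum>j\<in>UNIV. X $ i * Y $ j * (\<Sum>k\<in>UNIV. g $ i $ k * J $ k $ j))"
proof -
  have "tensor_val g X (J *v Y) = (\<Sum>i\<in>UNIV. \<Sum>k\<in>UNIV. \<Sum>j\<in>UNIV. X $ i * Y $ j * (g $ i $ k * J $ k $ j))"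
    by (simp add: tensor_val_def matrix_vector_mult_def sum_distrib_left sum_distrib_right mult_ac)
  also have "\<dots> = (\<Sum>i\<in>UNIV. \<Sum>j\<in>UNIV. \<Sum>k\<in>UNIV. X $ i * Y $ j * (g $ i $ k * J $ k $ j))"
    by (rule sum.cong[OF refl], rule sum.swap)
  finally show ?thesis by (simp add: sum_distrib_left)
qed

lemma bilinear_form_eq_iff:
  "(\<forall>X Y. (\<Sum>i\<in>UNIV. \<Sum>j\<in>UNIV. X $ i * Y $ j * a i j) = (\<Sum>i\<in>UNIV. \<Sum>j\<in>UNIV. X $ i * Y $ j * b i j))
    \<longleftrightarrow> (\<forall>(i::'n::finite) (j::'m::finite). a i j = (b i j :: real))"
proof -
  have "(\<Sum>i\<in>UNIV. \<Sum>j\<in>UNIV. axis p 1 $ i * axis q 1 $ j * c i j) = c p q"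
    for c :: "'n \<Rightarrow> 'm \<Rightarrow> real" and p q
  proof -
    have "(\<Sum>j\<in>UNIV. axis p 1 $ i * axis q 1 $ j * c i j) = (if i = p then c i q else 0)" for i
      by (simp add: axis_def if_distrib[of "\<lambda>x. x * _"] if_distrib[of "\<lambda>x. _ * x"] cong: if_cong)
    then show ?thesis by simp
  qed
  note ev = this
  show ?thesis
  proof (intro iffI allI)
    fix p q
    assume "\<forall>X Y. (\<Sum>i\<in>UNIV. \<Sum>j\<in>UNIV. X $ i * Y $ j * a i j) = (\<Sum>i\<in>UNIV. \<Sum>j\<in>UNIV. X $ i * Y $ j * b i j)"
    from this[rule_format, of "axis p 1" "axis q 1"] show "a p q = b p q" by (simp only: ev)
  qed simp
qed

lemma jacobi_condition_components:
  fixes w :: "real ^ 'n \<Rightarrow> real ^ 'n ^ 'n::finite"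
  assumes S: "open S" "smooth_on S w" "fst z \<in> S" and skew: "\<And>x i j. x \<in> S \<Longrightarrow> w x $ i $ j = - w x $ j $ i"
  shows "(\<forall>X Y. tensor_val g (J *v X) Y - tensor_val g X (J *v Y) = dH f (pullback w) z (snd z) X Y) \<longleftrightarrow>
    (\<forall>i j. (\<Sum>k\<in>UNIV. J $ k $ i * g $ k $ j) - (\<Sum>k\<in>UNIV. g $ i $ k * J $ k $ j) =
      (\<Sum>k\<in>UNIV. snd z $ k * (fderiv w (fst z) (axis k 1) $ i $ j
        + fderiv w (fst z) (axis i 1) $ j $ k + fderiv w (fst z) (axis j 1) $ k $ i)))"
proof -
  have l: "tensor_val g (J *v X) Y - tensor_val g X (J *v Y) = (\<Sum>i\<in>UNIV. \<Sum>j\<in>UNIV. X $ i * Y $ j *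
      ((\<Sum>k\<in>UNIV. J $ k $ i * g $ k $ j) - (\<Sum>k\<in>UNIV. g $ i $ k * J $ k $ j)))" for X Y
    unfolding tensor_val_mult_left tensor_val_mult_right
    by (simp only: sum_subtractf right_diff_distrib)
  have r: "dH f (pullback w) z (snd z) X Y = (\<Sum>i\<in>UNIV. \<Sum>j\<in>UNIV. X $ i * Y $ j *
    (\<Sum>k\<in>UNIV. snd z $ k * (fderiv w (fst z) (axis k 1) $ i $ j
        + fderiv w (fst z) (axis i 1) $ j $ k + fderiv w (fst z) (axis j 1) $ k $ i)))" for X Y
    by (rule trans[OF dH_pullback[OF S skew]], assumption, rule trans[OF sum_rotate3])
      (simp only: sum_distrib_left mult_ac)
  show ?thesis unfolding l r by (rule bilinear_form_eq_iff)
qed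

lemma frechet_derivative_axis_sum:
  fixes m :: "real ^ 'n::finite \<Rightarrow> 'b::real_normed_vector"
  assumes "m differentiable at x"
  shows "fderiv m x u = (\<Sum>k\<in>UNIV. u $ k *\<^sub>R fderiv m x (axis k 1))"
proof -
  interpret linear "fderiv m x" by (rule linear_frechet_derivative[OF assms])
  have "fderiv m x u = fderiv m x (\<Sum>k\<in>UNIV. u $ k *\<^sub>R axis k 1)"
    using basis_expansion[of u] by (simp add: scalar_mult_eq_scaleR)
  then show ?thesis by (simp add: sum scaleR)
qed

lemma Gam_pullback:
  fixes w :: "real ^ 'n \<Rightarrow> real ^ 'n ^ 'n::finite"
  assumes "w differentiable at (fst z)"
  shows "Gam f (\<lambda>y. w (fst y) $ i $ j) z = (\<Sum>k\<in>UNIV. snd z $ k * fderiv w (fst z) (axis k 1) $ i $ j)"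
proof -
  have d: "((\<lambda>y. w (fst y) $ i $ j) has_derivative (\<lambda>u. fderiv w (fst z) (fst u) $ i $ j)) (at z)"
    by (intro bounded_linear.has_derivative[OF bounded_linear_vec_nth]
      has_derivative_compose[OF has_derivative_fst[OF has_derivative_ident] assms[unfolded frechet_derivative_works]])
  have "Gam f (\<lambda>y. w (fst y) $ i $ j) z = fderiv w (fst z) (snd z) $ i $ j"
    using Gam_frechet_derivative[OF differentiableI[OF d], of f] fun_cong[OF frechet_derivative_at[OF d], of "(snd z, f z)"] by simp
  then show ?thesis by (subst (asm) frechet_derivative_axis_sum[OF assms]) simp
qed

lemma gyroscopic_imp_conditions:
  fixes f :: "'n tcoord \<Rightarrow> real ^ 'n::finite"
  assumes S: "open S" "smooth_on S w" "smooth_on (S \<times> UNIV) f" "smooth_on (S \<times> UNIV) L"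
    and skew: "\<And>x i j. x \<in> S \<Longrightarrow> w x $ i $ j = - w x $ j $ i"
    and EL: "\<And>z i. z \<in> S \<times> UNIV \<Longrightarrow> gyro_form f L w i z = 0" and z: "z \<in> S \<times> UNIV"
  shows "nabla f (hess L) z = 0"
    and "tensor_val (hess L z) (jacobi f z *v X) Y - tensor_val (hess L z) X (jacobi f z *v Y) = dH f (pullback w) z (snd z) X Y"
proof -
  let ?W = "S \<times> (UNIV :: (real ^ 'n) set)"
  have W: "open ?W" by (intro open_Times S open_UNIV)
  have EL0: "fderiv (gyro_form f L w i) y = (\<lambda>_. 0)" if y: "y \<in> ?W" for y i
    using frechet_derivative_transform_open[OF W y, of "gyro_form f L w i" "\<lambda>_. 0"] EL by simp
  have *: "nabla f (hess L) y $ i $ j = 0 \<and> hor_curl f L j i y = w (fst y) $ j $ i" if y: "y \<in> ?W" for y i j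
  proof -
    have 0: "nabla f (hess L) y $ i $ j + hor_curl f L j i y = w (fst y) $ j $ i" for i j
      using dv_gyro_form[OF S y, of j i] EL0[OF y] by (simp add: dv_def)
    have "Gam f (\<lambda>y. hess L y $ i $ j) y = Gam f (\<lambda>y. hess L y $ j $ i) y"
      by (rule Gam_transform_open[OF W y]) (rule hess_symmetric[OF W S(4)])
    then have "nabla f (hess L) y $ i $ j = nabla f (hess L) y $ j $ i"
      by (simp add: nabla_component hess_symmetric[OF W S(4) y, of _ j] hess_symmetric[OF W S(4) y, of i])
    moreover have "hor_curl f L j i y = - hor_curl f L i j y" by (simp add: hor_curl_def)
    moreover have "w (fst y) $ j $ i = - w (fst y) $ i $ j" by (rule skew) (use y in auto)
    ultimately show ?thesis using 0[of i j] 0[of j i] by linarith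
  qed
  show nab: "nabla f (hess L) z = 0" using * z by (simp add: vec_eq_iff)
  have zS: "fst z \<in> S" using z by auto
  let ?D = "\<lambda>k. fderiv w (fst z) (axis k 1)"
  have "(\<Sum>k\<in>UNIV. jacobi f z $ k $ i * hess L z $ k $ j) - (\<Sum>k\<in>UNIV. hess L z $ i $ k * jacobi f z $ k $ j) =
      (\<Sum>k\<in>UNIV. snd z $ k * (?D k $ i $ j + ?D i $ j $ k + ?D j $ k $ i))" for i j
  proof -
    \<comment> \<open>\<open>hor_curl\<close> equals the components of \<open>w\<close> on the whole
      open set, not just at \<open>z\<close>, so \<Gamma> may be applied to both sides. Its result,
      combined with the \<open>w\<close>-terms of the second identity, is the cyclic sum.\<close>
    have "Gam f (hor_curl f L j i) z = Gam f (\<lambda>y. w (fst y) $ j $ i) z"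
      by (rule Gam_transform_open[OF W z]) (use * in blast)
    also have "\<dots> = (\<Sum>k\<in>UNIV. snd z $ k * ?D k $ j $ i)"
      by (rule Gam_pullback[OF smooth_on_differentiable[OF S(2) zS]])
    finally have "(\<Sum>k\<in>UNIV. jacobi f z $ k $ i * hess L z $ k $ j) - (\<Sum>k\<in>UNIV. jacobi f z $ k $ j * hess L z $ k $ i)
        = (\<Sum>k\<in>UNIV. (?D j $ k $ i - ?D i $ k $ j) * snd z $ k) - (\<Sum>k\<in>UNIV. snd z $ k * ?D k $ j $ i)"
      using dq_gyro_form_antisym[OF S z nab, of j i] EL0[OF z] by (simp add: dq_def)
    also have "\<dots> = (\<Sum>k\<in>UNIV. snd z $ k * (?D k $ i $ j + ?D i $ j $ k + ?D j $ k $ i))"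
      unfolding sum_subtractf[symmetric]
    proof (rule sum.cong[OF refl])
      fix k
      have "?D k $ j $ i = - ?D k $ i $ j" "?D i $ k $ j = - ?D i $ j $ k"
        by (rule frechet_derivative_skew[OF S(1,2) zS skew], assumption)+
      then show "(?D j $ k $ i - ?D i $ k $ j) * snd z $ k - snd z $ k * ?D k $ j $ i
        = snd z $ k * (?D k $ i $ j + ?D i $ j $ k + ?D j $ k $ i)"
        by (simp add: algebra_simps)
    qed
    finally show ?thesis
      by (simp add: hess_symmetric[OF W S(4) z, of _ i] mult.commute)
  qed
  then show "tensor_val (hess L z) (jacobi f z *v X) Y - tensor_val (hess L z) X (jacobi f z *v Y) = dH f (pullback w) z (snd z) X Y"
    using jacobi_condition_components[OF S(1,2) zS skew] by blast
qed

section \<open>Construction of the Lagrangian in one chart\<close>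

lemma open_tube: "open S \<Longrightarrow> open (S \<times> (UNIV :: 'b::topological_space set))"
  by (rule open_Times[OF _ open_UNIV])

text \<open>The component form of \<open>poincare_fibre\<close>; each fibre is the full vector
  space, so star-shapedness holds over any base \<open>S\<close>.\<close>

lemma fibre_potential:
  fixes F :: "'n tcoord \<Rightarrow> real ^ 'n::finite"
  assumes S: "open S" "smooth_on (S \<times> UNIV) F"
    and closed: "\<And>z j k. z \<in> S \<times> UNIV \<Longrightarrow> dv k (\<lambda>y. F y $ j) z = dv j (\<lambda>y. F y $ k) z"
  obtains P where "smooth_on (S \<times> UNIV) P" "\<And>z j. z \<in> S \<times> UNIV \<Longrightarrow> dv j P z = F z $ j"
proof -
  obtain P where P: "smooth_on (S \<times> UNIV) P"
    "\<And>z u. z \<in> S \<times> UNIV \<Longrightarrow> fderiv P z (0, u) = F z \<bullet> u"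
  proof (rule poincare_fibre[OF open_tube[OF S(1)] S(2)])
    fix z :: "'n tcoord" and u w :: "real ^ 'n"
    assume z: "z \<in> S \<times> UNIV"
    let ?D = "fderiv F z"
    have e: "?D (0, u) \<bullet> w = (\<Sum>j\<in>UNIV. \<Sum>k\<in>UNIV. u $ k * w $ j * dv k (\<lambda>y. F y $ j) z)" for u w
    proof -
      have "?D (0, u) $ j = (\<Sum>k\<in>UNIV. u $ k * dv k (\<lambda>y. F y $ j) z)" for j
      proof -
        have d: "(\<lambda>y. F y $ j) differentiable at z"
          by (rule smooth_on_differentiable[OF smooth_on_nth[OF open_tube[OF S(1)] S(2)] z])
        have "?D (0, u) $ j = fderiv (\<lambda>y. F y $ j) z (0, u)"
          by (rule frechet_derivative_nth[OF smooth_on_differentiable[OF S(2) z], symmetric])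
        also have "\<dots> = (\<Sum>k\<in>UNIV. u $ k * dv k (\<lambda>y. F y $ j) z)"
          by (subst linear_tcoord_expansion[OF linear_frechet_derivative[OF d]]) (simp add: dv_def)
        finally show ?thesis .
      qed
      then show ?thesis by (simp add: inner_vec_def sum_distrib_left sum_distrib_right mult_ac)
    qed
    show "?D (0, u) \<bullet> w = ?D (0, w) \<bullet> u"
      unfolding e by (subst sum.swap) (simp only: closed[OF z] mult_ac)
  qed auto
  show thesis
  proof (rule that[OF P(1)])
    show "dv j P z = F z $ j" if "z \<in> S \<times> UNIV" for z j
      using P(2)[OF that, of "axis j 1"] by (simp add: dv_def inner_axis)
  qed
qed

lemma fibre_constant:
  fixes F :: "'n::finite tcoord \<Rightarrow> real"
  assumes S: "open S" "smooth_on (S \<times> UNIV) F"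
    and zero: "\<And>z k. z \<in> S \<times> UNIV \<Longrightarrow> dv k F z = 0" and x: "x \<in> S"
  shows "F (x, v) = F (x, u)"
proof (rule has_derivative_zero_unique[where s = UNIV and f = "\<lambda>v. F (x, v)"])
  fix v :: "real ^ 'n"
  have z: "(x, v) \<in> S \<times> UNIV" using x by simp
  have 1: "((\<lambda>v. (x, v)) has_derivative (\<lambda>u. (0, u))) (at v)" by (auto intro!: derivative_eq_intros)
  have "((\<lambda>v. F (x, v)) has_derivative (\<lambda>u. fderiv F (x, v) (0, u))) (at v)"
    by (rule has_derivative_compose[OF 1 smooth_on_has_derivative[OF S(2) z]])
  moreover have "fderiv F (x, v) (0, u) = 0" for u
    using zero[OF z] linear_tcoord_expansion[OF linear_frechet_derivative_smooth[OF S(2) z], of 0 u]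
    by (simp add: dv_def)
  ultimately show "((\<lambda>v. F (x, v)) has_derivative (\<lambda>h. 0)) (at v within UNIV)" by simp
qed auto

lemma frechet_derivative_linear_fibre:
  fixes a :: "'a::euclidean_space \<Rightarrow> real ^ 'n::finite"
  assumes "a differentiable at (fst z)"
  shows "fderiv (\<lambda>z. \<Sum>k\<in>UNIV. a (fst z) $ k * snd z $ k) z u =
    (\<Sum>k\<in>UNIV. a (fst z) $ k * snd u $ k + fderiv a (fst z) (fst u) $ k * snd z $ k)"
proof -
  have 1: "((\<lambda>z. a (fst z)) has_derivative (\<lambda>u. fderiv a (fst z) (fst u))) (at z)"
    by (rule has_derivative_compose[OF has_derivative_fst[OF has_derivative_ident] assms[unfolded frechet_derivative_works]])
  have "((\<lambda>z. \<Sum>k\<in>UNIV. a (fst z) $ k * snd z $ k) has_derivative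
    (\<lambda>u. \<Sum>k\<in>UNIV. a (fst z) $ k * snd u $ k + fderiv a (fst z) (fst u) $ k * snd z $ k)) (at z)"
    by (intro has_derivative_sum has_derivative_mult bounded_linear.has_derivative[OF bounded_linear_vec_nth] 1
        has_derivative_snd has_derivative_ident)
  from fun_cong[OF frechet_derivative_at[OF this, symmetric]] show ?thesis .
qed

lemma sum_axis_right: "(\<Sum>k\<in>UNIV. c k * axis i (1::real) $ k) = c (i::'n::finite)"
  by (simp add: axis_def if_distrib[of "\<lambda>x. _ * x"] cong: if_cong)

text \<open>Differentiating the momentum \<open>a\<^sub>i\<close> along \<Gamma> and subtracting the
  position derivative of \<open>a\<^sub>k v\<^sup>k\<close> leaves the exterior derivative of
  \<open>a\<close> contracted with the velocity. The terms are affine in \<open>v\<close>, hence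
  invisible to the Hessian.\<close>

lemma gyro_form_add_affine:
  fixes f :: "'n tcoord \<Rightarrow> real ^ 'n::finite"
  assumes S: "open S" "smooth_on (S \<times> UNIV) f" "smooth_on (S \<times> UNIV) L"
    and a: "smooth_on S a" and b: "smooth_on S b" and z: "z \<in> S \<times> UNIV"
  defines "L' \<equiv> \<lambda>z. L z + (\<Sum>k\<in>UNIV. a (fst z) $ k * snd z $ k) + b (fst z)"
  shows "gyro_form f L' w i z = gyro_form f L w i z
      + (\<Sum>k\<in>UNIV. snd z $ k * (fderiv a (fst z) (axis k 1) $ i - fderiv a (fst z) (axis i 1) $ k))
      - fderiv b (fst z) (axis i 1)"
    and "hess L' z = hess L z"
proof -
  let ?W = "S \<times> (UNIV :: (real ^ 'n) set)"
  note W = open_tube[OF S(1)]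
  let ?A = "\<lambda>z. \<Sum>k\<in>UNIV. a (fst z) $ k * snd z $ k"
  have sA: "smooth_on ?W ?A"
    by (intro smooth_on_sum smooth_on_mult smooth_on_nth smooth_on_pullback smooth_on_snd a S(1) W)
  have sB: "smooth_on ?W (\<lambda>z. b (fst z))" by (rule smooth_on_pullback[OF S(1) b])
  have da: "a differentiable at (fst y)" "b differentiable at (fst y)" if "y \<in> ?W" for y
    using smooth_on_differentiable[OF a] smooth_on_differentiable[OF b] that by auto
  have D: "fderiv L' y u = fderiv L y u
      + (\<Sum>k\<in>UNIV. a (fst y) $ k * snd u $ k + fderiv a (fst y) (fst u) $ k * snd y $ k)
      + fderiv b (fst y) (fst u)" if y: "y \<in> ?W" for y u
    unfolding L'_def
    using smooth_on_differentiable[OF S(3) y] smooth_on_differentiable[OF sA y] smooth_on_differentiable[OF sB y]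
    by (simp add: frechet_derivative_add differentiable_add frechet_derivative_linear_fibre[OF da(1)[OF y]]
        frechet_derivative_fst[OF da(2)[OF y]])
  have dv: "dv j L' y = dv j L y + a (fst y) $ j" if y: "y \<in> ?W" for y j
    using linear_0[OF linear_frechet_derivative[OF da(1)[OF y]]] linear_0[OF linear_frechet_derivative[OF da(2)[OF y]]]
    by (simp add: dv_def D[OF y] sum_axis_right)
  have dq: "dq j L' y = dq j L y + (\<Sum>k\<in>UNIV. fderiv a (fst y) (axis j 1) $ k * snd y $ k)
      + fderiv b (fst y) (axis j 1)" if y: "y \<in> ?W" for y j
    by (simp add: dq_def D[OF y])
  have dL: "dv i L differentiable at z" for i
    by (rule smooth_on_differentiable[OF smooth_on_dv[OF S(3)] z])
  have dap: "(\<lambda>y. a (fst y) $ j) differentiable at z" for j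
    by (rule smooth_on_differentiable[OF smooth_on_pullback[OF S(1) smooth_on_nth[OF S(1) a]] z])
  have aj: "(\<lambda>x. a x $ j) differentiable at (fst z)" for j
    using z smooth_on_differentiable[OF smooth_on_nth[OF S(1) a]] by auto
  have Dap: "fderiv (\<lambda>y. a (fst y) $ j) z u = fderiv a (fst z) (fst u) $ j" for j and u :: "'n tcoord"
    using frechet_derivative_fst[OF aj, where u = u] frechet_derivative_nth[OF da(1)[OF z]] by simp
  have "Gam f (dv i L') z = Gam f (\<lambda>y. dv i L y + a (fst y) $ i) z"
    by (rule Gam_transform_open[OF W z dv])
  also have "\<dots> = Gam f (dv i L) z + fderiv a (fst z) (snd z) $ i"
    by (simp add: Gam_add[OF dL dap] Gam_frechet_derivative[OF dap] Dap)
  also have "fderiv a (fst z) (snd z) $ i = (\<Sum>k\<in>UNIV. snd z $ k * fderiv a (fst z) (axis k 1) $ i)"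
    by (subst frechet_derivative_axis_sum[OF da(1)[OF z]]) simp
  finally show "gyro_form f L' w i z = gyro_form f L w i z
      + (\<Sum>k\<in>UNIV. snd z $ k * (fderiv a (fst z) (axis k 1) $ i - fderiv a (fst z) (axis i 1) $ k))
      - fderiv b (fst z) (axis i 1)"
    by (simp add: gyro_form_def dq[OF z] right_diff_distrib sum_subtractf mult.commute)
  have "dv i (dv j L') z = dv i (dv j L) z" for i j
  proof -
    have "dv i (dv j L') z = dv i (\<lambda>y. dv j L y + a (fst y) $ j) z"
      by (rule dv_transform_open[OF W z dv])
    also have "\<dots> = dv i (dv j L) z"
      using linear_0[OF linear_frechet_derivative[OF da(1)[OF z]]]
      by (simp add: dv_def[of i] frechet_derivative_add[OF dL dap] Dap)
    finally show ?thesis .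
  qed
  then show "hess L' z = hess L z" by (simp add: hess_def)
qed

text \<open>Alternating the two symmetries six times leads back to the same index order with three
  sign changes, as in the uniqueness proof of the Levi-Civita connection.\<close>

lemma symmetric_skew_zero:
  fixes T :: "'n \<Rightarrow> 'n \<Rightarrow> 'n \<Rightarrow> real"
  assumes "\<And>i j k. T i j k = T j i k" "\<And>i j k. T i j k = - T i k j"
  shows "T i j k = 0"
  using assms(1)[of i j k] assms(2)[of j i k] assms(1)[of j k i] assms(2)[of k j i] assms(1)[of k i j] assms(2)[of i k j]
  by linarith

lemma exists_gyroscopic_lagrangian:
  fixes f :: "'n tcoord \<Rightarrow> real ^ 'n::finite"
  assumes S: "open S" "smooth_on S w" "smooth_on (S \<times> UNIV) f" and g: "smooth_on (S \<times> UNIV) g"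
    and star: "\<And>x s. x \<in> S \<Longrightarrow> 0 \<le> s \<Longrightarrow> s \<le> 1 \<Longrightarrow> c + s *\<^sub>R (x - c) \<in> S"
    and skew: "\<And>x i j. x \<in> S \<Longrightarrow> w x $ i $ j = - w x $ j $ i"
    and sym: "\<And>z i j. z \<in> S \<times> UNIV \<Longrightarrow> g z $ i $ j = g z $ j $ i"
    and DVsym: "\<And>z i j k. z \<in> S \<times> UNIV \<Longrightarrow> dv k (\<lambda>y. g y $ i $ j) z = dv j (\<lambda>y. g y $ i $ k) z"
    and nab: "\<And>z. z \<in> S \<times> UNIV \<Longrightarrow> nabla f g z = 0"
    and jac: "\<And>z X Y. z \<in> S \<times> UNIV \<Longrightarrow>
      tensor_val (g z) (jacobi f z *v X) Y - tensor_val (g z) X (jacobi f z *v Y) = dH f (pullback w) z (snd z) X Y"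
  obtains L where "smooth_on (S \<times> UNIV) L" "\<And>z. z \<in> S \<times> UNIV \<Longrightarrow> hess L z = g z"
    "\<And>z i. z \<in> S \<times> UNIV \<Longrightarrow> gyro_form f L w i z = 0"
proof -
  let ?W = "S \<times> (UNIV :: (real ^ 'n) set)"
  note W = open_tube[OF S(1)]
  \<comment> \<open>Symmetry of \<open>D\<^sup>V g\<close> makes each row of \<open>g\<close> closed
    along the fibres. Symmetry of \<open>g\<close> itself is the closedness that the second
    integration, of the resulting momenta \<open>\<theta>\<close>, requires.\<close>
  have "\<exists>P. smooth_on ?W P \<and> (\<forall>z\<in>?W. \<forall>j. dv j P z = g z $ i $ j)" for i
    by (rule fibre_potential[OF S(1) smooth_on_nth[OF W g, of i]]) (use DVsym in auto)
  then obtain \<theta> where th: "\<And>i. smooth_on ?W (\<theta> i)" "\<And>i z j. z \<in> ?W \<Longrightarrow> dv j (\<theta> i) z = g z $ i $ j"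
    by metis
  obtain L0 where L0: "smooth_on ?W L0" "\<And>z j. z \<in> ?W \<Longrightarrow> dv j L0 z = (\<chi> i. \<theta> i z) $ j"
  proof (rule fibre_potential[OF S(1) smooth_on_vec_lambda[OF W th(1)]])
    fix z :: "'n tcoord" and j k
    assume "z \<in> ?W"
    then show "dv k (\<lambda>y. (\<chi> i. \<theta> i y) $ j) z = dv j (\<lambda>y. (\<chi> i. \<theta> i y) $ k) z"
      using sym by (simp add: th(2))
  qed auto
  have hess0: "hess L0 z = g z" if z: "z \<in> ?W" for z
  proof -
    have "dv i (dv j L0) z = g z $ i $ j" for i j
      using dv_transform_open[OF W z, of "dv j L0" "\<theta> j" i] L0(2) th(2)[OF z] sym[OF z] by simp
    then show ?thesis by (simp add: hess_def vec_eq_iff)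
  qed
  have nab0: "nabla f (hess L0) z = 0" if z: "z \<in> ?W" for z
  proof -
    have "nabla f (hess L0) z $ i $ j = nabla f g z $ i $ j" for i j
      using Gam_transform_open[OF W z, of "\<lambda>y. hess L0 y $ i $ j" "\<lambda>y. g y $ i $ j" f] hess0
      by (simp add: nabla_component hess0[OF z])
    then show ?thesis using nab[OF z] by (simp add: vec_eq_iff)
  qed
  define E where "E = gyro_form f L0 w"
  define \<mu> where "\<mu> j i z = hor_curl f L0 j i z - w (fst z) $ j $ i" for j i z
  have sE: "smooth_on ?W (E i)" for i unfolding E_def by (rule smooth_on_gyro_form[OF S L0(1)])
  have dvE: "dv j (E i) z = \<mu> j i z" if z: "z \<in> ?W" for z i j
    using dv_gyro_form[OF S L0(1) z, of j i] nab0[OF z] by (simp add: E_def \<mu>_def)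
  have smu: "smooth_on ?W (\<mu> j i)" for j i
    by (rule smooth_on_cong[OF W dvE smooth_on_dv[OF sE]])
  have mu_skew: "\<mu> j i z = - \<mu> i j z" if z: "z \<in> ?W" for z i j
    using skew[of "fst z" i j] z by (auto simp: \<mu>_def hor_curl_def)
  have dmu: "dv k (\<mu> j i) z = 0" if z: "z \<in> ?W" for z i j k
  proof (rule symmetric_skew_zero[where T = "\<lambda>k j i. dv k (\<mu> j i) z"])
    fix i j k
    have "dv i (\<mu> j k) z = dv i (dv j (E k)) z"
      by (rule dv_transform_open[OF W z]) (rule dvE[symmetric])
    also have "\<dots> = dv j (dv i (E k)) z" by (rule dv_commute[OF W sE z])
    also have "\<dots> = dv j (\<mu> i k) z" by (rule dv_transform_open[OF W z]) (rule dvE)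
    finally show "dv i (\<mu> j k) z = dv j (\<mu> i k) z" .
    have "dv i (\<mu> j k) z = dv i (\<lambda>y. - \<mu> k j y) z"
      by (rule dv_transform_open[OF W z]) (rule mu_skew)
    also have "\<dots> = - dv i (\<mu> k j) z"
      using frechet_derivative_diff[OF differentiable_const smooth_on_differentiable[OF smu z], of 0 k j "(0, axis i 1)"]
      by (simp add: dv_def)
    finally show "dv i (\<mu> j k) z = - dv i (\<mu> k j) z" .
  qed
  \<comment> \<open>Since \<open>\<mu>\<close> is constant along the fibres and \<open>E\<close>
    affine there, values on the zero section give the coefficients as smooth functions of
    position.\<close>
  define m where "m x = (\<chi> j i. \<mu> j i (x, 0))" for x
  define \<nu> where "\<nu> x = (\<chi> i. E i (x, 0))" for x
  have mu_m: "\<mu> j i z = m (fst z) $ j $ i" if "z \<in> ?W" for z i j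
    using fibre_constant[OF S(1) smu dmu, of "fst z" j i "snd z" 0] that by (simp add: m_def mem_Times_iff)
  have s0: "smooth_on S (\<lambda>x. (x, 0::real^'n))"
    by (intro smooth_on_Pair smooth_on_ident smooth_on_const S(1))
  have sm: "smooth_on S m" unfolding m_def
    by (intro smooth_on_vec_lambda S(1) smooth_on_compose[OF S(1) W smu s0]) auto
  have snu: "smooth_on S \<nu>" unfolding \<nu>_def
    by (intro smooth_on_vec_lambda S(1) smooth_on_compose[OF S(1) W sE s0]) auto
  have dm: "m differentiable at x" and dnu: "\<nu> differentiable at x" if "x \<in> S" for x
    using smooth_on_differentiable[OF sm that] smooth_on_differentiable[OF snu that] by auto
  have slin: "smooth_on ?W (\<lambda>z. \<Sum>k\<in>UNIV. m (fst z) $ k $ i * snd z $ k)" for i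
    by (rule smooth_on_gyro_linear_part[OF S(1) sm])
  have snu': "smooth_on ?W (\<lambda>z. \<nu> (fst z) $ i)" for i
    by (rule smooth_on_pullback[OF S(1) smooth_on_nth[OF S(1) snu]])
  have Dnu': "fderiv (\<lambda>z. \<nu> (fst z) $ i) z u = fderiv \<nu> (fst z) (fst u) $ i"
    if "z \<in> ?W" for i z and u :: "'n tcoord"
  proof -
    have zS: "fst z \<in> S" using that by auto
    show ?thesis
      using frechet_derivative_fst[OF smooth_on_differentiable[OF smooth_on_nth[OF S(1) snu, of i] zS], where u = u]
        frechet_derivative_nth[OF dnu[OF zS]] by simp
  qed
  have E_eq: "E i z = (\<Sum>k\<in>UNIV. m (fst z) $ k $ i * snd z $ k) + \<nu> (fst z) $ i" if z: "z \<in> ?W" for z i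
  proof -
    let ?R = "\<lambda>z. E i z - (\<Sum>k\<in>UNIV. m (fst z) $ k $ i * snd z $ k)"
    have "?R (fst z, snd z) = ?R (fst z, 0)"
    proof (rule fibre_constant[OF S(1)])
      show "smooth_on ?W ?R" by (intro smooth_on_diff W sE slin)
      fix y k assume y: "y \<in> ?W"
      then have yS: "fst y \<in> S" by auto
      show "dv k ?R y = 0"
        using dvE[OF y, of k i] linear_0[OF linear_frechet_derivative[OF dm[OF yS]]]
        by (simp add: dv_def mu_m[OF y] frechet_derivative_gyro_linear_part[OF S(1) sm yS] sum_axis_right
            frechet_derivative_diff[OF smooth_on_differentiable[OF sE y] smooth_on_differentiable[OF slin y]])
    qed (use z in auto)
    then show ?thesis by (simp add: \<nu>_def)
  qed
  let ?Dm = "\<lambda>x k. fderiv m x (axis k 1)"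
  let ?Dw = "\<lambda>x k. fderiv w x (axis k 1)"
  let ?Dn = "\<lambda>x k. fderiv \<nu> x (axis k 1)"
  have dqE: "dq j (E i) z = (\<Sum>k\<in>UNIV. ?Dm (fst z) j $ k $ i * snd z $ k) + ?Dn (fst z) j $ i" if z: "z \<in> ?W" for z i j
  proof -
    have zS: "fst z \<in> S" using z by auto
    have "dq j (E i) z = dq j (\<lambda>z. (\<Sum>k\<in>UNIV. m (fst z) $ k $ i * snd z $ k) + \<nu> (fst z) $ i) z"
      by (rule dq_transform_open[OF W z E_eq])
    then show ?thesis
      by (simp add: dq_def frechet_derivative_add[OF smooth_on_differentiable[OF slin z] smooth_on_differentiable[OF snu' z]]
          frechet_derivative_gyro_linear_part[OF S(1) sm zS] Dnu'[OF z])
  qed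
  have mskew: "m x $ i $ j = - m x $ j $ i" if "x \<in> S" for x i j
    using mu_skew[of "(x, 0)" i j] that by (simp add: m_def)
  \<comment> \<open>The left side does not contain \<open>v\<close> and the right side is linear in
    it. Putting \<open>v = 0\<close> makes \<open>\<nu>\<close> closed, and then the basis vectors
    make \<open>m\<close> closed.\<close>
  have key: "?Dn x j $ i - ?Dn x i $ j
      = (\<Sum>k\<in>UNIV. v $ k * (?Dm x k $ j $ i - ?Dm x j $ k $ i + ?Dm x i $ k $ j))" if x: "x \<in> S" for x v i j
  proof -
    define z where "z = (x, v)"
    have z: "z \<in> ?W" "fst z \<in> S" "fst z = x" "snd z = v" using x by (auto simp: z_def)
    have "(\<Sum>k\<in>UNIV. jacobi f z $ k $ i * g z $ k $ j) - (\<Sum>k\<in>UNIV. g z $ i $ k * jacobi f z $ k $ j) =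
        (\<Sum>k\<in>UNIV. v $ k * (?Dw x k $ i $ j + ?Dw x i $ j $ k + ?Dw x j $ k $ i))"
      using jacobi_condition_components[OF S(1,2) z(2) skew, where g = "g z" and J = "jacobi f z" and f = f] jac[OF z(1)] z by simp
    then have J: "(\<Sum>k\<in>UNIV. jacobi f z $ k $ i * hess L0 z $ k $ j) - (\<Sum>k\<in>UNIV. jacobi f z $ k $ j * hess L0 z $ k $ i) =
        (\<Sum>k\<in>UNIV. v $ k * (?Dw x k $ i $ j + ?Dw x i $ j $ k + ?Dw x j $ k $ i))"
      by (simp add: hess0[OF z(1)] sym[OF z(1), of _ i] mult.commute)
    have "Gam f (hor_curl f L0 j i) z = Gam f (\<lambda>y. m (fst y) $ j $ i + w (fst y) $ j $ i) z"
      by (rule Gam_transform_open[OF W z(1)]) (use mu_m in \<open>auto simp: \<mu>_def algebra_simps\<close>)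
    also have "\<dots> = Gam f (\<lambda>y. m (fst y) $ j $ i) z + Gam f (\<lambda>y. w (fst y) $ j $ i) z"
      by (rule Gam_add; rule smooth_on_differentiable[OF smooth_on_pullback[OF S(1)] z(1)])
        (intro smooth_on_nth S(1) sm S(2))+
    also have "\<dots> = (\<Sum>k\<in>UNIV. v $ k * ?Dm x k $ j $ i) + (\<Sum>k\<in>UNIV. v $ k * ?Dw x k $ j $ i)"
      using Gam_pullback[OF smooth_on_differentiable[OF S(2) z(2)], of f] Gam_pullback[OF dm[OF z(2)], of f] z by simp
    finally have G: "Gam f (hor_curl f L0 j i) z
      = (\<Sum>k\<in>UNIV. v $ k * ?Dm x k $ j $ i) + (\<Sum>k\<in>UNIV. v $ k * ?Dw x k $ j $ i)" .
    \<comment> \<open>All derivatives of \<open>w\<close> cancel: those from \<Gamma> applied to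
      \<open>hor_curl\<close>, those from the condition on \<Phi>, and those from the gyroscopic
      term inside \<open>E\<close>. Only \<open>m\<close> and \<open>\<nu>\<close> remain.\<close>
    have wcancel: "(\<Sum>k\<in>UNIV. v $ k * ?Dw x k $ j $ i)
        + (\<Sum>k\<in>UNIV. v $ k * (?Dw x k $ i $ j + ?Dw x i $ j $ k + ?Dw x j $ k $ i))
        - (\<Sum>k\<in>UNIV. (?Dw x j $ k $ i - ?Dw x i $ k $ j) * v $ k) = 0"
      unfolding sum.distrib[symmetric] sum_subtractf[symmetric]
    proof (rule sum.neutral, rule ballI)
      fix k
      have "?Dw x k $ j $ i = - ?Dw x k $ i $ j" "?Dw x i $ k $ j = - ?Dw x i $ j $ k"
        by (rule frechet_derivative_skew[OF S(1,2) x skew], assumption)+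
      then show "v $ k * ?Dw x k $ j $ i + v $ k * (?Dw x k $ i $ j + ?Dw x i $ j $ k + ?Dw x j $ k $ i)
          - (?Dw x j $ k $ i - ?Dw x i $ k $ j) * v $ k = 0"
        by (simp add: algebra_simps)
    qed
    have "dq j (E i) z - dq i (E j) z = (\<Sum>k\<in>UNIV. v $ k * ?Dm x k $ j $ i)"
      using dq_gyro_form_antisym[OF S L0(1) z(1) nab0[OF z(1)], of j i, folded E_def, unfolded z(3,4)] J G wcancel
      by linarith
    then have "?Dn x j $ i - ?Dn x i $ j = (\<Sum>k\<in>UNIV. v $ k * ?Dm x k $ j $ i)
        - (\<Sum>k\<in>UNIV. ?Dm x j $ k $ i * v $ k) + (\<Sum>k\<in>UNIV. ?Dm x i $ k $ j * v $ k)"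
      using dqE[OF z(1), of j i, unfolded z(3,4)] dqE[OF z(1), of i j, unfolded z(3,4)] by linarith
    also have "\<dots> = (\<Sum>k\<in>UNIV. v $ k * (?Dm x k $ j $ i - ?Dm x j $ k $ i + ?Dm x i $ k $ j))"
      by (simp add: sum.distrib sum_subtractf algebra_simps)
    finally show ?thesis .
  qed
  have nu_closed: "?Dn x j $ i = ?Dn x i $ j" if "x \<in> S" for x i j
    using key[OF that, of j i 0] by simp
  have m_closed: "?Dm x k $ j $ i - ?Dm x j $ k $ i + ?Dm x i $ k $ j = 0" if x: "x \<in> S" for x i j k
  proof -
    have "(\<Sum>l\<in>UNIV. axis k 1 $ l * (?Dm x l $ j $ i - ?Dm x j $ l $ i + ?Dm x i $ l $ j)) = 0"
      using key[OF x, of j i "axis k 1"] nu_closed[OF x, of j i] by simp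
    then show ?thesis
      using sum_axis_right[of "\<lambda>l. ?Dm x l $ j $ i - ?Dm x j $ l $ i + ?Dm x i $ l $ j" k] by (simp add: mult.commute)
  qed
  obtain b where b: "smooth_on S b" "\<And>x u. x \<in> S \<Longrightarrow> fderiv b x u = \<nu> x \<bullet> u"
  proof (rule poincare_one_form[OF S(1) snu star])
    fix x u v assume x: "x \<in> S"
    have e: "fderiv \<nu> x u \<bullet> v = (\<Sum>i\<in>UNIV. \<Sum>k\<in>UNIV. u $ k * v $ i * ?Dn x k $ i)" for u v
      by (subst frechet_derivative_axis_sum[OF dnu[OF x]]) (simp add: inner_vec_def sum_distrib_left sum_distrib_right mult_ac)
    show "fderiv \<nu> x u \<bullet> v = fderiv \<nu> x v \<bullet> u"
      unfolding e
    proof (subst sum.swap, intro sum.cong refl)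
      fix i k
      show "u $ i * v $ k * ?Dn x i $ k = v $ k * u $ i * ?Dn x k $ i"
        using nu_closed[OF x, of i k] by simp
    qed
  qed auto
  \<comment> \<open>The signs come from \<open>gyro_form_add_affine\<close>: the derivatives of
    \<open>a\<close> are added to \<open>E\<close>, so \<open>- m\<close> is integrated, while those
    of \<open>b\<close> are subtracted, so \<open>\<nu>\<close> is.\<close>
  obtain a where a: "smooth_on S a" "\<And>x i j. x \<in> S \<Longrightarrow>
      fderiv a x (axis j 1) $ i - fderiv a x (axis i 1) $ j = - m x $ j $ i"
  proof (rule poincare_two_form[OF S(1) smooth_on_uminus[OF S(1) sm] star])
    fix x i j k assume x: "x \<in> S"
    have Dneg: "fderiv (\<lambda>x. - m x) x u = - fderiv m x u" for u
      using frechet_derivative_diff[OF differentiable_const dm[OF x], of 0 u] by simp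
    show "fderiv (\<lambda>x. - m x) x (axis i 1) $ j $ k + fderiv (\<lambda>x. - m x) x (axis j 1) $ k $ i
        + fderiv (\<lambda>x. - m x) x (axis k 1) $ i $ j = 0"
      using m_closed[OF x, of i j k] frechet_derivative_skew[OF S(1) sm x mskew, of "axis j 1" i k]
      by (simp add: Dneg)
  next
    show "(- m x) $ i $ j = - (- m x) $ j $ i" if "x \<in> S" for x i j
      using mskew[OF that, of i j] by simp
  qed auto
  show thesis
  proof
    let ?L = "\<lambda>z. L0 z + (\<Sum>k\<in>UNIV. a (fst z) $ k * snd z $ k) + b (fst z)"
    show "smooth_on ?W ?L"
      by (intro smooth_on_add smooth_on_sum smooth_on_mult smooth_on_nth smooth_on_pullback smooth_on_snd W S(1) a(1) b(1) L0(1))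
    fix z :: "'n tcoord" assume z: "z \<in> ?W"
    then have zS: "fst z \<in> S" by auto
    note aff = gyro_form_add_affine[OF S(1,3) L0(1) a(1) b(1) z]
    show "hess ?L z = g z" using aff(2) hess0[OF z] by simp
    fix i
    have "gyro_form f ?L w i z = E i z + (\<Sum>k\<in>UNIV. snd z $ k * (- m (fst z) $ k $ i)) - \<nu> (fst z) $ i"
      unfolding aff(1) a(2)[OF zS] b(2)[OF zS] E_def by (simp add: inner_axis)
    then show "gyro_form f ?L w i z = 0"
      by (simp add: E_eq[OF z] sum_negf mult.commute)
  qed
qed

section \<open>Tangent maps\<close>

text \<open>The tangent map of a map between normed spaces, stated without charts so that the
  calculus of coordinate changes is independent of the atlas.\<close>

definition tmap :: "('a::real_normed_vector \<Rightarrow> 'b::real_normed_vector) \<Rightarrow> 'a \<times> 'a \<Rightarrow> 'b \<times> 'b" where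
  "tmap \<phi> z = (\<phi> (fst z), fderiv \<phi> (fst z) (snd z))"

lemma tangent_transition_tmap: "tangent_transition c d = tmap (transition c d)"
  by (simp add: fun_eq_iff tangent_transition_def tmap_def jacobian_map_def)

text \<open>The velocity component of a tangent map is the derivative of
  \<open>\<phi> (fst z)\<close> along the field \<open>(snd z, 0)\<close>. So
  \<open>frechet_derivative_apply_field\<close> applies, and it puts the second derivative of
  \<open>\<phi>\<close> into the order used below.\<close>

lemma tmap_fibre_derivative:
  fixes \<phi> :: "'a::euclidean_space \<Rightarrow> 'b::euclidean_space"
  assumes S: "open S" "smooth_on S \<phi>"
  shows "smooth_on (S \<times> UNIV) (\<lambda>z. fderiv \<phi> (fst z) (snd z))"
    and "z \<in> S \<times> UNIV \<Longrightarrow> fderiv (\<lambda>z. fderiv \<phi> (fst z) (snd z)) z (\<xi>, \<eta>) =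
      fderiv (\<lambda>x. fderiv \<phi> x \<xi>) (fst z) (snd z) + fderiv \<phi> (fst z) \<eta>"
proof -
  let ?W = "S \<times> (UNIV :: 'a set)" and ?P = "\<lambda>z :: 'a \<times> 'a. \<phi> (fst z)" and ?X = "\<lambda>z :: 'a \<times> 'a. (snd z, 0 :: 'a)"
  note W = open_tube[OF S(1), where 'b = 'a]
  have sP: "smooth_on ?W ?P" by (rule smooth_on_pullback[OF S])
  have sX: "smooth_on ?W ?X" by (intro smooth_on_Pair smooth_on_snd smooth_on_const W)
  have d: "\<phi> differentiable at (fst z)" if "z \<in> ?W" for z
    using smooth_on_differentiable[OF S(2)] that by auto
  have DP: "fderiv ?P z u = fderiv \<phi> (fst z) (fst u)" if "z \<in> ?W" for z u
    by (rule frechet_derivative_fst[OF d[OF that]])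
  have eq: "fderiv ?P z (?X z) = fderiv \<phi> (fst z) (snd z)" if "z \<in> ?W" for z
    using DP[OF that] by simp
  show "smooth_on ?W (\<lambda>z. fderiv \<phi> (fst z) (snd z))"
    by (rule smooth_on_cong[OF W eq smooth_on_frechet_derivative_apply[OF W sP sX]])
  assume z: "z \<in> ?W"
  have DX: "fderiv ?X z u = (snd u, 0)" for u
  proof -
    have "(?X has_derivative (\<lambda>u. (snd u, 0))) (at z)" by (auto intro!: derivative_eq_intros)
    from fun_cong[OF frechet_derivative_at[OF this, symmetric]] show ?thesis .
  qed
  have "fderiv (\<lambda>z. fderiv \<phi> (fst z) (snd z)) z (\<xi>, \<eta>) =
      fderiv (\<lambda>z. fderiv ?P z (?X z)) z (\<xi>, \<eta>)"
    by (rule fun_cong[OF frechet_derivative_transform_open[OF W z eq[symmetric]]])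
  also have "\<dots> = fderiv (\<lambda>y. fderiv ?P y (\<xi>, \<eta>)) z (?X z)
      + fderiv ?P z (fderiv ?X z (\<xi>, \<eta>))"
    by (rule frechet_derivative_apply_field[OF W sP sX z])
  also have "fderiv (\<lambda>y. fderiv ?P y (\<xi>, \<eta>)) z (?X z)
      = fderiv (\<lambda>y. fderiv \<phi> (fst y) \<xi>) z (?X z)"
    by (rule fun_cong[OF frechet_derivative_transform_open[OF W z]]) (simp add: DP)
  also have "\<dots> = fderiv (\<lambda>x. fderiv \<phi> x \<xi>) (fst z) (snd z)"
    by (subst frechet_derivative_fst)
      (use z in \<open>auto intro!: smooth_on_differentiable[OF smooth_on_frechet_derivative[OF S(2)]]\<close>)
  finally show "fderiv (\<lambda>z. fderiv \<phi> (fst z) (snd z)) z (\<xi>, \<eta>) =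
      fderiv (\<lambda>x. fderiv \<phi> x \<xi>) (fst z) (snd z) + fderiv \<phi> (fst z) \<eta>"
    by (simp add: DX DP[OF z])
qed

lemma smooth_on_tmap:
  fixes \<phi> :: "'a::euclidean_space \<Rightarrow> 'b::euclidean_space"
  assumes "open S" "smooth_on S \<phi>"
  shows "smooth_on (S \<times> UNIV) (tmap \<phi>)"
  unfolding tmap_def[abs_def]
  by (intro smooth_on_Pair open_tube smooth_on_pullback tmap_fibre_derivative assms)

lemma frechet_derivative_tmap:
  fixes \<phi> :: "'a::euclidean_space \<Rightarrow> 'b::euclidean_space"
  assumes S: "open S" "smooth_on S \<phi>" and z: "z \<in> S \<times> UNIV"
  shows "fderiv (tmap \<phi>) z (\<xi>, \<eta>) = (fderiv \<phi> (fst z) \<xi>,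
    fderiv (\<lambda>x. fderiv \<phi> x \<xi>) (fst z) (snd z) + fderiv \<phi> (fst z) \<eta>)"
proof -
  have zS: "fst z \<in> S" using z by auto
  have "(tmap \<phi> has_derivative (\<lambda>u. (fderiv (\<lambda>z. \<phi> (fst z)) z u,
      fderiv (\<lambda>z. fderiv \<phi> (fst z) (snd z)) z u))) (at z)"
    unfolding tmap_def[abs_def]
    by (intro has_derivative_Pair smooth_on_has_derivative[OF _ z] smooth_on_pullback tmap_fibre_derivative S)
  from fun_cong[OF frechet_derivative_at[OF this, symmetric], of "(\<xi>, \<eta>)"]
  show ?thesis
    by (simp add: tmap_fibre_derivative(2)[OF S z] frechet_derivative_fst[OF smooth_on_differentiable[OF S(2) zS]])
qed

lemma frechet_derivative_compose:
  assumes "F differentiable at (G z)" "G differentiable at z"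
  shows "fderiv (\<lambda>y. F (G y)) z u = fderiv F (G z) (fderiv G z u)"
  using fun_cong[OF frechet_derivative_at[OF has_derivative_compose[OF assms(2)[unfolded frechet_derivative_works]
          assms(1)[unfolded frechet_derivative_works]], symmetric], of u] by simp

lemma tensor_val_linear_image:
  fixes M N :: "real ^ 'n ^ 'n::finite"
  assumes J: "linear J" and M: "\<And>i j. M $ i $ j = tensor_val N (J (axis i 1)) (J (axis j 1))"
  shows "tensor_val M X Y = tensor_val N (J X) (J Y)"
proof -
  have Jx: "J X = (\<Sum>i\<in>UNIV. X $ i *\<^sub>R J (axis i 1))" for X
  proof -
    have "J X = J (\<Sum>i\<in>UNIV. X $ i *\<^sub>R axis i 1)"
      using basis_expansion[of X] by (simp add: scalar_mult_eq_scaleR)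
    then show ?thesis by (simp add: linear_sum[OF J] linear_cmul[OF J])
  qed
  have lin1: "linear (\<lambda>X. tensor_val N X Y)" and lin2: "linear (\<lambda>Y. tensor_val N X Y)" for X Y
    by (auto intro!: linearI simp: tensor_val_def algebra_simps sum.distrib sum_distrib_left)
  have "tensor_val N (J X) (J Y) = (\<Sum>i\<in>UNIV. X $ i * tensor_val N (J (axis i 1)) (J Y))"
    by (subst Jx) (simp add: linear_sum[OF lin1] linear_cmul[OF lin1])
  also have "\<dots> = (\<Sum>i\<in>UNIV. X $ i * (\<Sum>j\<in>UNIV. Y $ j * tensor_val N (J (axis i 1)) (J (axis j 1))))"
    by (subst (2) Jx) (simp add: linear_sum[OF lin2] linear_cmul[OF lin2])
  finally show ?thesis
    by (simp add: tensor_val_def[of M] M sum_distrib_left mult_ac)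
qed

lemma matrix_eq_tensor_val:
  fixes M N :: "real ^ 'n ^ 'n::finite"
  assumes "\<And>X Y. tensor_val M X Y = tensor_val N X Y"
  shows "M = N"
proof -
  have "tensor_val M (axis i 1) (axis j 1) = M $ i $ j" for M :: "real ^ 'n ^ 'n" and i j
    by (simp add: tensor_val_axis_right sum_axis_right)
  then show ?thesis using assms by (metis vec_eq_iff)
qed

lemma hess_transform_open:
  assumes "open W" "z \<in> W" "\<And>y. y \<in> W \<Longrightarrow> L y = L' y"
  shows "hess L z = hess L' z"
proof -
  have "dv i (dv j L) z = dv i (dv j L') z" for i j
    by (rule dv_transform_open[OF assms(1,2)]) (rule dv_transform_open[OF assms(1) _ assms(3)])
  then show ?thesis by (simp add: hess_def)
qed

section \<open>Covariance of the Hessian and of \<open>gyro_form\<close> under tangent maps\<close>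

context
  fixes S S' :: "(real ^ 'n::finite) set" and \<phi> :: "real ^ 'n \<Rightarrow> real ^ 'n" and L :: "'n tcoord \<Rightarrow> real"
  assumes S: "open S" "smooth_on S \<phi>" and S': "open S'" "\<phi> ` S \<subseteq> S'" and L: "smooth_on (S' \<times> UNIV) L"
begin

lemma tmap_in: "z \<in> S \<times> UNIV \<Longrightarrow> tmap \<phi> z \<in> S' \<times> UNIV"
  using S'(2) by (auto simp: tmap_def)

lemma smooth_on_compose_tmap: "smooth_on (S' \<times> UNIV) F \<Longrightarrow> smooth_on (S \<times> UNIV) (\<lambda>z. F (tmap \<phi> z))"
  by (rule smooth_on_compose[OF open_tube[OF S(1)] open_tube[OF S'(1)] _ smooth_on_tmap[OF S]])
    (use tmap_in in blast)+

lemma frechet_derivative_compose_tmap: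
  assumes "smooth_on (S' \<times> UNIV) F" "z \<in> S \<times> UNIV"
  shows "fderiv (\<lambda>z. F (tmap \<phi> z)) z u =
    fderiv F (tmap \<phi> z) (fderiv (tmap \<phi>) z u)"
  by (rule frechet_derivative_compose[OF smooth_on_differentiable[OF assms(1) tmap_in[OF assms(2)]]
        smooth_on_differentiable[OF smooth_on_tmap[OF S] assms(2)]])

lemma dv_compose_tmap:
  fixes F :: "'n tcoord \<Rightarrow> real"
  assumes "smooth_on (S' \<times> UNIV) F" "z \<in> S \<times> UNIV"
  shows "dv i (\<lambda>z. F (tmap \<phi> z)) z = (\<Sum>j\<in>UNIV. fderiv \<phi> (fst z) (axis i 1) $ j * dv j F (tmap \<phi> z))"
proof -
  have zS: "fst z \<in> S" using assms(2) by auto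
  have "fderiv (\<lambda>x. fderiv \<phi> x 0) (fst z) (snd z) = 0"
  proof -
    have "fderiv (\<lambda>x. fderiv \<phi> x 0) (fst z) = fderiv (\<lambda>x. 0) (fst z)"
      by (rule frechet_derivative_transform_open[OF S(1) zS])
        (rule linear_0[OF linear_frechet_derivative_smooth[OF S(2)]])
    then show ?thesis by simp
  qed
  then have "dv i (\<lambda>z. F (tmap \<phi> z)) z = fderiv F (tmap \<phi> z) (0, fderiv \<phi> (fst z) (axis i 1))"
    using linear_0[OF linear_frechet_derivative_smooth[OF S(2) zS]]
    by (simp add: dv_def frechet_derivative_compose_tmap[OF assms] frechet_derivative_tmap[OF S assms(2)])
  then show ?thesis
    using linear_tcoord_expansion[OF linear_frechet_derivative_smooth[OF assms(1) tmap_in[OF assms(2)]],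
        of 0 "fderiv \<phi> (fst z) (axis i 1)"]
    by (simp add: dv_def)
qed

lemma dq_compose_tmap:
  assumes "z \<in> S \<times> UNIV"
  shows "dq i (\<lambda>z. L (tmap \<phi> z)) z = (\<Sum>j\<in>UNIV. fderiv \<phi> (fst z) (axis i 1) $ j * dq j L (tmap \<phi> z)
    + fderiv (\<lambda>x. fderiv \<phi> x (axis i 1)) (fst z) (snd z) $ j * dv j L (tmap \<phi> z))"
proof -
  have zS: "fst z \<in> S" using assms by auto
  have "dq i (\<lambda>z. L (tmap \<phi> z)) z = fderiv L (tmap \<phi> z) (fderiv \<phi> (fst z) (axis i 1),
     fderiv (\<lambda>x. fderiv \<phi> x (axis i 1)) (fst z) (snd z))"
    using linear_0[OF linear_frechet_derivative_smooth[OF S(2) zS]]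
    by (simp add: dq_def frechet_derivative_compose_tmap[OF L assms] frechet_derivative_tmap[OF S assms])
  then show ?thesis
    using linear_tcoord_expansion[OF linear_frechet_derivative_smooth[OF L tmap_in[OF assms]],
        of "fderiv \<phi> (fst z) (axis i 1)"
          "fderiv (\<lambda>x. fderiv \<phi> x (axis i 1)) (fst z) (snd z)"]
    by (simp add: dv_def dq_def)
qed

lemma jacobian_component_pullback:
  assumes "z \<in> S \<times> UNIV"
  shows "(\<lambda>y::'n tcoord. fderiv \<phi> (fst y) v $ j) differentiable at z"
    and "fderiv (\<lambda>y::'n tcoord. fderiv \<phi> (fst y) v $ j) z u =
      fderiv (\<lambda>x. fderiv \<phi> x v) (fst z) (fst u) $ j"
proof -
  have zS: "fst z \<in> S" using assms by auto
  note sm = smooth_on_frechet_derivative[OF S(2), of v]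
  show "(\<lambda>y::'n tcoord. fderiv \<phi> (fst y) v $ j) differentiable at z"
    by (rule smooth_on_differentiable[OF smooth_on_pullback[OF S(1) smooth_on_nth[OF S(1) sm]] assms])
  show "fderiv (\<lambda>y::'n tcoord. fderiv \<phi> (fst y) v $ j) z u =
      fderiv (\<lambda>x. fderiv \<phi> x v) (fst z) (fst u) $ j"
    using frechet_derivative_fst[OF smooth_on_differentiable[OF smooth_on_nth[OF S(1) sm, of j] zS], where u = u]
      frechet_derivative_nth[OF smooth_on_differentiable[OF sm zS], of j] by simp
qed

text \<open>A vertical derivative of the composite brings out one Jacobian factor. That factor
  depends on position only, so the second vertical derivative passes it by and no inhomogeneous term
  arises.\<close>

lemma hess_compose_tmap:
  assumes z: "z \<in> S \<times> UNIV"
  shows "tensor_val (hess (\<lambda>z. L (tmap \<phi> z)) z) X Y =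
    tensor_val (hess L (tmap \<phi> z)) (fderiv \<phi> (fst z) X) (fderiv \<phi> (fst z) Y)"
proof (rule tensor_val_linear_image)
  have zS: "fst z \<in> S" using z by auto
  show "linear (fderiv \<phi> (fst z))" by (rule linear_frechet_derivative_smooth[OF S(2) zS])
  note W = open_tube[OF S(1), where 'b = "real ^ 'n"]
  let ?J = "\<lambda>v. fderiv \<phi> (fst z) v"
  let ?a = "\<lambda>j l (y::'n tcoord). fderiv \<phi> (fst y) (axis j 1) $ l"
  fix i j
  have d1: "?a j l differentiable at z" for l by (rule jacobian_component_pullback(1)[OF z])
  have d2: "(\<lambda>y. dv l L (tmap \<phi> y)) differentiable at z" for l
    by (rule smooth_on_differentiable[OF smooth_on_compose_tmap[OF smooth_on_dv[OF L]] z])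
  have "linear (fderiv (\<lambda>x. fderiv \<phi> x (axis j 1)) (fst z))"
    by (rule linear_frechet_derivative_smooth[OF smooth_on_frechet_derivative[OF S(2)] zS])
  then have Da: "fderiv (?a j l) z (0, v) = 0" for l v
    by (simp add: jacobian_component_pullback(2)[OF z] linear_0)
  have "dv i (dv j (\<lambda>z. L (tmap \<phi> z))) z = dv i (\<lambda>y. \<Sum>l\<in>UNIV. ?a j l y * dv l L (tmap \<phi> y)) z"
    by (rule dv_transform_open[OF W z]) (rule dv_compose_tmap[OF L])
  also have "\<dots> = (\<Sum>l\<in>UNIV. fderiv (\<lambda>y. ?a j l y * dv l L (tmap \<phi> y)) z (0, axis i 1))"
    unfolding dv_def[of i] by (rule frechet_derivative_sum) (rule differentiable_mult[OF d1 d2])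
  also have "\<dots> = (\<Sum>l\<in>UNIV. ?J (axis j 1) $ l * dv i (\<lambda>y. dv l L (tmap \<phi> y)) z)"
    by (simp add: frechet_derivative_mult[OF d1 d2] Da dv_def[of i])
  also have "\<dots> = (\<Sum>l\<in>UNIV. \<Sum>m\<in>UNIV. ?J (axis j 1) $ l * (?J (axis i 1) $ m * dv m (dv l L) (tmap \<phi> z)))"
    by (simp add: dv_compose_tmap[OF smooth_on_dv[OF L] z] sum_distrib_left)
  also have "\<dots> = tensor_val (hess L (tmap \<phi> z)) (?J (axis i 1)) (?J (axis j 1))"
    unfolding tensor_val_def by (subst sum.swap) (simp add: hess_def mult_ac)
  finally show "hess (\<lambda>z. L (tmap \<phi> z)) z $ i $ j = tensor_val (hess L (tmap \<phi> z)) (?J (axis i 1)) (?J (axis j 1))"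
    by (simp add: hess_def)
qed

text \<open>\<Gamma> acting on the Jacobian in the momentum and the position derivative of
  \<open>L (tmap \<phi> z)\<close> produce the same second-derivative term of \<open>\<phi>\<close>,
  which cancels in the difference. Hence \<open>gyro_form\<close> transforms like a covector, and
  its vanishing does not depend on the chart.\<close>

lemma gyro_form_compose_tmap:
  assumes z: "z \<in> S \<times> UNIV"
    and f: "fderiv (tmap \<phi>) z (snd z, f z) = (snd (tmap \<phi> z), f' (tmap \<phi> z))"
    and w: "\<And>X Y. tensor_val (w (fst z)) X Y =
      tensor_val (w' (\<phi> (fst z))) (fderiv \<phi> (fst z) X) (fderiv \<phi> (fst z) Y)"
  shows "gyro_form f (\<lambda>z. L (tmap \<phi> z)) w i z =
    (\<Sum>j\<in>UNIV. fderiv \<phi> (fst z) (axis i 1) $ j * gyro_form f' L w' j (tmap \<phi> z))"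
proof -
  note W = open_tube[OF S(1), where 'b = "real ^ 'n"]
  let ?J = "\<lambda>v. fderiv \<phi> (fst z) v"
  let ?a = "\<lambda>l (y::'n tcoord). fderiv \<phi> (fst y) (axis i 1) $ l"
  let ?DJ = "fderiv (\<lambda>x. fderiv \<phi> x (axis i 1)) (fst z) (snd z)"
  have d1: "?a l differentiable at z" for l by (rule jacobian_component_pullback(1)[OF z])
  have d2: "(\<lambda>y. dv l L (tmap \<phi> y)) differentiable at z" for l
    by (rule smooth_on_differentiable[OF smooth_on_compose_tmap[OF smooth_on_dv[OF L]] z])
  have GT: "Gam f (\<lambda>y. dv l L (tmap \<phi> y)) z = Gam f' (dv l L) (tmap \<phi> z)" for l
    by (simp add: Gam_frechet_derivative[OF d2] frechet_derivative_compose_tmap[OF smooth_on_dv[OF L] z] f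
        Gam_frechet_derivative[OF smooth_on_differentiable[OF smooth_on_dv[OF L] tmap_in[OF z]]])
  have "Gam f (dv i (\<lambda>z. L (tmap \<phi> z))) z = Gam f (\<lambda>y. \<Sum>l\<in>UNIV. ?a l y * dv l L (tmap \<phi> y)) z"
    by (rule Gam_transform_open[OF W z]) (rule dv_compose_tmap[OF L])
  also have "\<dots> = (\<Sum>l\<in>UNIV. Gam f (\<lambda>y. ?a l y * dv l L (tmap \<phi> y)) z)"
    by (rule Gam_sum) (auto intro: differentiable_mult[OF d1 d2])
  also have "\<dots> = (\<Sum>l\<in>UNIV. ?J (axis i 1) $ l * Gam f' (dv l L) (tmap \<phi> z) + ?DJ $ l * dv l L (tmap \<phi> z))"
    by (simp add: Gam_mult[OF d1 d2] GT Gam_frechet_derivative[OF d1] jacobian_component_pullback(2)[OF z])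
  finally have G: "Gam f (dv i (\<lambda>z. L (tmap \<phi> z))) z - dq i (\<lambda>z. L (tmap \<phi> z)) z =
      (\<Sum>l\<in>UNIV. ?J (axis i 1) $ l * (Gam f' (dv l L) (tmap \<phi> z) - dq l L (tmap \<phi> z)))"
    by (simp add: dq_compose_tmap[OF z] sum_subtractf[symmetric] sum.distrib[symmetric] right_diff_distrib)
  have "(\<Sum>k\<in>UNIV. w (fst z) $ k $ i * snd z $ k) = tensor_val (w (fst z)) (snd z) (axis i 1)"
    by (simp add: tensor_val_axis_right)
  also have "\<dots> = tensor_val (w' (\<phi> (fst z))) (?J (snd z)) (?J (axis i 1))" by (rule w)
  also have "\<dots> = (\<Sum>j\<in>UNIV. ?J (axis i 1) $ j * (\<Sum>k\<in>UNIV. w' (\<phi> (fst z)) $ k $ j * ?J (snd z) $ k))"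
    unfolding tensor_val_def by (subst sum.swap) (simp add: sum_distrib_left mult_ac)
  also have "\<dots> = (\<Sum>j\<in>UNIV. ?J (axis i 1) $ j * (\<Sum>k\<in>UNIV. w' (fst (tmap \<phi> z)) $ k $ j * snd (tmap \<phi> z) $ k))"
    by (simp add: tmap_def)
  finally have "(\<Sum>k\<in>UNIV. w (fst z) $ k $ i * snd z $ k)
    = (\<Sum>j\<in>UNIV. ?J (axis i 1) $ j * (\<Sum>k\<in>UNIV. w' (fst (tmap \<phi> z)) $ k $ j * snd (tmap \<phi> z) $ k))" .
  then show ?thesis
    using G unfolding gyro_form_def by (simp add: right_diff_distrib sum_subtractf)
qed

end

section \<open>Atlases and curves\<close>

context
  fixes Q :: "'q topology" and A :: "('q, 'n::finite) chart set"
  assumes atlas: "smooth_atlas Q A"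
begin

lemma chart_domain_open: "c \<in> A \<Longrightarrow> openin Q (fst c)"
  using atlas by (auto simp: smooth_atlas_def)

lemma chart_image_open: "c \<in> A \<Longrightarrow> open (snd c ` fst c)"
  using atlas by (auto simp: smooth_atlas_def)

lemma chart_homeomorphic:
  "c \<in> A \<Longrightarrow> homeomorphic_map (subtopology Q (fst c)) (top_of_set (snd c ` fst c)) (snd c)"
  using atlas by (auto simp: smooth_atlas_def)

lemma chart_inj_on:
  assumes "c \<in> A"
  shows "inj_on (snd c) (fst c)"
  using homeomorphic_imp_injective_map[OF chart_homeomorphic[OF assms]] openin_subset[OF chart_domain_open[OF assms]]
  by (simp add: inf_absorb2)

lemma open_base_coords:
  assumes "c \<in> A" "openin Q U"
  shows "open (base_coords U c)"
proof -
  have "openin (subtopology Q (fst c)) (U \<inter> fst c)"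
    using assms(2) by (auto simp: openin_subtopology)
  then have "openin (top_of_set (snd c ` fst c)) (snd c ` (U \<inter> fst c))"
    using homeomorphic_imp_open_map[OF chart_homeomorphic[OF assms(1)]] by (simp add: open_map_def)
  then show ?thesis
    unfolding base_coords_def by (rule openin_open_trans[OF _ chart_image_open[OF assms(1)]])
qed

lemma open_tangent_coords: "c \<in> A \<Longrightarrow> openin Q U \<Longrightarrow> open (tangent_coords U c)"
  unfolding tangent_coords_def by (intro open_tube open_base_coords)

lemma transition_apply: "c \<in> A \<Longrightarrow> p \<in> fst c \<Longrightarrow> transition c d (snd c p) = snd d p"
  by (simp add: transition_def chart_inj_on)

lemma transition_base_coords:
  "c \<in> A \<Longrightarrow> x \<in> base_coords (U \<inter> fst d) c \<Longrightarrow> transition c d x \<in> base_coords U d"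
  by (auto simp: base_coords_def transition_apply)

lemma smooth_on_transition:
  assumes "c \<in> A" "d \<in> A"
  shows "smooth_on (base_coords (U \<inter> fst d) c) (transition c d)"
proof (rule smooth_on_subset)
  show "smooth_on (snd c ` (fst c \<inter> fst d)) (transition c d)"
    using atlas assms by (simp add: smooth_atlas_def)
qed (auto simp: base_coords_def)

lemma tangent_transition_in:
  "c \<in> A \<Longrightarrow> z \<in> tangent_coords (U \<inter> fst d) c \<Longrightarrow> tangent_transition c d z \<in> tangent_coords U d"
  by (auto simp: tangent_coords_def tangent_transition_tmap tmap_def transition_base_coords)

text \<open>The chain rule on a triple overlap. It makes a function transported from one chart to
  all others compatible with every change of chart.\<close>

lemma tangent_transition_cocycle:
  assumes c: "c \<in> A" "d \<in> A" "e \<in> A" and z: "z \<in> tangent_coords (fst d \<inter> fst e) c"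
  shows "tangent_transition d e (tangent_transition c d z) = tangent_transition c e z"
proof -
  let ?S = "base_coords (fst d \<inter> fst e) c"
  have S: "open ?S" by (intro open_base_coords c openin_Int chart_domain_open)
  have x: "fst z \<in> ?S" using z by (auto simp: tangent_coords_def)
  have comp: "transition c e y = transition d e (transition c d y)" if "y \<in> ?S" for y
    using that c by (auto simp: base_coords_def transition_apply)
  have dc: "transition c d differentiable at (fst z)"
    by (rule smooth_on_differentiable[OF smooth_on_transition[OF c(1,2), of UNIV]])
      (use x in \<open>auto simp: base_coords_def\<close>)
  have dd: "transition d e differentiable at (transition c d (fst z))"
    by (rule smooth_on_differentiable[OF smooth_on_transition[OF c(2,3), of UNIV]])
      (use x c in \<open>auto simp: base_coords_def transition_apply\<close>)
  have "fderiv (transition c e) (fst z) = fderiv (\<lambda>y. transition d e (transition c d y)) (fst z)"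
    by (rule frechet_derivative_transform_open[OF S x comp])
  then have "fderiv (transition c e) (fst z) v =
      fderiv (transition d e) (transition c d (fst z)) (fderiv (transition c d) (fst z) v)" for v
    using frechet_derivative_compose[OF dd dc, of v] by simp
  then show ?thesis
    using comp[OF x] by (simp add: tangent_transition_tmap tmap_def)
qed

lemma smooth_on_tangent_transition:
  assumes "c \<in> A" "d \<in> A" "openin Q U"
  shows "smooth_on (tangent_coords (U \<inter> fst d) c) (tangent_transition c d)"
  unfolding tangent_coords_def tangent_transition_tmap
  by (intro smooth_on_tmap open_base_coords smooth_on_transition assms openin_Int chart_domain_open)

end

lemma smooth_on_vector_derivative:
  fixes p :: "real \<Rightarrow> 'a::real_normed_vector"
  assumes I: "open I" "smooth_on I p"
  shows "smooth_on I (\<lambda>t. vector_derivative p (at t))"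
    and "t \<in> I \<Longrightarrow> (p has_vector_derivative vector_derivative p (at t)) (at t)"
proof -
  have 1: "(p has_vector_derivative fderiv p t 1) (at t)" if "t \<in> I" for t
  proof -
    have "fderiv p t r = r *\<^sub>R fderiv p t 1" for r
      using linear_cmul[OF linear_frechet_derivative_smooth[OF I(2) that], of r 1] by simp
    then have "fderiv p t = (\<lambda>r. r *\<^sub>R fderiv p t 1)" by blast
    then show ?thesis
      using smooth_on_has_derivative[OF I(2) that] by (simp add: has_vector_derivative_def)
  qed
  show "smooth_on I (\<lambda>t. vector_derivative p (at t))"
    by (rule smooth_on_cong[OF I(1) _ smooth_on_frechet_derivative[OF I(2), of 1]])
      (rule vector_derivative_at[OF 1, symmetric])
  show "t \<in> I \<Longrightarrow> (p has_vector_derivative vector_derivative p (at t)) (at t)"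
    using 1 vector_derivative_at[OF 1] by simp
qed

text \<open>The tangent vector \<open>(v, a)\<close> of the lifted curve splits into
  \<open>(v, f)\<close> and the vertical vector \<open>(0, a - f)\<close>. The first part gives
  \<open>gyro_form\<close>; the second lets the acceleration defect act through the Hessian.\<close>

lemma euler_lagrange_along_curve:
  fixes f :: "'n tcoord \<Rightarrow> real ^ 'n::finite"
  assumes W: "smooth_on W L" "(p t, v t) \<in> W"
    and p: "(p has_vector_derivative v t) (at t)" and v: "(v has_vector_derivative a) (at t)"
  shows "deriv (\<lambda>s. dv i L (p s, v s)) t - dq i L (p t, v t) - (\<Sum>k\<in>UNIV. w (p t) $ k $ i * v t $ k) =
    gyro_form f L w i (p t, v t) + ((a - f (p t, v t)) v* hess L (p t, v t)) $ i"
proof -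
  let ?z = "(p t, v t)"
  note th = smooth_on_dv[OF W(1), of i]
  have "((\<lambda>s. (p s, v s)) has_derivative (\<lambda>r. (r *\<^sub>R v t, r *\<^sub>R a))) (at t)"
    using p v unfolding has_vector_derivative_def by (rule has_derivative_Pair)
  from has_derivative_compose[OF this smooth_on_has_derivative[OF th W(2)]]
  have "((\<lambda>s. dv i L (p s, v s)) has_derivative (\<lambda>r. fderiv (dv i L) ?z (r *\<^sub>R (v t, a)))) (at t)"
    by simp
  then have "((\<lambda>s. dv i L (p s, v s)) has_real_derivative fderiv (dv i L) ?z (v t, a)) (at t)"
    unfolding linear_cmul[OF linear_frechet_derivative_smooth[OF th W(2)]]
    by (simp add: has_field_derivative_def mult_commute_abs)
  then have "deriv (\<lambda>s. dv i L (p s, v s)) t = fderiv (dv i L) ?z (v t, a)"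
    by (rule DERIV_imp_deriv)
  also have "\<dots> = fderiv (dv i L) ?z (v t, f ?z) + fderiv (dv i L) ?z (0, a - f ?z)"
    using linear_add[OF linear_frechet_derivative_smooth[OF th W(2)], of "(v t, f ?z)" "(0, a - f ?z)"] by simp
  also have "fderiv (dv i L) ?z (v t, f ?z) = Gam f (dv i L) ?z"
    by (simp add: Gam_frechet_derivative[OF smooth_on_differentiable[OF th W(2)]])
  also have "fderiv (dv i L) ?z (0, a - f ?z) = ((a - f ?z) v* hess L ?z) $ i"
    by (subst linear_tcoord_expansion[OF linear_frechet_derivative_smooth[OF th W(2)]])
      (simp add: vector_matrix_mult_def hess_def dv_def[of _ "dv i L"] mult.commute)
  finally show ?thesis by (simp add: gyro_form_def)
qed

context
  fixes Q :: "'q topology" and A :: "('q, 'n::finite) chart set" and U I \<gamma>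
  assumes atlas: "smooth_atlas Q A" and curve: "smooth_curve Q A U I \<gamma>"
begin

lemma open_curve_chart_times:
  assumes "c \<in> A"
  shows "open {t \<in> I. \<gamma> t \<in> fst c}"
proof -
  have "openin (top_of_set I) {t \<in> topspace (top_of_set I). \<gamma> t \<in> fst c}"
    using curve by (intro openin_continuous_map_preimage[OF _ chart_domain_open[OF atlas assms]]) (simp add: smooth_curve_def)
  then show ?thesis
    using curve by (auto simp: smooth_curve_def intro: openin_open_trans)
qed

lemma curve_derivatives:
  assumes "c \<in> A" "t \<in> I" "\<gamma> t \<in> fst c"
  shows "(position c \<gamma> has_vector_derivative velocity c \<gamma> t) (at t)"
    and "(velocity c \<gamma> has_vector_derivative acceleration c \<gamma> t) (at t)"
proof -
  let ?I = "{t \<in> I. \<gamma> t \<in> fst c}"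
  have p: "smooth_on ?I (position c \<gamma>)"
    using curve assms(1) by (simp add: smooth_curve_def position_def[abs_def])
  have t: "t \<in> ?I" using assms by simp
  note o = open_curve_chart_times[OF assms(1)]
  show "(position c \<gamma> has_vector_derivative velocity c \<gamma> t) (at t)"
    using smooth_on_vector_derivative(2)[OF o p t] by (simp add: velocity_def)
  have "smooth_on ?I (velocity c \<gamma>)"
    using smooth_on_vector_derivative(1)[OF o p] by (simp add: velocity_def[abs_def])
  from smooth_on_vector_derivative(2)[OF o this t]
  show "(velocity c \<gamma> has_vector_derivative acceleration c \<gamma> t) (at t)" by (simp add: acceleration_def)
qed

lemma curve_tangent_coords:
  "c \<in> A \<Longrightarrow> t \<in> I \<Longrightarrow> \<gamma> t \<in> fst c \<Longrightarrow> (position c \<gamma> t, velocity c \<gamma> t) \<in> tangent_coords U c"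
  using curve by (auto simp: tangent_coords_def base_coords_def position_def smooth_curve_def)

lemma gyroscopic_residual:
  assumes "c \<in> A" "t \<in> I" "\<gamma> t \<in> fst c" "smooth_on (tangent_coords U c) L"
  defines "z \<equiv> (position c \<gamma> t, velocity c \<gamma> t)"
  shows "deriv (\<lambda>s. dv i L (position c \<gamma> s, velocity c \<gamma> s)) t - dq i L z
      - (\<Sum>k\<in>UNIV. w (position c \<gamma> t) $ k $ i * velocity c \<gamma> t $ k) =
    gyro_form f L w i z + ((acceleration c \<gamma> t - f z) v* hess L z) $ i"
  unfolding z_def
  by (rule euler_lagrange_along_curve[OF assms(4) curve_tangent_coords[OF assms(1-3)] curve_derivatives[OF assms(1-3)]])

end

lemma second_order_fieldD:
  "second_order_field Q A f \<Longrightarrow> c \<in> A \<Longrightarrow> d \<in> A \<Longrightarrow> z \<in> tangent_coords (fst d) c \<Longrightarrow>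
    fderiv (tangent_transition c d) z (snd z, f c z) =
      (snd (tangent_transition c d z), f d (tangent_transition c d z))"
  unfolding second_order_field_def by blast

text \<open>With vanishing \<open>gyro_form\<close> the residual along any curve is the acceleration
  defect times the Hessian, and an invertible Hessian annihilates no nonzero defect. The two
  equations thus agree at each time and in each chart.\<close>

lemma gyro_form_zero_imp_equivalent:
  assumes atlas: "smooth_atlas Q A"
    and L: "\<And>c. c \<in> A \<Longrightarrow> smooth_on (tangent_coords U c) (L c)" and reg: "regular A U L"
    and EL: "\<And>c z i. c \<in> A \<Longrightarrow> z \<in> tangent_coords U c \<Longrightarrow> gyro_form (f c) (L c) (w c) i z = 0"
  shows "equations_equivalent Q A U L w f"
  unfolding equations_equivalent_def
proof (intro allI impI)
  fix I \<gamma> assume curve: "smooth_curve Q A U I \<gamma>"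
  have "(\<forall>i. deriv (\<lambda>s. dv i (L c) (position c \<gamma> s, velocity c \<gamma> s)) t - dq i (L c) (position c \<gamma> t, velocity c \<gamma> t)
        = (\<Sum>k\<in>UNIV. w c (position c \<gamma> t) $ k $ i * velocity c \<gamma> t $ k))
      \<longleftrightarrow> acceleration c \<gamma> t = f c (position c \<gamma> t, velocity c \<gamma> t)"
    if c: "c \<in> A" "t \<in> I" "\<gamma> t \<in> fst c" for c t
  proof -
    define z where "z = (position c \<gamma> t, velocity c \<gamma> t)"
    have z: "z \<in> tangent_coords U c" unfolding z_def by (rule curve_tangent_coords[OF atlas curve c])
    define u where "u = acceleration c \<gamma> t - f c z"
    have res: "deriv (\<lambda>s. dv i (L c) (position c \<gamma> s, velocity c \<gamma> s)) t - dq i (L c) z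
        - (\<Sum>k\<in>UNIV. w c (position c \<gamma> t) $ k $ i * velocity c \<gamma> t $ k) = (u v* hess (L c) z) $ i" for i
      using gyroscopic_residual[OF atlas curve c L[OF c(1)], of i "w c" "f c", folded z_def u_def]
        EL[OF c(1) z, of i] by simp
    have "invertible (hess (L c) z)"
      using reg c(1) z by (simp add: regular_def hess_def)
    then obtain B where B: "hess (L c) z ** B = mat 1" unfolding invertible_def by blast
    have "u v* hess (L c) z = 0 \<longleftrightarrow> u = 0"
    proof
      assume "u v* hess (L c) z = 0"
      then have "(u v* hess (L c) z) v* B = 0" by simp
      then show "u = 0" by (simp add: vector_matrix_mul_assoc B)
    qed simp
    then have "(\<forall>i. (u v* hess (L c) z) $ i = 0) \<longleftrightarrow> acceleration c \<gamma> t = f c z"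
      by (simp add: vec_eq_iff u_def)
    moreover have "deriv (\<lambda>s. dv i (L c) (position c \<gamma> s, velocity c \<gamma> s)) t - dq i (L c) z
        = (\<Sum>k\<in>UNIV. w c (position c \<gamma> t) $ k $ i * velocity c \<gamma> t $ k) \<longleftrightarrow> (u v* hess (L c) z) $ i = 0" for i
      using res[of i] by auto
    ultimately show ?thesis
      unfolding z_def by simp
  qed
  then show "solves_gyroscopic A L w I \<gamma> \<longleftrightarrow> solves_second_order A f I \<gamma>"
    unfolding solves_gyroscopic_def solves_second_order_def by blast
qed

text \<open>An integral curve through \<open>z\<close> is found in the tangent coordinates of
  \<open>c\<close>. Most of the work lies in making it a smooth curve in \<open>Q\<close> that
  solves the second-order equation in every chart, since only then can the equivalence be
  applied.\<close>

lemma equivalent_imp_gyro_form_zero: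
  fixes Q :: "'q topology" and A :: "('q, 'n::finite) chart set"
  assumes atlas: "smooth_atlas Q A" and sof: "second_order_field Q A f" and U: "openin Q U"
    and L: "\<And>c. c \<in> A \<Longrightarrow> smooth_on (tangent_coords U c) (L c)"
    and eq: "equations_equivalent Q A U L w f" and c: "c \<in> A" and z: "z \<in> tangent_coords U c"
  shows "gyro_form (f c) (L c) (w c) i z = 0"
proof -
  let ?S = "base_coords U c"
  have Usub: "U \<subseteq> topspace Q" by (rule openin_subset[OF U])
  define F where "F y = (snd y, f c y)" for y
  have sf: "smooth_on (tangent_coords U c) (f c)"
  proof (rule smooth_on_subset)
    show "smooth_on (tangent_coords (topspace Q) c) (f c)"
      using sof c by (simp add: second_order_field_def)
  qed (use Usub in \<open>auto simp: tangent_coords_def base_coords_def\<close>)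
  note oW = open_tangent_coords[OF atlas c U]
  have sF: "smooth_on (tangent_coords U c) F"
    unfolding F_def by (intro smooth_on_Pair smooth_on_snd sf oW)
  obtain e y where e: "e > 0" "y 0 = z" and yW: "\<And>t. t \<in> {-e<..<e} \<Longrightarrow> y t \<in> tangent_coords U c"
    and ode: "\<And>t. t \<in> {-e<..<e} \<Longrightarrow> (y has_vector_derivative F (y t)) (at t)"
    by (rule ode_local_solution[OF oW sF z]) blast
  define I where "I = {-e<..<e}"
  have I: "open I" "0 \<in> I" "is_interval I" using e by (auto simp: I_def is_interval_oo)
  have sy: "smooth_on I y"
  proof (rule ode_solution_smooth[OF oW sF I(1)])
    show "y ` I \<subseteq> tangent_coords U c" unfolding I_def using yW by blast
    show "(y has_vector_derivative F (y t)) (at t)" if "t \<in> I" for t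
      using ode that by (simp add: I_def)
  qed
  have cy: "continuous_on I y" by (rule smooth_on_continuous_on[OF sy])
  define \<gamma> where "\<gamma> t = inv_into (fst c) (snd c) (fst (y t))" for t
  have in_S: "fst (y t) \<in> ?S" if "t \<in> I" for t
    using yW[of t] that by (auto simp: I_def tangent_coords_def)
  have gam: "\<gamma> t \<in> U \<inter> fst c" "snd c (\<gamma> t) = fst (y t)" if "t \<in> I" for t
    using in_S[OF that] chart_inj_on[OF atlas c] by (auto simp: \<gamma>_def base_coords_def)
  \<comment> \<open>Injectivity of the chart \<open>c\<close> lets membership in another chart
    domain be read off from coordinates; this yields openness of the set of such times.\<close>
  have in_dom: "\<gamma> t \<in> fst d \<longleftrightarrow> fst (y t) \<in> base_coords (fst d) c" 
    if t: "t \<in> I" for t and d :: "('q, 'n) chart"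
  proof
    assume "\<gamma> t \<in> fst d"
    then have "snd c (\<gamma> t) \<in> base_coords (fst d) c"
      unfolding base_coords_def using gam(1)[OF t] by blast
    then show "fst (y t) \<in> base_coords (fst d) c" by (simp only: gam(2)[OF t])
  next
    assume "fst (y t) \<in> base_coords (fst d) c"
    then obtain p where p: "p \<in> fst d" "p \<in> fst c" "snd c p = snd c (\<gamma> t)"
      unfolding base_coords_def gam(2)[OF t, symmetric] by auto
    then have "p = \<gamma> t"
      using inj_onD[OF chart_inj_on[OF atlas c] p(3)] gam(1)[OF t] by blast
    then show "\<gamma> t \<in> fst d" using p(1) by simp
  qed
  have snd_gam: "snd d (\<gamma> t) = transition c d (fst (y t))" if "t \<in> I" for t and d :: "('q, 'n) chart"
    by (simp add: transition_def \<gamma>_def)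
  have oI: "open {t \<in> I. \<gamma> t \<in> fst d}" if "d \<in> A" for d
  proof -
    have "open (I \<inter> (\<lambda>t. fst (y t)) -` base_coords (fst d) c)"
      by (rule continuous_open_preimage[OF continuous_on_fst[OF cy] I(1) open_base_coords[OF atlas c chart_domain_open[OF atlas that]]])
    also have "I \<inter> (\<lambda>t. fst (y t)) -` base_coords (fst d) c = {t \<in> I. \<gamma> t \<in> fst d}"
      using in_dom by auto
    finally show ?thesis .
  qed
  have sdc: "smooth_on (base_coords (fst d) c) (transition c d)" if "d \<in> A" for d
    using smooth_on_transition[OF atlas c that, of UNIV] by simp
  have obd: "open (base_coords (fst d) c)" if "d \<in> A" for d
    by (rule open_base_coords[OF atlas c chart_domain_open[OF atlas that]])
  have curve: "smooth_curve Q A U I \<gamma>"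
    unfolding smooth_curve_def
  proof (intro conjI ballI)
    show "\<gamma> ` I \<subseteq> U" using gam by auto
    \<comment> \<open>Along the curve the inverse homeomorphism of the chart agrees with
      \<open>inv_into\<close>, which gives continuity into \<open>Q\<close>.\<close>
    obtain g where g: "homeomorphic_maps (subtopology Q (fst c)) (top_of_set (snd c ` fst c)) (snd c) g"
      using chart_homeomorphic[OF atlas c] by (auto simp: homeomorphic_map_maps)
    have "continuous_map (top_of_set I) (top_of_set (snd c ` fst c)) (\<lambda>t. fst (y t))"
      using continuous_on_fst[OF cy] in_S by (auto simp: base_coords_def)
    then have "continuous_map (top_of_set I) (subtopology Q (fst c)) (g \<circ> (\<lambda>t. fst (y t)))"
      using g by (intro continuous_map_compose) (auto simp: homeomorphic_maps_def)
    then have "continuous_map (top_of_set I) Q (g \<circ> (\<lambda>t. fst (y t)))"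
      by (simp add: continuous_map_in_subtopology)
    moreover have "g (fst (y t)) = \<gamma> t" if "t \<in> I" for t
    proof -
      have "g (snd c (\<gamma> t)) = \<gamma> t"
        using g gam(1)[OF that] Usub by (auto simp: homeomorphic_maps_def)
      then show ?thesis using gam(2)[OF that] by simp
    qed
    ultimately show "continuous_map (top_of_set I) Q \<gamma>"
      by (elim continuous_map_eq) auto
    fix d assume d: "d \<in> A"
    show "smooth_on {t \<in> I. \<gamma> t \<in> fst d} (\<lambda>t. snd d (\<gamma> t))"
    proof (rule smooth_on_cong[OF oI[OF d]])
      show "smooth_on {t \<in> I. \<gamma> t \<in> fst d} (\<lambda>t. transition c d (fst (y t)))"
      proof (rule smooth_on_compose[OF oI[OF d] obd[OF d] sdc[OF d]])
        show "smooth_on {t \<in> I. \<gamma> t \<in> fst d} (\<lambda>t. fst (y t))"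
          by (intro smooth_on_linear_compose[OF bounded_linear_fst] oI[OF d] smooth_on_subset[OF sy]) auto
      qed (use in_dom in auto)
    qed (simp add: snd_gam)
  qed (use I in auto)
  \<comment> \<open>In the chart \<open>d\<close> the lifted curve is the image of \<open>y\<close>
    under the tangent transition. This map carries the field of \<open>f c\<close> to that of
    \<open>f d\<close>, so velocity and acceleration are the components of the transformed
    field.\<close>
  have pv: "position d \<gamma> t = fst (tangent_transition c d (y t)) \<and> velocity d \<gamma> t = snd (tangent_transition c d (y t))"
    and acc: "acceleration d \<gamma> t = f d (tangent_transition c d (y t))"
    if d: "d \<in> A" "t \<in> I" "\<gamma> t \<in> fst d" for d t
  proof -
    let ?I = "{t \<in> I. \<gamma> t \<in> fst d}" and ?T = "tangent_transition c d"
    have yT: "y s \<in> base_coords (fst d) c \<times> UNIV" if "s \<in> ?I" for s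
      using that in_dom[of s d] by (auto simp: mem_Times_iff)
    have DT: "((\<lambda>s. ?T (y s)) has_vector_derivative (snd (?T (y s)), f d (?T (y s)))) (at s)" if s: "s \<in> ?I" for s
    proof -
      have "(?T has_derivative fderiv ?T (y s)) (at (y s))"
        unfolding tangent_transition_tmap
        by (rule smooth_on_has_derivative[OF smooth_on_tmap[OF obd[OF d(1)] sdc[OF d(1)]] yT[OF s]])
      moreover have "(y has_derivative (\<lambda>r. r *\<^sub>R F (y s))) (at s)"
        using ode s by (auto simp: I_def has_vector_derivative_def)
      ultimately have "((\<lambda>s. ?T (y s)) has_derivative (\<lambda>r. fderiv ?T (y s) (r *\<^sub>R F (y s)))) (at s)"
        using has_derivative_compose by blast
      moreover have "fderiv ?T (y s) (r *\<^sub>R F (y s)) = r *\<^sub>R fderiv ?T (y s) (F (y s))" for r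
        unfolding tangent_transition_tmap
        by (rule linear_cmul[OF linear_frechet_derivative_smooth[OF smooth_on_tmap[OF obd[OF d(1)] sdc[OF d(1)]] yT[OF s]]])
      moreover have "fderiv ?T (y s) (F (y s)) = (snd (?T (y s)), f d (?T (y s)))"
        unfolding F_def by (rule second_order_fieldD[OF sof c d(1)]) (use yT[OF s] in \<open>simp add: tangent_coords_def\<close>)
      ultimately show ?thesis by (simp add: has_vector_derivative_def)
    qed
    have pos: "position d \<gamma> s = fst (?T (y s))" if "s \<in> ?I" for s
      using that snd_gam by (simp add: position_def tangent_transition_tmap tmap_def)
    have vel: "velocity d \<gamma> s = snd (?T (y s))" if s: "s \<in> ?I" for s
    proof -
      have "((\<lambda>s. fst (?T (y s))) has_vector_derivative snd (?T (y s))) (at s)"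
        using bounded_linear.has_vector_derivative[OF bounded_linear_fst DT[OF s]] by simp
      then have "(position d \<gamma> has_vector_derivative snd (?T (y s))) (at s)"
        by (rule has_vector_derivative_transform_within_open[OF _ oI[OF d(1)] s]) (rule pos[symmetric])
      then show ?thesis by (simp add: velocity_def vector_derivative_at)
    qed
    have t: "t \<in> ?I" using d by simp
    show "position d \<gamma> t = fst (?T (y t)) \<and> velocity d \<gamma> t = snd (?T (y t))"
      using pos[OF t] vel[OF t] by simp
    have "((\<lambda>s. snd (?T (y s))) has_vector_derivative f d (?T (y t))) (at t)"
      using bounded_linear.has_vector_derivative[OF bounded_linear_snd DT[OF t]] by simp
    then have "(velocity d \<gamma> has_vector_derivative f d (?T (y t))) (at t)"
      by (rule has_vector_derivative_transform_within_open[OF _ oI[OF d(1)] t]) (rule vel[symmetric])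
    then show "acceleration d \<gamma> t = f d (?T (y t))" by (simp add: acceleration_def vector_derivative_at)
  qed
  have "solves_second_order A f I \<gamma>"
    unfolding solves_second_order_def using pv acc by simp
  then have gyr: "solves_gyroscopic A L w I \<gamma>"
    using eq curve by (simp add: equations_equivalent_def)
  have c0: "\<gamma> 0 \<in> fst c" using gam[OF I(2)] by auto
  have z0: "(position c \<gamma> 0, velocity c \<gamma> 0) = z"
  proof -
    have y0: "y 0 \<in> tangent_coords U c" using yW I(2) by (simp add: I_def)
    have fy: "((\<lambda>s. fst (y s)) has_vector_derivative snd (y 0)) (at 0)"
      using bounded_linear.has_vector_derivative[OF bounded_linear_fst ode[of 0]] e by (simp add: F_def)
    have "(position c \<gamma> has_vector_derivative snd (y 0)) (at 0)"
      by (rule has_vector_derivative_transform_within_open[OF fy I(1,2)]) (simp add: position_def gam(2))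
    then show ?thesis
      using gam(2)[OF I(2)] e(2) by (simp add: velocity_def vector_derivative_at position_def prod_eq_iff)
  qed
  have "acceleration c \<gamma> 0 = f c z"
    using \<open>solves_second_order A f I \<gamma>\<close> c I(2) c0 z0 by (simp add: solves_second_order_def)
  moreover have "deriv (\<lambda>s. dv i (L c) (position c \<gamma> s, velocity c \<gamma> s)) 0 - dq i (L c) z
      = (\<Sum>k\<in>UNIV. w c (position c \<gamma> 0) $ k $ i * velocity c \<gamma> 0 $ k)"
    using gyr[unfolded solves_gyroscopic_def, rule_format, OF c I(2) c0, of i] by (simp only: z0)
  \<comment> \<open>At time 0 the acceleration defect vanishes, so the residual of the gyroscopic
    equation is exactly \<open>gyro_form\<close> at \<open>z\<close>.\<close>
  ultimately show ?thesis
    using gyroscopic_residual[OF atlas curve c I(2) c0 L[OF c], of i "w c" "f c", unfolded z0]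
    by simp
qed

section \<open>The local equivalence\<close>

lemma base_coords_mono: "V \<subseteq> U \<Longrightarrow> base_coords V c \<subseteq> base_coords U c"
  by (auto simp: base_coords_def)

lemma tangent_coords_mono: "V \<subseteq> U \<Longrightarrow> tangent_coords V c \<subseteq> tangent_coords U c"
  using base_coords_mono[of V U c] by (auto simp: tangent_coords_def)

lemma basic_two_form_subset: "basic_two_form A U w \<Longrightarrow> V \<subseteq> U \<Longrightarrow> basic_two_form A V w"
  unfolding basic_two_form_def
  by (meson base_coords_mono Int_mono order_refl smooth_on_subset subsetD)

lemma DV_eq_sum:
  "DV g z X Y Z = (\<Sum>k\<in>UNIV. \<Sum>i\<in>UNIV. \<Sum>j\<in>UNIV. X $ k * Y $ i * Z $ j * dv k (\<lambda>y. g y $ i $ j) z)"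
proof -
  have "DV g z X Y Z = (\<Sum>i\<in>UNIV. \<Sum>j\<in>UNIV. \<Sum>k\<in>UNIV. X $ k * Y $ i * Z $ j * dv k (\<lambda>y. g y $ i $ j) z)"
    by (simp add: DV_def tensor_val_def sum_distrib_left sum_distrib_right mult_ac)
  then show ?thesis by (rule trans[OF _ sum_rotate3[symmetric]])
qed

lemma DV_axis: "DV g z (axis k 1) (axis i 1) (axis j 1) = dv k (\<lambda>y. g y $ i $ j) z"
  by (simp add: DV_def tensor_val_axis_right sum_axis_right)
    (simp add: sum_axis_right mult.commute[of "axis k 1 $ _"])

text \<open>The components of \<open>DV (hess L)\<close> are third vertical derivatives of
  \<open>L\<close>, and vertical derivatives commute.\<close>

lemma DV_hess_symmetric:
  assumes "open W" "smooth_on W L" "z \<in> W"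
  shows "DV (hess L) z X Y Z = DV (hess L) z Y X Z" "DV (hess L) z X Y Z = DV (hess L) z X Z Y"
proof -
  have a: "dv k (\<lambda>y. hess L y $ i $ j) z = dv k (\<lambda>y. hess L y $ j $ i) z" for i j k
    by (rule dv_transform_open[OF assms(1,3)]) (rule hess_symmetric[OF assms(1,2)])
  have b: "dv k (\<lambda>y. hess L y $ i $ j) z = dv i (\<lambda>y. hess L y $ k $ j) z" for i j k
    using dv_commute[OF assms(1) smooth_on_dv[OF assms(2), of j] assms(3), of k i] by (simp add: hess_def)
  have "DV (hess L) z X Y Z = (\<Sum>i\<in>UNIV. \<Sum>k\<in>UNIV. \<Sum>j\<in>UNIV. X $ k * Y $ i * Z $ j * dv k (\<lambda>y. hess L y $ i $ j) z)"
    unfolding DV_eq_sum by (rule sum.swap)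
  also have "\<dots> = DV (hess L) z Y X Z"
    unfolding DV_eq_sum
  proof (intro sum.cong refl)
    fix i k j
    show "X $ k * Y $ i * Z $ j * dv k (\<lambda>y. hess L y $ i $ j) z = Y $ i * X $ k * Z $ j * dv i (\<lambda>y. hess L y $ k $ j) z"
      using b[of k i j] by simp
  qed
  finally show "DV (hess L) z X Y Z = DV (hess L) z Y X Z" .
  have "DV (hess L) z X Y Z = (\<Sum>k\<in>UNIV. \<Sum>j\<in>UNIV. \<Sum>i\<in>UNIV. X $ k * Y $ i * Z $ j * dv k (\<lambda>y. hess L y $ i $ j) z)"
    unfolding DV_eq_sum by (rule sum.cong[OF refl sum.swap])
  also have "\<dots> = DV (hess L) z X Z Y"
    unfolding DV_eq_sum
  proof (intro sum.cong refl)
    fix k j i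
    show "X $ k * Y $ i * Z $ j * dv k (\<lambda>y. hess L y $ i $ j) z = X $ k * Z $ j * Y $ i * dv k (\<lambda>y. hess L y $ j $ i) z"
      using a[of k i j] by simp
  qed
  finally show "DV (hess L) z X Y Z = DV (hess L) z X Z Y" .
qed

lemma smooth_on_second_order_coefficients:
  assumes "second_order_field Q A f" "c \<in> A" "openin Q U"
  shows "smooth_on (tangent_coords U c) (f c)"
  by (rule smooth_on_subset[OF _ tangent_coords_mono[OF openin_subset[OF assms(3)]]])
    (use assms(1,2) in \<open>simp add: second_order_field_def\<close>)

lemma hess_tensorial:
  fixes Q :: "'q topology" and A :: "('q, 'n::finite) chart set"
  assumes atlas: "smooth_atlas Q A" and U: "openin Q U" and c: "c \<in> A" "d \<in> A"
    and L: "smooth_on (tangent_coords U d) (L d)"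
    and eq: "\<And>z. z \<in> tangent_coords (U \<inter> fst d) c \<Longrightarrow> L c z = L d (tangent_transition c d z)"
    and z: "z \<in> tangent_coords (U \<inter> fst d) c"
  shows "tensor_val (hess (L c) z) X Y = tensor_val (hess (L d) (tangent_transition c d z))
    (jacobian_map c d (fst z) X) (jacobian_map c d (fst z) Y)"
proof -
  have o: "openin Q (U \<inter> fst d)" by (intro openin_Int U chart_domain_open[OF atlas c(2)])
  have "hess (L c) z = hess (\<lambda>z. L d (tmap (transition c d) z)) z"
    by (rule hess_transform_open[OF open_tangent_coords[OF atlas c(1) o] z])
      (simp add: eq tangent_transition_tmap)
  then show ?thesis
    using hess_compose_tmap[OF open_base_coords[OF atlas c(1) o] smooth_on_transition[OF atlas c]
        open_base_coords[OF atlas c(2) U], of "L d" z X Y] z L transition_base_coords[OF atlas c(1), of _ U d]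
    by (auto simp: tangent_coords_def tangent_transition_tmap jacobian_map_def)
qed

lemma gyroscopic_imp_tensor:
  fixes Q :: "'q topology" and A :: "('q, 'n::finite) chart set"
  assumes atlas: "smooth_atlas Q A" and sof: "second_order_field Q A f" and U: "openin Q U"
    and L: "tangent_function A U L" and reg: "regular A U L" and w: "basic_two_form A U w"
    and eq: "equations_equivalent Q A U L w f"
  defines "g \<equiv> \<lambda>c. hess (L c)"
  shows "tensor02_along A U g" "nonsingular A U g" "symmetric_tensor A U g" "DV_symmetric A U g"
    "nabla_zero A U f g" "jacobi_condition A U f g w"
proof -
  have sL: "smooth_on (tangent_coords U c) (L c)" if "c \<in> A" for c
    using L that by (simp add: tangent_function_def)
  note oW = open_tangent_coords[OF atlas _ U]
  show "tensor02_along A U g"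
    unfolding tensor02_along_def
  proof (intro conjI ballI allI)
    show "smooth_on (tangent_coords U c) (g c)" if "c \<in> A" for c
      unfolding g_def by (rule smooth_on_hess[OF oW[OF that] sL[OF that]])
    fix c d z X Y assume cd: "c \<in> A" "d \<in> A" "z \<in> tangent_coords (U \<inter> fst d) c"
    show "tensor_val (g c z) X Y = tensor_val (g d (tangent_transition c d z)) (jacobian_map c d (fst z) X) (jacobian_map c d (fst z) Y)"
      unfolding g_def
      by (rule hess_tensorial[where L = L, OF atlas U cd(1,2) sL[OF cd(2)] _ cd(3)])
        (use L cd in \<open>auto simp: tangent_function_def\<close>)
  qed
  show "nonsingular A U g"
    using reg by (simp add: nonsingular_def regular_def g_def hess_def)
  show "symmetric_tensor A U g"
    unfolding symmetric_tensor_def g_def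
  proof (intro ballI allI)
    fix c z X Y assume c: "c \<in> A" "z \<in> tangent_coords U c"
    show "tensor_val (hess (L c) z) X Y = tensor_val (hess (L c) z) Y X"
      unfolding tensor_val_def
      by (subst sum.swap, intro sum.cong refl)
        (simp add: hess_symmetric[OF oW[OF c(1)] sL[OF c(1)] c(2)] mult_ac)
  qed
  show "DV_symmetric A U g"
    unfolding DV_symmetric_def g_def using DV_hess_symmetric[OF oW sL] by blast
  have EL: "gyro_form (f c) (L c) (w c) i z = 0" if "c \<in> A" "z \<in> tangent_coords U c" for c z i
    by (rule equivalent_imp_gyro_form_zero[OF atlas sof U sL eq that])
  have cond: "nabla (f c) (hess (L c)) z = 0"
    "tensor_val (hess (L c) z) (jacobi (f c) z *v X) Y - tensor_val (hess (L c) z) X (jacobi (f c) z *v Y)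
      = dH (f c) (pullback (w c)) z (snd z) X Y"
    if c: "c \<in> A" "z \<in> tangent_coords U c" for c z X Y
  proof -
    have "open (base_coords U c)" "smooth_on (base_coords U c) (w c)"
      "smooth_on (base_coords U c \<times> UNIV) (f c)" "smooth_on (base_coords U c \<times> UNIV) (L c)"
      using open_base_coords[OF atlas c(1) U] w c(1) sL[OF c(1)] smooth_on_second_order_coefficients[OF sof c(1) U]
      by (auto simp: basic_two_form_def tangent_coords_def)
    note facts = gyroscopic_imp_conditions[OF this, of z]
    have skew: "w c x $ i $ j = - w c x $ j $ i" if "x \<in> base_coords U c" for x i j
      using w c(1) that unfolding basic_two_form_def by blast
    show "nabla (f c) (hess (L c)) z = 0"
      by (rule facts(1)[OF skew]) (use EL c in \<open>auto simp: tangent_coords_def\<close>)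
    show "tensor_val (hess (L c) z) (jacobi (f c) z *v X) Y - tensor_val (hess (L c) z) X (jacobi (f c) z *v Y)
      = dH (f c) (pullback (w c)) z (snd z) X Y"
      by (rule facts(2)[OF skew]) (use EL c in \<open>auto simp: tangent_coords_def\<close>)
  qed
  show "nabla_zero A U f g" using cond(1) by (simp add: nabla_zero_def g_def)
  show "jacobi_condition A U f g w" using cond(2) by (simp add: jacobi_condition_def g_def)
qed

text \<open>Since the potentials involve choices, the Lagrangian is constructed in one chart
  \<open>c\<close> around \<open>p\<close> and carried to the others. The neighbourhood shrinks to
  the preimage \<open>V\<close> of a coordinate ball, where the Poincare lemmas are available and
  which lies in the domain of \<open>c\<close>.\<close>

lemma tensor_imp_gyroscopic:
  fixes Q :: "'q topology" and A :: "('q, 'n::finite) chart set"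
  assumes atlas: "smooth_atlas Q A" and sof: "second_order_field Q A f" and U: "openin Q U" "p \<in> U"
    and w: "basic_two_form A U w" and g: "tensor02_along A U g" "nonsingular A U g" "symmetric_tensor A U g" "DV_symmetric A U g"
      "nabla_zero A U f g" "jacobi_condition A U f g w"
  shows "\<exists>V L. openin Q V \<and> p \<in> V \<and> tangent_function A V L \<and> regular A V L \<and> basic_two_form A V w \<and>
    equations_equivalent Q A V L w f"
proof -
  have "p \<in> topspace Q" using openin_subset[OF U(1)] U(2) by blast
  then obtain c where c: "c \<in> A" "p \<in> fst c" using atlas unfolding smooth_atlas_def by blast
  have "snd c p \<in> base_coords U c" using c U by (auto simp: base_coords_def)
  then obtain r where r: "r > 0" "ball (snd c p) r \<subseteq> base_coords U c"
    using open_base_coords[OF atlas c(1) U(1)] open_contains_ball by blast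
  define B where "B = ball (snd c p) r"
  define V where "V = {q \<in> U \<inter> fst c. snd c q \<in> B}"
  have V: "V \<subseteq> U" "V \<subseteq> fst c" "p \<in> V" using U c r by (auto simp: V_def B_def)
  have BV: "base_coords V c = B" using r by (auto simp: V_def B_def base_coords_def)
  have "continuous_map (subtopology Q (fst c)) (top_of_set (snd c ` fst c)) (snd c)"
    using chart_homeomorphic[OF atlas c(1)] by (rule homeomorphic_imp_continuous_map)
  then have "continuous_map (subtopology Q (fst c)) euclidean (snd c)"
    by (simp add: continuous_map_in_subtopology)
  then have "openin (subtopology Q (fst c)) {q \<in> topspace (subtopology Q (fst c)). snd c q \<in> B}"
    by (rule openin_continuous_map_preimage) (simp add: B_def)
  then have "openin Q {q \<in> topspace (subtopology Q (fst c)). snd c q \<in> B}"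
    using openin_trans_full chart_domain_open[OF atlas c(1)] by blast
  then have "openin Q (U \<inter> {q \<in> topspace (subtopology Q (fst c)). snd c q \<in> B})"
    by (intro openin_Int U(1))
  also have "U \<inter> {q \<in> topspace (subtopology Q (fst c)). snd c q \<in> B} = V"
    using openin_subset[OF U(1)] by (auto simp: V_def)
  finally have oV: "openin Q V" .
  have B: "open B" "smooth_on B (w c)" "smooth_on (B \<times> UNIV) (f c)" "smooth_on (B \<times> UNIV) (g c)"
  proof -
    show "open B" by (simp add: B_def)
    have "smooth_on (base_coords V c) (w c)"
      using basic_two_form_subset[OF w V(1)] c(1) by (simp add: basic_two_form_def)
    then show "smooth_on B (w c)" by (simp only: BV)
    show "smooth_on (B \<times> UNIV) (f c)"
      using smooth_on_second_order_coefficients[OF sof c(1) oV] by (simp only: tangent_coords_def BV)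
    have "smooth_on (tangent_coords U c) (g c)"
      using g(1) c(1) by (simp add: tensor02_along_def)
    from smooth_on_subset[OF this tangent_coords_mono[OF V(1)]]
    show "smooth_on (B \<times> UNIV) (g c)" by (simp only: tangent_coords_def BV)
  qed
  have inU: "z \<in> tangent_coords U c" if "z \<in> B \<times> UNIV" for z
    using that r by (auto simp: tangent_coords_def B_def)
  obtain L0 where L0: "smooth_on (B \<times> UNIV) L0" "\<And>z. z \<in> B \<times> UNIV \<Longrightarrow> hess L0 z = g c z"
    "\<And>z i. z \<in> B \<times> UNIV \<Longrightarrow> gyro_form (f c) L0 (w c) i z = 0"
  proof (rule exists_gyroscopic_lagrangian[OF B])
    show "snd c p + s *\<^sub>R (x - snd c p) \<in> B" if "x \<in> B" "0 \<le> s" "s \<le> 1" for x s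
    proof -
      have "s * norm (x - snd c p) \<le> norm (x - snd c p)" using that by (simp add: mult_left_le_one_le)
      then show ?thesis using that by (simp add: B_def dist_norm norm_minus_commute)
    qed
    show "w c x $ i $ j = - w c x $ j $ i" if "x \<in> B" for x i j
      using w c(1) that r unfolding basic_two_form_def B_def by blast
    fix z :: "'n tcoord" assume z: "z \<in> B \<times> UNIV"
    note zU = inU[OF z]
    show "g c z $ i $ j = g c z $ j $ i" for i j
      using g(3) c(1) zU tensor_val_axis_right[of "g c z" "axis i 1" j] tensor_val_axis_right[of "g c z" "axis j 1" i]
      by (simp add: symmetric_tensor_def sum_axis_right)
    show "dv k (\<lambda>y. g c y $ i $ j) z = dv j (\<lambda>y. g c y $ i $ k) z" for i j k
      using g(4) c(1) zU unfolding DV_symmetric_def by (metis DV_axis)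
    show "nabla (f c) (g c) z = 0" using g(5) c(1) zU by (simp add: nabla_zero_def)
    show "tensor_val (g c z) (jacobi (f c) z *v X) Y - tensor_val (g c z) X (jacobi (f c) z *v Y)
      = dH (f c) (pullback (w c)) z (snd z) X Y" for X Y
      using g(6) c(1) zU by (simp add: jacobi_condition_def)
  qed auto
  \<comment> \<open>As \<open>V\<close> lies in the domain of \<open>c\<close>, the tangent
    transition from any chart \<open>d\<close> to \<open>c\<close> is defined over all of
    \<open>V\<close>, and one formula gives every coordinate expression.\<close>
  define L where "L d z = L0 (tangent_transition d c z)" for d z
  have Vc: "V \<inter> fst c = V" using V(2) by blast
  have T_in: "tangent_transition d c z \<in> B \<times> UNIV" if "d \<in> A" "z \<in> tangent_coords V d" for d z
    using tangent_transition_in[OF atlas that(1), of z V c] that(2) by (simp add: Vc tangent_coords_def BV)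
  have sT: "smooth_on (tangent_coords V d) (tangent_transition d c)" if "d \<in> A" for d
    using smooth_on_tangent_transition[OF atlas that c(1) oV] by (simp add: Vc)
  have sL: "smooth_on (tangent_coords V d) (L d)" if "d \<in> A" for d
    unfolding L_def
    by (rule smooth_on_compose[OF open_tangent_coords[OF atlas that oV] open_tube[OF B(1)] L0(1) sT[OF that]])
      (use T_in[OF that] in blast)
  have Lfun: "tangent_function A V L"
    unfolding tangent_function_def
  proof (intro conjI ballI)
    fix d e z assume de: "d \<in> A" "e \<in> A" "z \<in> tangent_coords (V \<inter> fst e) d"
    then have "z \<in> tangent_coords (fst e \<inter> fst c) d"
      using tangent_coords_mono[of "V \<inter> fst e" "fst e \<inter> fst c" d] V(2) by blast
    from tangent_transition_cocycle[OF atlas de(1,2) c(1) this]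
    show "L d z = L e (tangent_transition d e z)" by (simp add: L_def)
  qed (rule sL)
  have phi: "open (base_coords V d)" "smooth_on (base_coords V d) (transition d c)" "transition d c ` base_coords V d \<subseteq> B"
    if "d \<in> A" for d
    using open_base_coords[OF atlas that oV] smooth_on_transition[OF atlas that c(1), of V]
      transition_base_coords[OF atlas that, of _ V c] by (auto simp: Vc BV)
  have VU: "tangent_coords V d \<subseteq> tangent_coords (U \<inter> fst c) d" for d
    by (rule tangent_coords_mono) (use V in blast)
  \<comment> \<open>Both sides obey the same tensor law under the transition to \<open>c\<close>,
    where they agree by construction; nonsingularity of \<open>g\<close> then yields regularity in
    every chart.\<close>
  have hessL: "hess (L d) z = g d z" if d: "d \<in> A" "z \<in> tangent_coords V d" for d z
  proof (rule matrix_eq_tensor_val)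
    fix X Y
    have "tensor_val (hess (L d) z) X Y = tensor_val (hess L0 (tmap (transition d c) z))
        (fderiv (transition d c) (fst z) X) (fderiv (transition d c) (fst z) Y)"
      unfolding L_def tangent_transition_tmap
      by (rule hess_compose_tmap[OF phi(1,2)[OF d(1)] B(1) phi(3)[OF d(1)] L0(1)])
        (use d(2) in \<open>simp add: tangent_coords_def\<close>)
    also have "\<dots> = tensor_val (g c (tangent_transition d c z)) (jacobian_map d c (fst z) X) (jacobian_map d c (fst z) Y)"
      using L0(2)[OF T_in[OF d]] by (simp add: tangent_transition_tmap jacobian_map_def)
    also have "\<dots> = tensor_val (g d z) X Y"
      using g(1)[unfolded tensor02_along_def, THEN conjunct2, rule_format, OF d(1) c(1) subsetD[OF VU d(2)], of X Y]
      by simp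
    finally show "tensor_val (hess (L d) z) X Y = tensor_val (g d z) X Y" .
  qed
  have reg: "regular A V L"
    unfolding regular_def
  proof (intro ballI)
    fix d z assume d: "d \<in> A" "z \<in> tangent_coords V d"
    have "invertible (g d z)"
      using g(2) d tangent_coords_mono[OF V(1)] unfolding nonsingular_def by blast
    then show "invertible (\<chi> i j. dv i (dv j (L d)) z)"
      using hessL[OF d] by (simp add: hess_def)
  qed
  \<comment> \<open>Covariance expresses this through the \<open>gyro_form\<close> of
    \<open>L0\<close> in the chart \<open>c\<close>, which vanishes; the transformation laws of
    \<open>f\<close> and \<open>w\<close> supply its hypotheses.\<close>
  have "gyro_form (f d) (L d) (w d) i z = 0" if d: "d \<in> A" "z \<in> tangent_coords V d" for d z i
  proof -
    have zUc: "z \<in> tangent_coords (U \<inter> fst c) d" using d VU by blast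
    have "gyro_form (f d) (\<lambda>z. L0 (tmap (transition d c) z)) (w d) i z =
      (\<Sum>j\<in>UNIV. fderiv (transition d c) (fst z) (axis i 1) $ j * gyro_form (f c) L0 (w c) j (tmap (transition d c) z))"
    proof (rule gyro_form_compose_tmap[OF phi(1,2)[OF d(1)] B(1) phi(3)[OF d(1)] L0(1)])
      show "z \<in> base_coords V d \<times> UNIV" using d(2) by (simp add: tangent_coords_def)
      show "fderiv (tmap (transition d c)) z (snd z, f d z) =
          (snd (tmap (transition d c) z), f c (tmap (transition d c) z))"
        using second_order_fieldD[OF sof d(1) c(1), of z] zUc tangent_coords_mono[of "U \<inter> fst c" "fst c" d]
        by (auto simp: tangent_transition_tmap)
      show "tensor_val (w d (fst z)) X Y = tensor_val (w c (transition d c (fst z)))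
          (fderiv (transition d c) (fst z) X) (fderiv (transition d c) (fst z) Y)" for X Y
        using w d(1) c(1) zUc by (auto simp: basic_two_form_def tangent_coords_def jacobian_map_def)
    qed
    then show ?thesis
      using L0(3)[OF T_in[OF d]] by (simp add: L_def[abs_def] tangent_transition_tmap)
  qed
  then have "equations_equivalent Q A V L w f"
    by (intro gyro_form_zero_imp_equivalent[OF atlas sL reg])
  then show ?thesis
    using oV V(3) Lfun reg basic_two_form_subset[OF w V(1)] by blast
qed

theorem theorem2:
  fixes Q :: "'q topology"
    and A :: "('q, 'n::finite) chart set"
    and f :: "('q, 'n) chart \<Rightarrow> 'n tcoord \<Rightarrow> real ^ 'n"
  assumes "smooth_atlas Q A"
    and "second_order_field Q A f"
  shows
    "(\<forall>p\<in>topspace Q. \<exists>U. openin Q U \<and> p \<in> U \<and>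
        (\<exists>L w. tangent_function A U L \<and> regular A U L \<and> basic_two_form A U w \<and>
               equations_equivalent Q A U L w f))
     \<longleftrightarrow>
     (\<forall>p\<in>topspace Q. \<exists>U. openin Q U \<and> p \<in> U \<and>
        (\<exists>w g. basic_two_form A U w \<and>
               tensor02_along A U g \<and> nonsingular A U g \<and> symmetric_tensor A U g \<and>
               DV_symmetric A U g \<and>
               nabla_zero A U f g \<and> jacobi_condition A U f g w))"
  (is "(\<forall>p\<in>_. ?lhs p) \<longleftrightarrow> (\<forall>p\<in>_. ?rhs p)")
proof (rule ball_cong[OF refl], rule iffI)
  fix p
  assume "?lhs p"
  then obtain U L w where U: "openin Q U" "p \<in> U"
    and L: "tangent_function A U L" "regular A U L" "basic_two_form A U w" "equations_equivalent Q A U L w f"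
    by blast
  show "?rhs p"
    using U L(3) gyroscopic_imp_tensor[OF assms U(1) L] by blast
next
  fix p
  assume "?rhs p"
  then obtain U w g where U: "openin Q U" "p \<in> U" "basic_two_form A U w" "tensor02_along A U g" "nonsingular A U g"
    "symmetric_tensor A U g" "DV_symmetric A U g" "nabla_zero A U f g" "jacobi_condition A U f g w" by blast
  show "?lhs p" using tensor_imp_gyroscopic[OF assms U] by blast
qed

end
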